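(* Let $X$ be a differentiable manifold, $G$ a finite dimensional connected Lie group, and let $(x_t,g_t)_{t\ge0}$ be a diffusion process with values in $X\times G$, with infinite lifetime and infinitesimal generator $\mathcal L$, satisfying the Dévissage, Convergence, Equivariance and Regularity conditions (all four are stated in the context), where $\mathrm{Inv}((x_t)_{t\ge0})$ is generated by a random variable $\ell_\infty$ with values in a separable measure space $(S,\mathcal G,\lambda)$ as in the Dévissage condition. Let $g_\infty$ denote the almost sure limit of $g_t$ as $t\to+\infty$. Then, for all starting points $(x,g)\in X\times G$, the two sigma fields $$\mathrm{Inv}((x_t,g_t)_{t\ge0})\quad\text{and}\quad\sigma(\ell_\infty,g_\infty)$$ coincide up to $\mathbb P_{(x,g)}$-negligible sets. Equivalently, if $H$ is a bounded $\mathcal L$-harmonic function, there exists a bounded measurable function $\psi$ on $S\times G$ such that $H(x,g)=\mathbb E_{(x,g)}[\psi(\ell_\infty,g_\infty)]$ for all $(x,g)\in X\times G$.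
   Context: Setting. The process $(x_t,g_t)_{t\ge0}$ is realized as the coordinate process on the path space $\Omega=C(\mathbb R^+,X\times G)$ with its Borel sigma field; $\mathbb P_{(x,g)}$ is the law of the diffusion started from $(x,g)$ and $\mathbb E_{(x,g)}$ the expectation. As usual, a diffusion with generator $\mathcal L$ (acting on $C^\infty(X\times G,\mathbb R)$) means that $(\mathbb P_{(x,g)})$ is a strong Markov family of laws on continuous paths, $\mathbb P_{(x,g)}$ being the unique solution of the martingale problem for $\mathcal L$ (with smooth compactly supported test functions) started at $(x,g)$. Invariant sigma field. Let $\theta_s\omega=(\omega_{t+s})_{t\ge0}$ be the shift operators and $\mathcal F^\infty=\bigcap_{t\ge0}\sigma((x_s,g_s),\,s\ge t)$ the tail sigma field. Then $\mathrm{Inv}((x_t,g_t)_{t\ge0})$ is the sigma field of all $A\in\mathcal F^\infty$ such that $\theta_s^{-1}A=A$ for all $s>0$. $\mathrm{Inv}((x_t)_{t\ge0})$ is defined in the same way from the process $(x_t)_{t\ge 0}$ alone. Action of $G$. For $g\in G$ and $f\in C^\infty(X\times G,\mathbb R)$, $(g\cdot f)(x,h):=f(x,gh)$. Harmonic functions. A bounded measurable $H:X\times G\to\mathbb R$ is $\mathcal L$-harmonic if $H(x,g)=\mathbb E_{(x,g)}[H(x_t,g_t)]$ for all $t\ge 0$ and all $(x,g)$; equivalently $H(x,g)=\mathbb E_{(x,g)}[Z]$ for some bounded shift-invariant $\mathrm{Inv}((x_t,g_t)_{t\ge0})$-measurable $Z$. Conditions. - Dévissage condition: $(x_t)_{t\ge0}$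 is itself a diffusion (a sub-diffusion of the full process) on $X$. Its own invariant sigma field $\mathrm{Inv}((x_t)_{t\ge0})$ is either trivial, or (the case of this statement) generated, up to negligible sets, by a random variable $\ell_\infty$ with values in a separable (i.e. countably generated) measure space $(S,\mathcal G,\lambda)$, with $\lambda$ a probability measure, and the law of $\ell_\infty$ (under each starting point) is absolutely continuous with respect to $\lambda$. - Convergence condition: for every $(x,g)\in X\times G$, $g_t$ converges $\mathbb P_{(x,g)}$-almost surely as $t\to\infty$ to a random variable $g_\infty$ in $G$. - Equivariance condition: $\mathcal L(g\cdot f)=g\cdot(\mathcal Lf)$ for all $g\in G$ and $f\in C^\infty(X\times G,\mathbb R)$. - Regularity condition: (bounded) $\mathcal L$-harmonic functions are continuous on $X\times G$. *)

theory Defs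
  imports "HOL-Probability.Probability" "HOL-Algebra.Group"
begin

section \<open>Smooth manifolds and Lie groups\<close>

primrec Ck_on :: "nat \<Rightarrow> ('e::real_normed_vector \<Rightarrow> 'f::real_normed_vector) \<Rightarrow> 'e set \<Rightarrow> bool" where
  "Ck_on 0 f S \<longleftrightarrow> continuous_on S f"
| "Ck_on (Suc k) f S \<longleftrightarrow>
     (\<forall>x\<in>S. f differentiable (at x)) \<and>
     (\<forall>v. Ck_on k (\<lambda>x. frechet_derivative f (at x) v) S)"

text \<open>
  Smoothness on an arbitrary subset of a Euclidean space: locally the restriction of a function that
  is \<open>C\<^sup>\<infinity>\<close> on an open set. On a relatively open subset of a linear subspace this is the usual
  \<open>C\<^sup>\<infinity>\<close> notion of that subspace.
\<close>

definition smooth_on :: "'e::real_normed_vector set \<Rightarrow> ('e \<Rightarrow> 'f::real_normed_vector) \<Rightarrow> bool" where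
  "smooth_on S f \<longleftrightarrow>
     (\<forall>x\<in>S. \<exists>T F. open T \<and> x \<in> T \<and> (\<forall>k. Ck_on k F T) \<and> (\<forall>y\<in>S \<inter> T. F y = f y))"

text \<open>
  Manifolds are types with a (Hausdorff, second countable) topology, together with a smooth atlas.
  Charts take values in a linear subspace \<open>V\<close> of the Euclidean space \<open>'e\<close> rather than in all
  of \<open>'e\<close>, because class \<open>euclidean_space\<close> excludes dimension 0. The dimension of the manifold
  is the dimension of \<open>V\<close>.
\<close>

type_synonym ('a, 'e) chart = "'a set \<times> ('a \<Rightarrow> 'e)"

definition smooth_atlas ::
  "'e::euclidean_space set \<Rightarrow> ('a::topological_space, 'e) chart set \<Rightarrow> bool" where
  "smooth_atlas V \<A> \<longleftrightarrow>
     subspace V \<and>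
     (\<Union>(U, \<phi>)\<in>\<A>. U) = UNIV \<and>
     (\<forall>(U, \<phi>)\<in>\<A>. open U \<and> openin (top_of_set V) (\<phi> ` U) \<and>
        homeomorphism U (\<phi> ` U) \<phi> (inv_into U \<phi>)) \<and>
     (\<forall>(U, \<phi>)\<in>\<A>. \<forall>(U', \<phi>')\<in>\<A>. smooth_on (\<phi> ` (U \<inter> U')) (\<phi>' \<circ> inv_into U \<phi>))"

definition smooth_manifold ::
  "('a::{t2_space, second_countable_topology}, 'e::euclidean_space) chart set \<Rightarrow> bool" where
  "smooth_manifold \<A> \<longleftrightarrow> (\<exists>V. smooth_atlas V \<A>)"

definition prod_atlas :: "('a, 'e) chart set \<Rightarrow> ('b, 'f) chart set \<Rightarrow> ('a \<times> 'b, 'e \<times> 'f) chart set" where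
  "prod_atlas \<A> \<B> = (\<lambda>((U, \<phi>), (W, \<psi>)). (U \<times> W, map_prod \<phi> \<psi>)) ` (\<A> \<times> \<B>)"

definition smooth_fun :: "('a, 'e::euclidean_space) chart set \<Rightarrow> ('a \<Rightarrow> real) \<Rightarrow> bool" where
  "smooth_fun \<A> f \<longleftrightarrow> (\<forall>(U, \<phi>)\<in>\<A>. smooth_on (\<phi> ` U) (f \<circ> inv_into U \<phi>))"

definition smooth_map ::
  "('a::topological_space, 'e::euclidean_space) chart set \<Rightarrow>
   ('b::topological_space, 'f::euclidean_space) chart set \<Rightarrow> ('a \<Rightarrow> 'b) \<Rightarrow> bool" where
  "smooth_map \<A> \<B> f \<longleftrightarrow>
     continuous_on UNIV f \<and>
     (\<forall>(U, \<phi>)\<in>\<A>. \<forall>(W, \<psi>)\<in>\<B>. smooth_on (\<phi> ` (U \<inter> f -` W)) (\<psi> \<circ> f \<circ> inv_into U \<phi>))"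

definition lie_group ::
  "('g::{t2_space, second_countable_topology}, 'm) monoid_scheme \<Rightarrow>
   ('g, 'e::euclidean_space) chart set \<Rightarrow> bool" where
  "lie_group G \<A> \<longleftrightarrow>
     group G \<and> carrier G = UNIV \<and> smooth_manifold \<A> \<and>
     smooth_map (prod_atlas \<A> \<A>) \<A> (\<lambda>(a, b). a \<otimes>\<^bsub>G\<^esub> b) \<and>
     smooth_map \<A> \<A> (\<lambda>a. inv\<^bsub>G\<^esub> a)"

section \<open>Path space\<close>

text \<open>
  \<open>C([0,\<infinity>), 'a)\<close>. Time is a nonnegative real, so a path is an extensional function on
  \<open>{0..}\<close>.
\<close>

definition paths :: "(real \<Rightarrow> 'a::topological_space) set" where
  "paths = {\<omega> \<in> extensional {0..}. continuous_on {0..} \<omega>}"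

definition compact_open_topology :: "(real \<Rightarrow> 'a::topological_space) topology" where
  "compact_open_topology =
     topology_generated_by {{\<omega> \<in> paths. \<omega> ` K \<subseteq> U} |K U. K \<subseteq> {0..} \<and> compact K \<and> open U}"

definition path_space :: "(real \<Rightarrow> 'a::topological_space) measure" where
  "path_space = sigma paths {W. openin compact_open_topology W}"

definition shift :: "real \<Rightarrow> (real \<Rightarrow> 'a) \<Rightarrow> real \<Rightarrow> 'a" where
  "shift s \<omega> = restrict (\<lambda>t. \<omega> (t + s)) {0..}"

definition sigma_of ::
  "real set \<Rightarrow> (real \<Rightarrow> (real \<Rightarrow> 'a::topological_space) \<Rightarrow> 'b::topological_space)
   \<Rightarrow> (real \<Rightarrow> 'a) measure" where
  "sigma_of I Y = sigma paths {Y t -` B \<inter> paths |t B. t \<in> I \<and> B \<in> sets borel}"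

text \<open>Indexed by \<open>ennreal\<close> so that stopping times may take the value \<open>\<infinity>\<close>.\<close>

definition canonical_filtration :: "ennreal \<Rightarrow> (real \<Rightarrow> 'a::topological_space) measure" where
  "canonical_filtration t = sigma_of {s. 0 \<le> s \<and> ennreal s \<le> t} (\<lambda>s \<omega>. \<omega> s)"

definition tail_sets ::
  "(real \<Rightarrow> (real \<Rightarrow> 'a::topological_space) \<Rightarrow> 'b::topological_space) \<Rightarrow> (real \<Rightarrow> 'a) set set" where
  "tail_sets Y = (\<Inter>t\<in>{0..}. sets (sigma_of {t..} Y))"

definition inv_sets ::
  "(real \<Rightarrow> (real \<Rightarrow> 'a::topological_space) \<Rightarrow> 'b::topological_space) \<Rightarrow> (real \<Rightarrow> 'a) set set" where
  "inv_sets Y = {A \<in> tail_sets Y. \<forall>s>0. shift s -` A \<inter> paths = A}"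

section \<open>Diffusions\<close>

definition martingale ::
  "'w measure \<Rightarrow> (ennreal \<Rightarrow> 'w measure) \<Rightarrow> (real \<Rightarrow> 'w \<Rightarrow> real) \<Rightarrow> bool" where
  "martingale Q F M \<longleftrightarrow>
     (\<forall>t\<ge>0. M t \<in> borel_measurable (F (ennreal t)) \<and> integrable Q (M t)) \<and>
     (\<forall>s\<ge>0. \<forall>t\<ge>s. AE \<omega> in Q. real_cond_exp Q (F (ennreal s)) (M t) \<omega> = M s \<omega>)"

definition test_fun ::
  "('a::topological_space, 'e::euclidean_space) chart set \<Rightarrow> ('a \<Rightarrow> real) \<Rightarrow> bool" where
  "test_fun \<A> f \<longleftrightarrow> smooth_fun \<A> f \<and> compact (closure {z. f z \<noteq> 0})"

definition solves_martingale_problem ::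
  "('a::topological_space, 'e::euclidean_space) chart set \<Rightarrow> (('a \<Rightarrow> real) \<Rightarrow> 'a \<Rightarrow> real)
   \<Rightarrow> 'a \<Rightarrow> (real \<Rightarrow> 'a) measure \<Rightarrow> bool" where
  "solves_martingale_problem \<A> L z Q \<longleftrightarrow>
     prob_space Q \<and> sets Q = sets path_space \<and> (AE \<omega> in Q. \<omega> 0 = z) \<and>
     (\<forall>f. test_fun \<A> f \<longrightarrow>
        martingale Q canonical_filtration
          (\<lambda>t \<omega>. f (\<omega> t) - f (\<omega> 0) - (LBINT s:{0..t}. L f (\<omega> s))))"

definition strong_markov_family ::
  "('a::topological_space \<Rightarrow> (real \<Rightarrow> 'a) measure) \<Rightarrow> bool" where
  "strong_markov_family P \<longleftrightarrow>
     P \<in> borel \<rightarrow>\<^sub>M prob_algebra path_space \<and>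
     (\<forall>z. AE \<omega> in P z. \<omega> 0 = z) \<and>
     (\<forall>z \<tau> Z. stopping_time canonical_filtration \<tau> \<and>
        Z \<in> borel_measurable path_space \<and> bounded (Z ` paths) \<longrightarrow>
        (AE \<omega> in P z. \<tau> \<omega> < \<infinity> \<longrightarrow>
           real_cond_exp (P z) (filtration.pre_sigma paths canonical_filtration \<tau>)
             (\<lambda>\<omega>'. Z (shift (enn2real (\<tau> \<omega>')) \<omega>')) \<omega>
           = (\<integral>\<omega>'. Z \<omega>' \<partial>P (\<omega> (enn2real (\<tau> \<omega>))))))"

definition smooth_operator ::
  "('a, 'e::euclidean_space) chart set \<Rightarrow> (('a \<Rightarrow> real) \<Rightarrow> 'a \<Rightarrow> real) \<Rightarrow> bool" where
  "smooth_operator \<A> L \<longleftrightarrow>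
     (\<forall>f. smooth_fun \<A> f \<longrightarrow> smooth_fun \<A> (L f)) \<and>
     (\<forall>f h a b. smooth_fun \<A> f \<and> smooth_fun \<A> h \<longrightarrow>
        L (\<lambda>z. a * f z + b * h z) = (\<lambda>z. a * L f z + b * L h z))"

text \<open>
  Paths live in \<open>C([0,\<infinity>), 'a)\<close> without a cemetery point, so the lifetime is infinite.
\<close>

definition diffusion ::
  "('a::topological_space, 'e::euclidean_space) chart set \<Rightarrow> (('a \<Rightarrow> real) \<Rightarrow> 'a \<Rightarrow> real)
   \<Rightarrow> ('a \<Rightarrow> (real \<Rightarrow> 'a) measure) \<Rightarrow> bool" where
  "diffusion \<A> L P \<longleftrightarrow>
     smooth_operator \<A> L \<and>
     strong_markov_family P \<and>
     (\<forall>z. solves_martingale_problem \<A> L z (P z) \<and>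
          (\<forall>Q. solves_martingale_problem \<A> L z Q \<longrightarrow> Q = P z))"

definition harmonic :: "('a::topological_space \<Rightarrow> (real \<Rightarrow> 'a) measure) \<Rightarrow> ('a \<Rightarrow> real) \<Rightarrow> bool" where
  "harmonic P H \<longleftrightarrow>
     H \<in> borel_measurable borel \<and> bounded (range H) \<and>
     (\<forall>z. \<forall>t\<ge>0. H z = (\<integral>\<omega>. H (\<omega> t) \<partial>P z))"

section \<open>The four conditions\<close>

text \<open>
  Equality of two families of events up to sets that are negligible for every measure in
  \<open>\<Q>\<close>: the approximating event may not depend on the measure.
\<close>

definition eq_mod_null :: "'w measure set \<Rightarrow> 'w set set \<Rightarrow> 'w set set \<Rightarrow> bool" where
  "eq_mod_null \<Q> \<A> \<B> \<longleftrightarrow>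
     (\<forall>A\<in>\<A>. \<exists>B\<in>\<B>. \<forall>Q\<in>\<Q>. sym_diff A B \<in> null_sets Q) \<and>
     (\<forall>B\<in>\<B>. \<exists>A\<in>\<A>. \<forall>Q\<in>\<Q>. sym_diff A B \<in> null_sets Q)"

definition countably_generated :: "'s measure \<Rightarrow> bool" where
  "countably_generated M \<longleftrightarrow>
     (\<exists>C. countable C \<and> C \<subseteq> Pow (space M) \<and> sets M = sigma_sets (space M) C)"

text \<open>
  The law of \<open>(x\<^sub>t)\<close> under \<open>P (x, g)\<close> depends on \<open>x\<close> only and forms a diffusion on \<open>X\<close>;
  \<open>Inv((x\<^sub>t))\<close> is generated by \<open>l\<close> up to sets that are negligible under all starting points.
\<close>

definition devissage ::
  "('x::topological_space, 'e::euclidean_space) chart set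
   \<Rightarrow> ('x \<times> 'g::topological_space \<Rightarrow> (real \<Rightarrow> 'x \<times> 'g) measure)
   \<Rightarrow> 's measure \<Rightarrow> ((real \<Rightarrow> 'x \<times> 'g) \<Rightarrow> 's) \<Rightarrow> bool" where
  "devissage \<A> P \<Lambda> l \<longleftrightarrow>
     (\<exists>L Q. diffusion \<A> L Q \<and>
        (\<forall>x g. distr (P (x, g)) path_space (\<lambda>\<omega>. restrict (\<lambda>t. fst (\<omega> t)) {0..}) = Q x)) \<and>
     prob_space \<Lambda> \<and> countably_generated \<Lambda> \<and>
     l \<in> path_space \<rightarrow>\<^sub>M \<Lambda> \<and>
     eq_mod_null (range P) (inv_sets (\<lambda>t \<omega>. fst (\<omega> t))) (sets (vimage_algebra paths l \<Lambda>)) \<and>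
     (\<forall>z. absolutely_continuous \<Lambda> (distr (P z) \<Lambda> l))"

definition convergence_to ::
  "('x::topological_space \<times> 'g::topological_space \<Rightarrow> (real \<Rightarrow> 'x \<times> 'g) measure)
   \<Rightarrow> ((real \<Rightarrow> 'x \<times> 'g) \<Rightarrow> 'g) \<Rightarrow> bool" where
  "convergence_to P ginf \<longleftrightarrow>
     ginf \<in> path_space \<rightarrow>\<^sub>M borel \<and>
     (\<forall>z. AE \<omega> in P z. ((\<lambda>t. snd (\<omega> t)) \<longlongrightarrow> ginf \<omega>) at_top)"

definition group_act ::
  "('g, 'm) monoid_scheme \<Rightarrow> 'g \<Rightarrow> ('x \<times> 'g \<Rightarrow> real) \<Rightarrow> 'x \<times> 'g \<Rightarrow> real" where
  "group_act G g f = (\<lambda>(x, h). f (x, g \<otimes>\<^bsub>G\<^esub> h))"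

definition equivariant ::
  "('x \<times> 'g, 'e::euclidean_space) chart set \<Rightarrow> ('g, 'm) monoid_scheme
   \<Rightarrow> (('x \<times> 'g \<Rightarrow> real) \<Rightarrow> 'x \<times> 'g \<Rightarrow> real) \<Rightarrow> bool" where
  "equivariant \<A> G L \<longleftrightarrow>
     (\<forall>g\<in>carrier G. \<forall>f. smooth_fun \<A> f \<longrightarrow> L (group_act G g f) = group_act G g (L f))"

definition regular :: "('a::topological_space \<Rightarrow> (real \<Rightarrow> 'a) measure) \<Rightarrow> bool" where
  "regular P \<longleftrightarrow> (\<forall>H. harmonic P H \<longrightarrow> continuous_on UNIV H)"

section \<open>Basic facts\<close>

lemma space_path_space [simp]: "space path_space = paths"
  by (simp add: path_space_def space_measure_of_conv)

lemma topspace_compact_open [simp]: "topspace compact_open_topology = paths"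
proof -
  have "paths \<in> {{\<omega> \<in> paths. \<omega> ` K \<subseteq> U} |K U. K \<subseteq> {0..} \<and> compact K \<and> open U}"
    by (rule CollectI, rule exI[of _ "{}"], rule exI[of _ UNIV]) auto
  then show ?thesis
    unfolding compact_open_topology_def topology_generated_by_topspace by blast
qed

lemma sets_path_space: "sets path_space = sigma_sets paths {W. openin compact_open_topology W}"
proof -
  have "{W :: (real \<Rightarrow> 'a) set. openin compact_open_topology W} \<subseteq> Pow paths"
    using openin_subset[of compact_open_topology] by auto
  then show ?thesis
    by (simp add: path_space_def sets_measure_of)
qed

lemma sets_sigma_of:
  "sets (sigma_of I Y) = sigma_sets paths {Y t -` B \<inter> paths |t B. t \<in> I \<and> B \<in> sets borel}"
  unfolding sigma_of_def by (rule sets_measure_of) auto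

lemma filtration_canonical: "filtration paths canonical_filtration"
proof
  show "space (canonical_filtration t) = paths" for t
    by (simp add: canonical_filtration_def sigma_of_def space_measure_of_conv)
  show "sets (canonical_filtration s) \<subseteq> sets (canonical_filtration t)" if "s \<le> t" for s t
    unfolding canonical_filtration_def sets_sigma_of
    by (rule sigma_sets_mono') (use that in \<open>auto intro: order_trans\<close>)
qed

lemma measurable_eval:
  assumes "0 \<le> t"
  shows "(\<lambda>\<omega>. \<omega> t) \<in> path_space \<rightarrow>\<^sub>M borel"
proof (rule borel_measurableI)
  fix U :: "'a set" assume "open U"
  then have "{\<omega> \<in> paths. \<omega> ` {t} \<subseteq> U} \<in> {{\<omega> \<in> paths. \<omega> ` K \<subseteq> U} |K U. K \<subseteq> {0..} \<and> compact K \<and> open U}"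
    using assms by (intro CollectI exI[of _ "{t}"] exI[of _ U]) auto
  then have "openin compact_open_topology {\<omega> \<in> paths. \<omega> ` {t} \<subseteq> U}"
    unfolding compact_open_topology_def by (rule topology_generated_by_Basis)
  then have "{\<omega> \<in> paths. \<omega> ` {t} \<subseteq> U} \<in> sets path_space"
    by (auto simp: sets_path_space)
  moreover have "(\<lambda>\<omega>. \<omega> t) -` U \<inter> space path_space = {\<omega> \<in> paths. \<omega> ` {t} \<subseteq> U}"
    by auto
  ultimately show "(\<lambda>\<omega>. \<omega> t) -` U \<inter> space path_space \<in> sets path_space"
    by simp
qed

end

theory Submission
  imports Defs
begin

text \<open>
  Write \<open>(x\<^sub>t, g\<^sub>t)\<close> for the coordinates of a path and let \<open>a \<in> G\<close> act on paths by translating the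
  second coordinate. Uniqueness in the martingale problem turns equivariance of the generator into
  equivariance in law: the translate of the path started at \<open>z\<close> has the law of the path started at
  \<open>a z\<close> (\<open>diffusion_left_mult_law\<close>).
  
  Two facts link invariant functions with harmonic ones. A bounded harmonic function converges almost
  surely along the path (\<open>harmonic_converges\<close>), and if \<open>V\<close> is a bounded shift-invariant function of
  the path then \<open>z \<mapsto> E\<^sub>z[V]\<close> is harmonic with limit \<open>V\<close> (\<open>expectation_converges_to_invariant\<close>). If
  \<open>V\<close> is unchanged by the action as well, then \<open>E\<^sub>z[V]\<close> depends on the first component of \<open>z\<close> only, so
  \<open>V\<close> is an invariant function of \<open>(x\<^sub>t)\<close>, that is, a function of \<open>linf\<close>
  (\<open>translation_invariant_measurable_linf\<close>).
  
  Let now \<open>Z\<close> be an arbitrary invariant function. The path \<open>\<eta> = inv ginf \<cdot> \<omega>\<close> is unchanged by the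
  action, so for each fixed \<open>b\<close> the function \<open>Z(b \<cdot> \<eta>)\<close> is a function of \<open>linf\<close>, and \<open>Z\<close> itself
  arises by putting \<open>b = ginf\<close>. Substituting a random \<open>b\<close> is not allowed without some continuity in
  \<open>b\<close>, because the exceptional null set depends on \<open>b\<close>. The continuity is obtained by smoothing: \<open>Z\<close>
  is averaged over translations by the inverse of a random group element which has the law of \<open>ginf\<close>
  under \<open>P (x, \<one>)\<close>. Regularity makes the smoothed function continuous in \<open>b\<close>
  (\<open>continuous_smoothed\<close>), since its value at \<open>b\<close> is the expectation of a function of \<open>ginf\<close> started
  from \<open>(x, inv b)\<close>; hence averages of \<open>Z\<close> are functions of \<open>(linf, ginf)\<close>
  (\<open>average_measurable_limit\<close>). The laws of \<open>ginf\<close> thus play the part that densities with respect to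
  Haar measure would otherwise have.
  
  It remains to undo the averaging. Almost sure convergence of \<open>g\<^sub>t\<close> and the Markov property provide
  points \<open>x\<^sub>n\<close> for which the law of \<open>ginf\<close> under \<open>P (x\<^sub>n, \<one>)\<close> shrinks to the unit
  (\<open>ginf_concentrates\<close>), and the corresponding averages converge weakly to \<open>Z\<close>
  (\<open>expectation_average_tendsto\<close>). So \<open>Z\<close> coincides with its conditional expectation given
  \<open>(linf, ginf)\<close>. To treat all starting points at once, this is carried out under a mixture of the
  laws started from a countable dense set, which by regularity dominates every \<open>P z\<close> on invariant
  events (\<open>AE_from_dense\<close>, \<open>invariant_measurable_limits\<close>).
\<close>

section \<open>Smoothness of group translations\<close>

lemma Ck_on_cong:
  assumes "open S" "\<And>x. x \<in> S \<Longrightarrow> f x = g x"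
  shows "Ck_on k f S \<longleftrightarrow> Ck_on k g S"
  using assms(2)
proof (induction k arbitrary: f g)
  case 0
  then show ?case by (auto cong: continuous_on_cong)
next
  case (Suc k)
  have transfer: "(f' has_derivative D) (at x)"
    if "x \<in> S" "(g' has_derivative D) (at x)" "\<And>y. y \<in> S \<Longrightarrow> g' y = f' y" for f' g' D x
    by (rule has_derivative_transform_within_open[OF that(2) assms(1) that(1)]) (rule that(3))
  have diff: "f differentiable at x \<longleftrightarrow> g differentiable at x" if "x \<in> S" for x
    unfolding differentiable_def
    using transfer[OF that, of f _ g] transfer[OF that, of g _ f] Suc.prems
    by (intro iffI; elim exE; intro exI) simp_all
  show ?case
  proof (cases "\<forall>x\<in>S. f differentiable at x")
    case True
    have "frechet_derivative f (at x) = frechet_derivative g (at x)" if "x \<in> S" for x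
      by (rule frechet_derivative_transform_within_open[OF _ assms(1) that])
        (use True that Suc.prems in \<open>simp_all\<close>)
    then have "Ck_on k (\<lambda>x. frechet_derivative f (at x) v) S
        \<longleftrightarrow> Ck_on k (\<lambda>x. frechet_derivative g (at x) v) S" for v
      by (intro Suc.IH) simp
    with True diff show ?thesis by simp
  next
    case False
    with diff show ?thesis by auto
  qed
qed

lemma Ck_on_subset: "Ck_on k f S \<Longrightarrow> T \<subseteq> S \<Longrightarrow> Ck_on k f T"
  by (induction k arbitrary: f) (auto intro: continuous_on_subset)

lemma Ck_on_Suc_imp: "Ck_on (Suc k) f S \<Longrightarrow> Ck_on k f S"
proof (induction k arbitrary: f)
  case 0
  then have "\<forall>x\<in>S. f differentiable at x" by simp
  then show ?case
    by (simp add: continuous_at_imp_continuous_on differentiable_imp_continuous_within)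
next
  case (Suc k)
  have d: "\<forall>x\<in>S. f differentiable at x"
    and c: "Ck_on (Suc k) (\<lambda>x. frechet_derivative f (at x) v) S" for v
    using Suc.prems unfolding Ck_on.simps(2)[of "Suc k"] by blast+
  show ?case unfolding Ck_on.simps(2)[of k] using d Suc.IH[OF c] by blast
qed

lemma Ck_on_SucI:
  assumes "open S" and "\<And>x. x \<in> S \<Longrightarrow> (f has_derivative D x) (at x)"
    and "\<And>v. Ck_on k (\<lambda>x. D x v) S"
  shows "Ck_on (Suc k) f S"
proof -
  have "frechet_derivative f (at x) = D x" if "x \<in> S" for x
    using frechet_derivative_at[OF assms(2)[OF that]] by simp
  then have "Ck_on k (\<lambda>x. frechet_derivative f (at x) v) S" for v
    using assms(3)[of v]
      Ck_on_cong[OF assms(1), of "\<lambda>x. frechet_derivative f (at x) v" "\<lambda>x. D x v" k] by simp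
  moreover have "f differentiable at x" if "x \<in> S" for x
    using assms(2)[OF that] by (auto simp: differentiable_def)
  ultimately show ?thesis by simp
qed

lemma Ck_on_Suc_has_derivative:
  "Ck_on (Suc k) f S \<Longrightarrow> x \<in> S \<Longrightarrow> (f has_derivative frechet_derivative f (at x)) (at x)"
  by (simp add: frechet_derivative_works)

lemma Ck_on_const: "open S \<Longrightarrow> Ck_on k (\<lambda>x. c) S"
proof (induction k arbitrary: c)
  case (Suc k)
  show ?case
    by (rule Ck_on_SucI[where D="\<lambda>_ _. 0"])
      (simp_all add: has_derivative_const Suc del: Ck_on.simps)
qed simp

lemma Ck_on_bounded_linear:
  assumes "bounded_linear f" "open S"
  shows "Ck_on k f S"
proof (cases k)
  case 0
  then show ?thesis using assms by (simp add: linear_continuous_on)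
next
  case (Suc n)
  have "Ck_on (Suc n) f S"
    by (rule Ck_on_SucI[where D="\<lambda>_. f"])
      (use assms in \<open>auto intro: bounded_linear_imp_has_derivative Ck_on_const\<close>)
  with Suc show ?thesis by simp
qed

lemma Ck_on_bounded_linear_comp:
  assumes "bounded_linear h" "open S" "Ck_on k f S"
  shows "Ck_on k (\<lambda>x. h (f x)) S"
  using assms(3)
proof (induction k arbitrary: f)
  case 0
  then show ?case using assms(1)
    by (auto intro: bounded_linear.continuous_on)
next
  case (Suc k)
  show ?case
  proof (rule Ck_on_SucI[OF assms(2)])
    fix x assume "x \<in> S"
    show "((\<lambda>x. h (f x)) has_derivative (\<lambda>v. h (frechet_derivative f (at x) v))) (at x)"
      by (rule bounded_linear.has_derivative[OF assms(1)])
        (rule Ck_on_Suc_has_derivative[OF Suc.prems \<open>x \<in> S\<close>])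
  next
    fix v show "Ck_on k (\<lambda>x. h (frechet_derivative f (at x) v)) S"
      using Suc by simp
  qed
qed

lemma Ck_on_add:
  assumes "open S" "Ck_on k f S" "Ck_on k g S"
  shows "Ck_on k (\<lambda>x. f x + g x) S"
  using assms(2,3)
proof (induction k arbitrary: f g)
  case 0
  then show ?case by (auto intro: continuous_intros)
next
  case (Suc k)
  show ?case
  proof (rule Ck_on_SucI[OF assms(1)])
    fix x assume x: "x \<in> S"
    show "((\<lambda>x. f x + g x) has_derivative
        (\<lambda>v. frechet_derivative f (at x) v + frechet_derivative g (at x) v)) (at x)"
      by (intro has_derivative_add Ck_on_Suc_has_derivative[OF Suc.prems(1) x]
          Ck_on_Suc_has_derivative[OF Suc.prems(2) x])
  next
    fix v show "Ck_on k (\<lambda>x. frechet_derivative f (at x) v + frechet_derivative g (at x) v) S"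
      using Suc by simp
  qed
qed

lemma Ck_on_sum:
  assumes "open S" "\<And>i. i \<in> I \<Longrightarrow> Ck_on k (f i) S"
  shows "Ck_on k (\<lambda>x. \<Sum>i\<in>I. f i x) S"
  using assms(2)
proof (induction I rule: infinite_finite_induct)
  case (insert i I)
  then show ?case using Ck_on_add[OF assms(1), of k "f i" "\<lambda>x. \<Sum>i\<in>I. f i x"] by simp
qed (simp_all add: Ck_on_const[OF assms(1)])

lemma Ck_on_scaleR:
  assumes "open S" "Ck_on k f S" "Ck_on k g S"
  shows "Ck_on k (\<lambda>x. f x *\<^sub>R g x) S"
  using assms(2,3)
proof (induction k arbitrary: f g)
  case 0
  then show ?case by (auto intro: continuous_intros)
next
  case (Suc k)
  show ?case
  proof (rule Ck_on_SucI[OF assms(1)])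
    fix x assume x: "x \<in> S"
    show "((\<lambda>x. f x *\<^sub>R g x) has_derivative
        (\<lambda>v. f x *\<^sub>R frechet_derivative g (at x) v + frechet_derivative f (at x) v *\<^sub>R g x)) (at x)"
      by (intro has_derivative_scaleR Ck_on_Suc_has_derivative[OF Suc.prems(1) x]
          Ck_on_Suc_has_derivative[OF Suc.prems(2) x])
  next
    fix v show "Ck_on k (\<lambda>x. f x *\<^sub>R frechet_derivative g (at x) v
        + frechet_derivative f (at x) v *\<^sub>R g x) S"
      using Suc.prems Ck_on_Suc_imp[OF Suc.prems(1)] Ck_on_Suc_imp[OF Suc.prems(2)]
      by (intro Ck_on_add assms(1) Suc.IH) simp_all
  qed
qed

lemma Ck_on_Pair:
  assumes "open S" "Ck_on k f S" "Ck_on k g S"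
  shows "Ck_on k (\<lambda>x. (f x, g x)) S"
proof -
  have "Ck_on k (\<lambda>x. (f x, 0) + (0, g x)) S"
    by (intro Ck_on_add assms Ck_on_bounded_linear_comp[of "\<lambda>a. (a, 0)"]
        Ck_on_bounded_linear_comp[of "\<lambda>a. (0, a)"] bounded_linear_Pair bounded_linear_ident
        bounded_linear_zero)
  then show ?thesis by simp
qed

text \<open>
  The derivative of \<open>f \<circ> g\<close> along \<open>v\<close> is expanded over the Euclidean basis of the
  intermediate space, which turns it into a sum of products of functions to which the induction
  hypothesis applies.
\<close>

lemma Ck_on_compose:
  fixes g :: "'a::real_normed_vector \<Rightarrow> 'b::euclidean_space" and f :: "'b \<Rightarrow> 'c::real_normed_vector"
  assumes "open S" "open T" "Ck_on k g S" "Ck_on k f T" "g ` S \<subseteq> T"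
  shows "Ck_on k (\<lambda>x. f (g x)) S"
  using assms(3,4)
proof (induction k arbitrary: f)
  case 0
  then show ?case using assms(5) by (auto intro: continuous_on_compose2)
next
  case (Suc k)
  let ?D = "\<lambda>x v. \<Sum>i\<in>Basis. (frechet_derivative g (at x) v \<bullet> i) *\<^sub>R frechet_derivative f (at (g x)) i"
  show ?case
  proof (rule Ck_on_SucI[OF assms(1)])
    fix x assume x: "x \<in> S"
    then have gx: "g x \<in> T" using assms(5) by auto
    have lin: "linear (frechet_derivative f (at (g x)))"
      using Ck_on_Suc_has_derivative[OF Suc.prems(2) gx] has_derivative_linear by blast
    have "frechet_derivative f (at (g x)) (frechet_derivative g (at x) v) = ?D x v" for v
      by (subst euclidean_representation[of "frechet_derivative g (at x) v", symmetric])
        (simp add: linear_sum[OF lin] linear_cmul[OF lin] del: euclidean_representation)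
    moreover have "((\<lambda>x. f (g x)) has_derivative
        (\<lambda>v. frechet_derivative f (at (g x)) (frechet_derivative g (at x) v))) (at x)"
      using diff_chain_at[OF Ck_on_Suc_has_derivative[OF Suc.prems(1) x]
          Ck_on_Suc_has_derivative[OF Suc.prems(2) gx]] by (simp add: o_def)
    ultimately show "((\<lambda>x. f (g x)) has_derivative ?D x) (at x)" by simp
  next
    fix v
    have "Ck_on k (\<lambda>x. frechet_derivative g (at x) v) S"
      using Suc.prems(1) by simp
    moreover have "Ck_on k (\<lambda>x. frechet_derivative f (at (g x)) i) S" for i
      using Suc.IH[OF Ck_on_Suc_imp[OF Suc.prems(1)], of "\<lambda>y. frechet_derivative f (at y) i"]
        Suc.prems(2) by simp
    ultimately show "Ck_on k (\<lambda>x. ?D x v) S"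
      by (intro Ck_on_sum Ck_on_scaleR assms(1)
          Ck_on_bounded_linear_comp[of "\<lambda>y. y \<bullet> i" for i] bounded_linear_inner_left)
  qed
qed

lemma smooth_atlas_chart:
  assumes "smooth_manifold \<A>" "(U, \<phi>) \<in> \<A>"
  shows "open U" "inj_on \<phi> U" "homeomorphism U (\<phi> ` U) \<phi> (inv_into U \<phi>)"
proof -
  from assms show "open U" and h: "homeomorphism U (\<phi> ` U) \<phi> (inv_into U \<phi>)"
    by (fastforce simp: smooth_manifold_def smooth_atlas_def)+
  show "inj_on \<phi> U"
    using h by (metis homeomorphism_def inj_on_inverseI)
qed

lemma smooth_atlas_covers:
  assumes "smooth_manifold \<A>"
  obtains U \<phi> where "(U, \<phi>) \<in> \<A>" "x \<in> U"
proof -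
  from assms have "(\<Union>(U, \<phi>)\<in>\<A>. U) = UNIV"
    by (auto simp: smooth_manifold_def smooth_atlas_def)
  then have "x \<in> (\<Union>(U, \<phi>)\<in>\<A>. U)" by simp
  with that show ?thesis by blast
qed

lemma lie_groupD:
  assumes "lie_group G \<G>"
  shows "group G" "carrier G = UNIV" "smooth_manifold \<G>"
    "smooth_map (prod_atlas \<G> \<G>) \<G> (\<lambda>(a, b). a \<otimes>\<^bsub>G\<^esub> b)"
    "continuous_on UNIV (\<lambda>(a, b). a \<otimes>\<^bsub>G\<^esub> b)"
    "continuous_on UNIV (\<lambda>a. inv\<^bsub>G\<^esub> a)"
  using assms by (auto simp: lie_group_def smooth_map_def)

lemma continuous_on_group_mult:
  fixes G (structure)
  assumes "continuous_on UNIV (\<lambda>(a, b). a \<otimes> b)" "continuous_on S f" "continuous_on S g"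
  shows "continuous_on S (\<lambda>z. f z \<otimes> g z)"
  using continuous_on_compose2[OF assms(1) continuous_on_Pair[OF assms(2,3)]] by simp

text \<open>
  Around \<open>(x, g)\<close> the translate is written in charts as \<open>(u, v) \<mapsto> F1 (u, F2 (c, v))\<close>, where \<open>F1\<close>
  extends the coordinate expression of \<open>f\<close> near \<open>(x, a \<otimes> g)\<close>, \<open>F2\<close> extends that of the
  multiplication near \<open>(a, g)\<close>, and \<open>c\<close> is the coordinate of \<open>a\<close>.
\<close>

lemma smooth_fun_group_act:
  fixes \<X> :: "('x::{t2_space, second_countable_topology}, 'e::euclidean_space) chart set"
    and \<G> :: "('g::{t2_space, second_countable_topology}, 'f::euclidean_space) chart set"
  assumes X: "smooth_manifold \<X>" and G: "lie_group G \<G>"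
    and f: "smooth_fun (prod_atlas \<X> \<G>) f"
  shows "smooth_fun (prod_atlas \<X> \<G>) (group_act G a f)"
  unfolding smooth_fun_def prod_atlas_def
proof clarsimp
  fix U \<phi> W \<psi> assume chX: "(U, \<phi>) \<in> \<X>" and chG: "(W, \<psi>) \<in> \<G>"
  note GM = lie_groupD(3)[OF G]
  have inv_prod: "inv_into (U \<times> W) (map_prod \<phi> \<psi>) (\<phi> x, \<psi> g) = (x, g)"
    if "(U, \<phi>) \<in> \<X>" "(W, \<psi>) \<in> \<G>" "x \<in> U" "g \<in> W" for U \<phi> W \<psi> x g
    using inv_into_f_f[of "map_prod \<phi> \<psi>" "U \<times> W" "(x, g)"] that
      smooth_atlas_chart(2)[OF X that(1)] smooth_atlas_chart(2)[OF GM that(2)]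
    by (auto simp: map_prod_inj_on)
  have inv_prod': "inv_into (U \<times> W) (map_prod \<phi> \<psi>) (\<phi> x, \<psi> g) = (x, g)"
    if "(U, \<phi>) \<in> \<G>" "(W, \<psi>) \<in> \<G>" "x \<in> U" "g \<in> W" for U \<phi> W \<psi> x g
    using inv_into_f_f[of "map_prod \<phi> \<psi>" "U \<times> W" "(x, g)"] that
      smooth_atlas_chart(2)[OF GM that(1)] smooth_atlas_chart(2)[OF GM that(2)]
    by (auto simp: map_prod_inj_on)
  show "smooth_on (map_prod \<phi> \<psi> ` (U \<times> W)) (group_act G a f \<circ> inv_into (U \<times> W) (map_prod \<phi> \<psi>))"
    unfolding smooth_on_def
  proof
    fix p assume "p \<in> map_prod \<phi> \<psi> ` (U \<times> W)"
    then obtain x g where xg: "x \<in> U" "g \<in> W" and p: "p = (\<phi> x, \<psi> g)" by auto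
    obtain A \<alpha> where A: "(A, \<alpha>) \<in> \<G>" "a \<in> A" by (rule smooth_atlas_covers[OF GM])
    obtain W' \<psi>' where W': "(W', \<psi>') \<in> \<G>" "a \<otimes>\<^bsub>G\<^esub> g \<in> W'" by (rule smooth_atlas_covers[OF GM])
    have "smooth_on (map_prod \<phi> \<psi>' ` (U \<times> W')) (f \<circ> inv_into (U \<times> W') (map_prod \<phi> \<psi>'))"
      using f chX W'(1) unfolding smooth_fun_def prod_atlas_def by fastforce
    moreover have "(\<phi> x, \<psi>' (a \<otimes>\<^bsub>G\<^esub> g)) \<in> map_prod \<phi> \<psi>' ` (U \<times> W')" using xg W' by auto
    ultimately obtain T1 F1 where T1: "open T1" "(\<phi> x, \<psi>' (a \<otimes>\<^bsub>G\<^esub> g)) \<in> T1"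
        "\<And>k. Ck_on k F1 T1"
      and F1: "\<And>y. y \<in> map_prod \<phi> \<psi>' ` (U \<times> W') \<inter> T1 \<Longrightarrow>
          F1 y = (f \<circ> inv_into (U \<times> W') (map_prod \<phi> \<psi>')) y"
      unfolding smooth_on_def by metis
    let ?m = "\<lambda>(a, b). a \<otimes>\<^bsub>G\<^esub> b"
    have "smooth_on (map_prod \<alpha> \<psi> ` ((A \<times> W) \<inter> ?m -` W'))
        (\<psi>' \<circ> ?m \<circ> inv_into (A \<times> W) (map_prod \<alpha> \<psi>))"
      using lie_groupD(4)[OF G] A chG W'(1) unfolding smooth_map_def prod_atlas_def by fastforce
    moreover have "(\<alpha> a, \<psi> g) \<in> map_prod \<alpha> \<psi> ` ((A \<times> W) \<inter> ?m -` W')"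
      using xg W' A by (auto intro!: image_eqI[where x="(a, g)"])
    ultimately obtain T2 F2 where T2: "open T2" "(\<alpha> a, \<psi> g) \<in> T2" "\<And>k. Ck_on k F2 T2"
      and F2: "\<And>y. y \<in> map_prod \<alpha> \<psi> ` ((A \<times> W) \<inter> ?m -` W') \<inter> T2 \<Longrightarrow>
          F2 y = (\<psi>' \<circ> ?m \<circ> inv_into (A \<times> W) (map_prod \<alpha> \<psi>)) y"
      unfolding smooth_on_def by metis
    have F2_eq: "F2 (\<alpha> a, \<psi> h) = \<psi>' (a \<otimes>\<^bsub>G\<^esub> h)"
      if "h \<in> W" "a \<otimes>\<^bsub>G\<^esub> h \<in> W'" "(\<alpha> a, \<psi> h) \<in> T2" for h
    proof -
      have "(\<alpha> a, \<psi> h) \<in> map_prod \<alpha> \<psi> ` ((A \<times> W) \<inter> ?m -` W') \<inter> T2"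
        using that A by (auto intro!: image_eqI[where x="(a, h)"])
      from F2[OF this] show ?thesis using inv_prod'[OF A(1) chG A(2) that(1)] by simp
    qed
    have F1_eq: "F1 (\<phi> y, \<psi>' h) = f (y, h)"
      if "y \<in> U" "h \<in> W'" "(\<phi> y, \<psi>' h) \<in> T1" for y h
    proof -
      have "(\<phi> y, \<psi>' h) \<in> map_prod \<phi> \<psi>' ` (U \<times> W') \<inter> T1"
        using that by (auto intro!: image_eqI[where x="(y, h)"])
      from F1[OF this] show ?thesis using inv_prod[OF chX W'(1) that(1,2)] by simp
    qed
    \<comment> \<open>The chart domain has to be shrunk so that translation by \<open>a\<close> stays inside \<open>W'\<close>.\<close>
    have "continuous_on UNIV (\<lambda>h. a \<otimes>\<^bsub>G\<^esub> h)"
      by (intro continuous_on_group_mult[OF lie_groupD(5)[OF G]] continuous_intros)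
    then have "open ((\<lambda>h. a \<otimes>\<^bsub>G\<^esub> h) -` W')"
      using smooth_atlas_chart(1)[OF GM W'(1)] by (simp add: open_vimage)
    then have "openin (top_of_set W) {h \<in> W. a \<otimes>\<^bsub>G\<^esub> h \<in> W'}"
      by (auto simp: openin_open intro!: exI[of _ "(\<lambda>h. a \<otimes>\<^bsub>G\<^esub> h) -` W'"])
    then have "openin (top_of_set (\<psi> ` W)) (\<psi> ` {h \<in> W. a \<otimes>\<^bsub>G\<^esub> h \<in> W'})"
      by (rule homeomorphism_imp_open_map[OF smooth_atlas_chart(3)[OF GM chG]])
    then obtain V where V: "open V" "\<psi> ` {h \<in> W. a \<otimes>\<^bsub>G\<^esub> h \<in> W'} = \<psi> ` W \<inter> V"
      by (auto simp: openin_open)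
    have V_imp: "a \<otimes>\<^bsub>G\<^esub> h \<in> W'" if "h \<in> W" "\<psi> h \<in> V" for h
    proof -
      have "\<psi> h \<in> \<psi> ` {h \<in> W. a \<otimes>\<^bsub>G\<^esub> h \<in> W'}" using V(2) that by auto
      then show ?thesis
        using smooth_atlas_chart(2)[OF GM chG] that(1) by (auto dest: inj_onD)
    qed
    define T3 where "T3 = (\<lambda>v. (\<alpha> a, v)) -` T2 \<inter> V"
    have T3: "open T3"
      unfolding T3_def by (intro open_Int V(1) open_vimage T2(1) continuous_intros)
    have T3': "open (UNIV \<times> T3)" by (intro open_Times open_UNIV T3)
    have k3: "Ck_on k (\<lambda>z. F2 (\<alpha> a, snd z)) (UNIV \<times> T3)" for k
      by (rule Ck_on_compose[OF T3' T2(1) _ T2(3)])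
        (auto simp: T3_def intro: Ck_on_Pair[OF T3'[unfolded T3_def]]
          Ck_on_const[OF T3'[unfolded T3_def]]
          Ck_on_bounded_linear[OF bounded_linear_snd T3'[unfolded T3_def]])
    let ?h = "\<lambda>z. (fst z, F2 (\<alpha> a, snd z))"
    have kh: "Ck_on k ?h (UNIV \<times> T3)" for k
      by (intro Ck_on_Pair T3' k3 Ck_on_bounded_linear bounded_linear_fst)
    define T where "T = (UNIV \<times> T3) \<inter> ?h -` T1"
    have T: "open T"
      unfolding T_def using kh[of 0] T1(1) T3
      by (intro continuous_open_preimage open_Times) auto
    have "Ck_on k (\<lambda>z. F1 (?h z)) T" for k
      by (rule Ck_on_compose[OF T T1(1) Ck_on_subset[OF kh] T1(3)]) (auto simp: T_def)
    moreover have "\<psi> g \<in> V"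
      using V(2) xg W'(2) by blast
    then have "p \<in> T"
      using T1(2) T2(2) xg W'(2) by (simp add: T_def T3_def p F2_eq)
    moreover have "F1 (?h q) = (group_act G a f \<circ> inv_into (U \<times> W) (map_prod \<phi> \<psi>)) q"
      if q: "q \<in> map_prod \<phi> \<psi> ` (U \<times> W) \<inter> T" for q
    proof -
      from q obtain y h where yh: "y \<in> U" "h \<in> W" "q = (\<phi> y, \<psi> h)" by auto
      with q have "\<psi> h \<in> V" "(\<alpha> a, \<psi> h) \<in> T2" "(\<phi> y, F2 (\<alpha> a, \<psi> h)) \<in> T1"
        by (auto simp: T_def T3_def)
      then show ?thesis
        using yh V_imp[of h] by (simp add: F2_eq F1_eq inv_prod[OF chX chG] group_act_def)
    qed
    ultimately show "\<exists>T F. open T \<and> p \<in> T \<and> (\<forall>k. Ck_on k F T) \<and>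
        (\<forall>y\<in>map_prod \<phi> \<psi> ` (U \<times> W) \<inter> T.
          F y = (group_act G a f \<circ> inv_into (U \<times> W) (map_prod \<phi> \<psi>)) y)"
      using T by (intro exI[of _ T] exI[of _ "\<lambda>z. F1 (?h z)"]) blast
  qed
qed

lemma test_fun_group_act:
  fixes \<X> :: "('x::{t2_space, second_countable_topology}, 'e::euclidean_space) chart set"
    and \<G> :: "('g::{t2_space, second_countable_topology}, 'f::euclidean_space) chart set"
  assumes X: "smooth_manifold \<X>" and G: "lie_group G \<G>"
    and f: "test_fun (prod_atlas \<X> \<G>) f"
  shows "test_fun (prod_atlas \<X> \<G>) (group_act G a f)"
proof -
  interpret group G by (rule lie_groupD(1)[OF G])
  have car [simp]: "c \<in> carrier G" for c using lie_groupD(2)[OF G] by simp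
  let ?K = "closure {z. f z \<noteq> 0}" and ?t = "\<lambda>(x, h). (x, inv\<^bsub>G\<^esub> a \<otimes>\<^bsub>G\<^esub> h)"
  have "continuous_on UNIV (\<lambda>z. inv\<^bsub>G\<^esub> a \<otimes>\<^bsub>G\<^esub> snd z)"
    by (intro continuous_on_group_mult[OF lie_groupD(5)[OF G]] continuous_intros)
  then have "continuous_on UNIV ?t"
    by (auto simp: case_prod_beta' intro!: continuous_intros)
  then have K: "compact (?t ` ?K)"
    using f by (intro compact_continuous_image) (auto simp: test_fun_def intro: continuous_on_subset)
  have "{z. group_act G a f z \<noteq> 0} \<subseteq> ?t ` ?K"
  proof clarify
    fix x h assume "group_act G a f (x, h) \<noteq> 0"
    then have "(x, a \<otimes>\<^bsub>G\<^esub> h) \<in> ?K"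
      using closure_subset by (fastforce simp: group_act_def)
    moreover have "inv\<^bsub>G\<^esub> a \<otimes>\<^bsub>G\<^esub> (a \<otimes>\<^bsub>G\<^esub> h) = h"
      by (simp flip: m_assoc)
    ultimately show "(x, h) \<in> ?t ` ?K" by (force intro!: image_eqI[where x="(x, a \<otimes>\<^bsub>G\<^esub> h)"])
  qed
  then have "closure {z. group_act G a f z \<noteq> 0} \<subseteq> ?t ` ?K"
    by (rule closure_minimal[OF _ compact_imp_closed[OF K]])
  then have "compact (closure {z. group_act G a f z \<noteq> 0})"
    using K by (metis closed_Int_compact closed_closure inf.absorb1)
  then show ?thesis
    using f smooth_fun_group_act[OF X G] by (simp add: test_fun_def)
qed

section \<open>Path space\<close>

definition path_map :: "('a \<Rightarrow> 'b) \<Rightarrow> (real \<Rightarrow> 'a) \<Rightarrow> real \<Rightarrow> 'b" where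
  "path_map \<Phi> \<omega> = restrict (\<lambda>t. \<Phi> (\<omega> t)) {0..}"

definition left_mult :: "('g, 'm) monoid_scheme \<Rightarrow> 'g \<Rightarrow> 'x \<times> 'g \<Rightarrow> 'x \<times> 'g" where
  "left_mult G a = (\<lambda>(x, h). (x, a \<otimes>\<^bsub>G\<^esub> h))"

lemma path_map_apply [simp]: "0 \<le> t \<Longrightarrow> path_map \<Phi> \<omega> t = \<Phi> (\<omega> t)"
  by (simp add: path_map_def)

lemma shift_apply [simp]: "0 \<le> t \<Longrightarrow> shift s \<omega> t = \<omega> (t + s)"
  by (simp add: shift_def)

lemma pathsD: "\<omega> \<in> paths \<Longrightarrow> continuous_on {0..} \<omega>"
  by (simp add: paths_def)

lemma restrict_in_paths:
  assumes "continuous_on {0..} f"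
  shows "restrict f {0..} \<in> paths"
proof -
  have "continuous_on {0..} (restrict f {0..}) \<longleftrightarrow> continuous_on {0..} f"
    by (rule continuous_on_cong) auto
  with assms show ?thesis by (simp add: paths_def)
qed

lemma path_map_in_paths:
  assumes "continuous_on UNIV \<Phi>" "\<omega> \<in> paths"
  shows "path_map \<Phi> \<omega> \<in> paths"
proof -
  have "continuous_on {0..} (\<lambda>t. \<Phi> (\<omega> t))"
    using continuous_on_compose2[OF assms(1) pathsD[OF assms(2)]] by simp
  then show ?thesis unfolding path_map_def by (rule restrict_in_paths)
qed

lemma shift_in_paths:
  assumes "0 \<le> s" "\<omega> \<in> paths"
  shows "shift s \<omega> \<in> paths"
proof -
  have "continuous_on {0..} (\<lambda>t. \<omega> (t + s))"
    using assms
    by (intro continuous_on_compose2[OF pathsD[OF assms(2)]] continuous_intros) auto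
  then show ?thesis unfolding shift_def by (rule restrict_in_paths)
qed

lemma shift_0: "\<omega> \<in> paths \<Longrightarrow> shift 0 \<omega> = \<omega>"
  by (auto simp: shift_def paths_def extensional_def)

lemma shift_path_map: "0 \<le> s \<Longrightarrow> shift s (path_map \<Phi> \<omega>) = path_map \<Phi> (shift s \<omega>)"
  by (auto simp: shift_def path_map_def)

lemma measurable_path_space_continuous:
  assumes "continuous_map compact_open_topology compact_open_topology f"
  shows "f \<in> path_space \<rightarrow>\<^sub>M path_space"
  unfolding path_space_def[where 'a='b]
proof (rule measurable_measure_of)
  show "{W. openin (compact_open_topology :: (real \<Rightarrow> 'b) topology) W} \<subseteq> Pow paths"
    using openin_subset[of compact_open_topology] by auto
  show "f \<in> space path_space \<rightarrow> paths"
    using continuous_map_image_subset_topspace[OF assms] by auto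
  fix W :: "(real \<Rightarrow> 'b) set" assume "W \<in> {W. openin compact_open_topology W}"
  then have "openin compact_open_topology {\<omega> \<in> paths. f \<omega> \<in> W}"
    using openin_continuous_map_preimage[OF assms, of W] by simp
  moreover have "{\<omega> \<in> paths. f \<omega> \<in> W} = f -` W \<inter> space path_space"
    by auto
  ultimately show "f -` W \<inter> space path_space \<in> sets path_space"
    by (auto simp: sets_path_space)
qed

lemma open_compact_open:
  "K \<subseteq> {0..} \<Longrightarrow> compact K \<Longrightarrow> open U \<Longrightarrow> openin compact_open_topology {\<omega> \<in> paths. \<omega> ` K \<subseteq> U}"
  unfolding compact_open_topology_def by (rule topology_generated_by_Basis) auto

text \<open>
  Shifts and translations have to be measurable for the Borel sets of the compact-open topology, which
  may be finer than the events generated by the coordinates; so they are shown to be continuous.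
\<close>

lemma compact_open_continuous_mapI:
  fixes f :: "(real \<Rightarrow> 'a::topological_space) \<Rightarrow> real \<Rightarrow> 'b::topological_space"
  assumes "\<And>\<omega>. \<omega> \<in> paths \<Longrightarrow> f \<omega> \<in> paths"
    and "\<And>K U. K \<subseteq> {0..} \<Longrightarrow> compact K \<Longrightarrow> open U \<Longrightarrow>
      openin compact_open_topology {\<omega> \<in> paths. f \<omega> ` K \<subseteq> U}"
  shows "continuous_map compact_open_topology compact_open_topology f"
  unfolding compact_open_topology_def[where 'a='b]
proof (rule continuous_on_generated_topo, clarify)
  fix K :: "real set" and U :: "'b set" assume KU: "K \<subseteq> {0..}" "compact K" "open U"
  have "f -` {\<omega> \<in> paths. \<omega> ` K \<subseteq> U} \<inter> topspace compact_open_topology = {\<omega> \<in> paths. f \<omega> ` K \<subseteq> U}"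
    using assms(1) by auto
  then show "openin compact_open_topology
      (f -` {\<omega> \<in> paths. \<omega> ` K \<subseteq> U} \<inter> topspace compact_open_topology)"
    using assms(2)[OF KU] by simp
next
  have "topspace (compact_open_topology :: (real \<Rightarrow> 'b) topology) = paths" by simp
  then show "f ` topspace compact_open_topology
      \<subseteq> \<Union> {{\<omega> \<in> paths. \<omega> ` K \<subseteq> U} |K U. K \<subseteq> {0..} \<and> compact K \<and> open U}"
    using assms(1) unfolding compact_open_topology_def[where 'a='b] topology_generated_by_topspace
    by auto
qed

lemma measurable_path_map:
  fixes \<Phi> :: "'a::topological_space \<Rightarrow> 'b::topological_space"
  assumes "continuous_on UNIV \<Phi>"
  shows "path_map \<Phi> \<in> path_space \<rightarrow>\<^sub>M path_space"
proof (rule measurable_path_space_continuous, rule compact_open_continuous_mapI)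
  fix K :: "real set" and U :: "'b set" assume K: "K \<subseteq> {0..}" "compact K" "open U"
  have "{\<omega> \<in> paths. path_map \<Phi> \<omega> ` K \<subseteq> U} = {\<omega> \<in> paths. \<omega> ` K \<subseteq> \<Phi> -` U}"
    using K(1) by (auto simp: path_map_def)
  moreover have "open (\<Phi> -` U)" using assms K(3) by (simp add: open_vimage)
  ultimately show "openin compact_open_topology {\<omega> \<in> paths. path_map \<Phi> \<omega> ` K \<subseteq> U}"
    using open_compact_open[OF K(1,2)] by simp
qed (rule path_map_in_paths[OF assms])

lemma measurable_shift:
  fixes s :: real
  assumes "0 \<le> s"
  shows "shift s \<in> path_space \<rightarrow>\<^sub>M path_space"
proof (rule measurable_path_space_continuous, rule compact_open_continuous_mapI)
  fix K :: "real set" and U :: "'a set" assume K: "K \<subseteq> {0..}" "compact K" "open U"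
  have "{\<omega> \<in> paths. shift s \<omega> ` K \<subseteq> U} = {\<omega> \<in> paths. \<omega> ` ((\<lambda>t. t + s) ` K) \<subseteq> U}"
    using K(1) by (force simp: shift_def)
  moreover have "compact ((\<lambda>t. t + s) ` K)"
    by (intro compact_continuous_image K continuous_intros)
  moreover have "(\<lambda>t. t + s) ` K \<subseteq> {0..}" using K(1) assms by force
  ultimately show "openin compact_open_topology {\<omega> \<in> paths. shift s \<omega> ` K \<subseteq> U}"
    using open_compact_open[of "(\<lambda>t. t + s) ` K" U] K(3) by simp
qed (rule shift_in_paths[OF assms])

lemma space_sigma_of [simp]: "space (sigma_of I Y) = paths"
  by (simp add: sigma_of_def space_measure_of_conv)

lemma measurable_sigma_of_coord:
  assumes "t \<in> I"
  shows "Y t \<in> sigma_of I Y \<rightarrow>\<^sub>M borel"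
proof (rule measurableI)
  fix B :: "'b set" assume "B \<in> sets borel"
  with assms have "Y t -` B \<inter> paths \<in> {Y t -` B \<inter> paths |t B. t \<in> I \<and> B \<in> sets borel}" by blast
  then show "Y t -` B \<inter> space (sigma_of I Y) \<in> sets (sigma_of I Y)"
    unfolding sets_sigma_of space_sigma_of by (rule sigma_sets.Basic)
qed simp

lemma measurable_into_sigma_of:
  assumes "f \<in> space N \<rightarrow> paths" "\<And>t. t \<in> I \<Longrightarrow> (\<lambda>n. Y t (f n)) \<in> N \<rightarrow>\<^sub>M borel"
  shows "f \<in> N \<rightarrow>\<^sub>M sigma_of I Y"
  unfolding sigma_of_def
proof (rule measurable_measure_of)
  fix B assume "B \<in> {Y t -` B \<inter> paths |t B. t \<in> I \<and> B \<in> sets borel}"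
  then obtain t C where B: "B = Y t -` C \<inter> paths" "t \<in> I" "C \<in> sets borel" by auto
  then have "f -` B \<inter> space N = (\<lambda>n. Y t (f n)) -` C \<inter> space N" using assms(1) by auto
  with assms(2)[OF B(2)] B(3) show "f -` B \<inter> space N \<in> sets N"
    by (simp add: measurable_sets)
qed (use assms(1) in auto)

lemma sigma_of_subset:
  assumes "\<And>t. t \<in> I \<Longrightarrow> Y t \<in> N \<rightarrow>\<^sub>M borel" "space N = paths"
  shows "sets (sigma_of I Y) \<subseteq> sets N"
proof -
  have "(\<lambda>\<omega>. \<omega>) \<in> N \<rightarrow>\<^sub>M sigma_of I Y"
    by (rule measurable_into_sigma_of) (use assms in auto)
  then have "(\<lambda>\<omega>. \<omega>) -` A \<inter> paths \<in> sets N" if "A \<in> sets (sigma_of I Y)" for A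
    using measurable_sets[OF _ that] assms(2) by metis
  then show ?thesis
    using sets.sets_into_space[of _ "sigma_of I Y"] by (simp add: subset_iff Int_absorb2)
qed

abbreviation coord_space :: "(real \<Rightarrow> 'a::topological_space) measure" where
  "coord_space \<equiv> sigma_of {0..} (\<lambda>t \<omega>. \<omega> t)"

lemma coord_space_subset: "sets coord_space \<subseteq> sets path_space"
  by (rule sigma_of_subset) (simp_all add: measurable_eval)

lemma space_canonical_filtration [simp]: "space (canonical_filtration t) = paths"
  by (simp add: canonical_filtration_def)

lemma canonical_filtration_subset: "sets (canonical_filtration t) \<subseteq> sets coord_space"
  unfolding canonical_filtration_def
  by (rule sigma_of_subset) (simp_all add: measurable_sigma_of_coord[where Y="\<lambda>t \<omega>. \<omega> t"])

lemma measurable_canonical_filtration_path_space: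
  assumes "Z \<in> borel_measurable (canonical_filtration s)"
  shows "Z \<in> borel_measurable path_space"
  by (rule measurable_from_subalg[OF _ assms])
    (use canonical_filtration_subset[of s] coord_space_subset in \<open>auto simp: subalgebra_def\<close>)

lemma measurable_canonical_filtration_coord:
  "0 \<le> s \<Longrightarrow> s \<le> t \<Longrightarrow> (\<lambda>\<omega>. \<omega> s) \<in> canonical_filtration (ennreal t) \<rightarrow>\<^sub>M borel"
  unfolding canonical_filtration_def
  by (rule measurable_sigma_of_coord[where Y="\<lambda>t \<omega>. \<omega> t"]) (simp add: ennreal_leI)

lemma measurable_path_map_filtration:
  assumes "continuous_on UNIV \<Phi>"
  shows "path_map \<Phi> \<in> canonical_filtration t \<rightarrow>\<^sub>M canonical_filtration t"
  unfolding canonical_filtration_def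
proof (rule measurable_into_sigma_of)
  fix s :: real assume s: "s \<in> {s. 0 \<le> s \<and> ennreal s \<le> t}"
  then have "(\<lambda>\<omega>. \<Phi> (\<omega> s)) \<in> sigma_of {s. 0 \<le> s \<and> ennreal s \<le> t} (\<lambda>t \<omega>. \<omega> t) \<rightarrow>\<^sub>M borel"
    by (rule measurable_compose[OF measurable_sigma_of_coord[where Y="\<lambda>t \<omega>. \<omega> t"]
        borel_measurable_continuous_onI[OF assms]])
  with s show "(\<lambda>\<omega>. path_map \<Phi> \<omega> s) \<in> sigma_of {s. 0 \<le> s \<and> ennreal s \<le> t} (\<lambda>t \<omega>. \<omega> t) \<rightarrow>\<^sub>M borel"
    by simp
qed (use path_map_in_paths[OF assms] in auto)

section \<open>Equivariance in law\<close>

lemma finite_measure_subalgebra_filtration: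
  assumes "prob_space Q" "sets Q = sets path_space"
  shows "finite_measure_subalgebra Q (canonical_filtration t)"
proof -
  interpret prob_space Q by fact
  have "space Q = paths" using sets_eq_imp_space_eq[OF assms(2)] by simp
  then show ?thesis
    using canonical_filtration_subset[of t] coord_space_subset assms(2)
    by unfold_locales (auto simp: subalgebra_def)
qed

text \<open>
  The martingale property passes through a path map because the map sends the filtration to
  itself.
\<close>

lemma martingale_distr_path_map:
  fixes \<Phi> :: "'a::topological_space \<Rightarrow> 'b::topological_space"
    and M :: "real \<Rightarrow> (real \<Rightarrow> 'b) \<Rightarrow> real"
  assumes Q: "prob_space Q" "sets Q = sets path_space"
    and \<Phi>: "continuous_on UNIV \<Phi>"
    and meas: "\<And>t. 0 \<le> t \<Longrightarrow> M t \<in> borel_measurable (canonical_filtration (ennreal t))"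
    and mart: "martingale Q canonical_filtration M'"
    and eq: "\<And>t \<omega>. 0 \<le> t \<Longrightarrow> M t (path_map \<Phi> \<omega>) = M' t \<omega>"
  shows "martingale (distr Q path_space (path_map \<Phi>)) canonical_filtration M"
proof -
  let ?D = "distr Q path_space (path_map \<Phi>)"
  have [measurable_cong]: "sets Q = sets path_space" by fact
  have pm [measurable]: "path_map \<Phi> \<in> Q \<rightarrow>\<^sub>M path_space"
    using measurable_path_map[OF \<Phi>] Q(2) by (simp cong: measurable_cong_sets)
  have prob: "prob_space ?D" by (rule prob_space.prob_space_distr[OF Q(1) pm])
  have Mps [measurable]: "M t \<in> borel_measurable path_space" if "0 \<le> t" for t
    by (rule measurable_canonical_filtration_path_space[OF meas[OF that]])
  have int: "integrable ?D (M t)" if "0 \<le> t" for t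
    using mart that by (simp add: martingale_def integrable_distr_eq[OF pm Mps] eq)
  have "AE \<omega> in ?D. real_cond_exp ?D (canonical_filtration (ennreal s)) (M t) \<omega> = M s \<omega>"
    if st: "0 \<le> s" "s \<le> t" for s t
  proof -
    interpret D: finite_measure_subalgebra ?D "canonical_filtration (ennreal s)"
      by (rule finite_measure_subalgebra_filtration[OF prob]) simp
    interpret Q: finite_measure_subalgebra Q "canonical_filtration (ennreal s)"
      by (rule finite_measure_subalgebra_filtration[OF Q])
    show ?thesis
    proof (rule D.real_cond_exp_charact)
      fix A :: "(real \<Rightarrow> 'b) set" assume A: "A \<in> sets (canonical_filtration (ennreal s))"
      have A_ps [measurable]: "A \<in> sets path_space"
        using A canonical_filtration_subset coord_space_subset by blast
      let ?A = "path_map \<Phi> -` A \<inter> paths"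
      have A': "?A \<in> sets (canonical_filtration (ennreal s))"
        using measurable_sets[OF measurable_path_map_filtration[OF \<Phi>] A] by simp
      have conv: "(\<integral>\<omega>\<in>A. M u \<omega> \<partial>?D) = (\<integral>\<omega>\<in>?A. M' u \<omega> \<partial>Q)" if u: "0 \<le> u" for u
      proof -
        have [measurable]: "M u \<in> borel_measurable path_space" by (rule Mps[OF u])
        have "(\<integral>\<omega>\<in>A. M u \<omega> \<partial>?D) = (\<integral>\<omega>. indicator A (path_map \<Phi> \<omega>) *\<^sub>R M u (path_map \<Phi> \<omega>) \<partial>Q)"
          unfolding set_lebesgue_integral_def by (rule integral_distr[OF pm]) measurable
        also have "\<dots> = (\<integral>\<omega>\<in>?A. M' u \<omega> \<partial>Q)"
          unfolding set_lebesgue_integral_def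
          by (rule Bochner_Integration.integral_cong[OF refl])
            (use sets_eq_imp_space_eq[OF Q(2)] u in \<open>auto simp: eq indicator_def\<close>)
        finally show ?thesis .
      qed
      have "(\<integral>\<omega>\<in>?A. M' t \<omega> \<partial>Q)
          = (\<integral>\<omega>\<in>?A. real_cond_exp Q (canonical_filtration (ennreal s)) (M' t) \<omega> \<partial>Q)"
        by (rule Q.real_cond_exp_intA[OF _ A']) (use mart st in \<open>auto simp: martingale_def\<close>)
      also have "\<dots> = (\<integral>\<omega>\<in>?A. M' s \<omega> \<partial>Q)"
      proof -
        have ae: "AE \<omega> in Q. real_cond_exp Q (canonical_filtration (ennreal s)) (M' t) \<omega> = M' s \<omega>"
          using mart st by (auto simp: martingale_def)
        have "M' s \<in> borel_measurable Q"
          using mart st(1) by (auto simp: martingale_def)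
        moreover have "?A \<in> sets Q"
          using A' canonical_filtration_subset coord_space_subset Q(2) by blast
        ultimately show ?thesis
          using ae by (intro set_lebesgue_integral_cong_AE) auto
      qed
      finally show "(\<integral>\<omega>\<in>A. M t \<omega> \<partial>?D) = (\<integral>\<omega>\<in>A. M s \<omega> \<partial>?D)"
        using st by (simp add: conv)
    qed (use st int meas in auto)
  qed
  with meas int show ?thesis by (auto simp: martingale_def)
qed

lemma continuous_left_mult:
  assumes "continuous_on UNIV (\<lambda>(a, b). a \<otimes>\<^bsub>G\<^esub> b)"
  shows "continuous_on UNIV (left_mult G a)"
  unfolding left_mult_def case_prod_beta'
  by (intro continuous_intros continuous_on_group_mult[OF assms])

text \<open>
  The image of the law started at \<open>(x, h)\<close> under left translation solves the martingale problem
  of the same generator from \<open>(x, a \<otimes> h)\<close>, so uniqueness identifies it.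
\<close>

lemma diffusion_left_mult_law:
  fixes \<X> :: "('x::{t2_space, second_countable_topology}, 'e::euclidean_space) chart set"
    and \<G> :: "('g::{t2_space, second_countable_topology}, 'f::euclidean_space) chart set"
  assumes X: "smooth_manifold \<X>" and G: "lie_group G \<G>"
    and P: "diffusion (prod_atlas \<X> \<G>) L P"
    and E: "equivariant (prod_atlas \<X> \<G>) G L"
  shows "distr (P z) path_space (path_map (left_mult G a)) = P (left_mult G a z)"
proof -
  let ?T = "path_map (left_mult G a)" and ?\<A> = "prod_atlas \<X> \<G>"
  let ?D = "distr (P z) path_space ?T"
  have cont: "continuous_on UNIV (left_mult G a :: 'x \<times> 'g \<Rightarrow> _)"
    by (rule continuous_left_mult[OF lie_groupD(5)[OF G]])
  have sol: "solves_martingale_problem ?\<A> L z (P z)" for z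
    using P unfolding diffusion_def by blast
  then have prob: "prob_space (P z)" and sets: "sets (P z) = sets path_space"
    and start: "AE \<omega> in P z. \<omega> 0 = z" by (auto simp: solves_martingale_problem_def)
  have T [measurable]: "?T \<in> P z \<rightarrow>\<^sub>M path_space"
    using measurable_path_map[OF cont] sets by (simp cong: measurable_cong_sets)
  have "solves_martingale_problem ?\<A> L (left_mult G a z) ?D"
    unfolding solves_martingale_problem_def
  proof (intro conjI allI impI)
    show "prob_space ?D" by (rule prob_space.prob_space_distr[OF prob T])
    have "{\<omega> \<in> space path_space. \<omega> 0 = left_mult G a z} \<in> sets path_space"
    proof -
      have "{\<omega> \<in> space path_space. \<omega> 0 = left_mult G a z}
          = (\<lambda>\<omega>. \<omega> 0) -` {left_mult G a z} \<inter> space path_space" by auto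
      then show ?thesis
        using measurable_sets[OF measurable_eval[of 0], of "{left_mult G a z}"] by simp
    qed
    then show "AE \<omega> in ?D. \<omega> 0 = left_mult G a z"
      using start by (subst AE_distr_iff[OF T]) (auto elim: eventually_mono)
  next
    fix f assume f: "test_fun ?\<A> f"
    let ?f = "group_act G a f"
    have f_eq: "group_act G a u = (\<lambda>z. u (left_mult G a z))" for u :: "'x \<times> 'g \<Rightarrow> real"
      by (auto simp: group_act_def left_mult_def)
    have "L ?f = group_act G a (L f)"
      using E f lie_groupD(2)[OF G] by (auto simp: equivariant_def test_fun_def)
    then have L_eq: "L ?f = (\<lambda>z. L f (left_mult G a z))" by (simp add: f_eq)
    have mart: "martingale (P z) canonical_filtration
        (\<lambda>t \<omega>. f (\<omega> t) - f (\<omega> 0) - (LBINT s:{0..t}. L f (\<omega> s)))" if "test_fun ?\<A> f" for f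
      using sol[of z] that by (simp add: solves_martingale_problem_def)
    show "martingale ?D canonical_filtration
        (\<lambda>t \<omega>. f (\<omega> t) - f (\<omega> 0) - (LBINT s:{0..t}. L f (\<omega> s)))"
    proof (rule martingale_distr_path_map[OF prob sets cont _ mart[OF test_fun_group_act[OF X G f]]])
      show "(\<lambda>\<omega>. f (\<omega> t) - f (\<omega> 0) - (LBINT s:{0..t}. L f (\<omega> s)))
          \<in> borel_measurable (canonical_filtration (ennreal t))" if "0 \<le> t" for t
        using mart[OF f] that by (simp add: martingale_def)
      fix t :: real and \<omega> :: "real \<Rightarrow> 'x \<times> 'g" assume t: "0 \<le> t"
      have "(LBINT s:{0..t}. L f (?T \<omega> s)) = (LBINT s:{0..t}. L ?f (\<omega> s))"
        by (rule set_lebesgue_integral_cong) (auto simp: L_eq)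
      with t show "f (?T \<omega> t) - f (?T \<omega> 0) - (LBINT s:{0..t}. L f (?T \<omega> s))
          = ?f (\<omega> t) - ?f (\<omega> 0) - (LBINT s:{0..t}. L ?f (\<omega> s))"
        by (simp add: f_eq)
    qed
  qed simp
  then show ?thesis using P unfolding diffusion_def by blast
qed

section \<open>Markov families on path space\<close>

locale markov_family =
  fixes P :: "'z::{t2_space, second_countable_topology} \<Rightarrow> (real \<Rightarrow> 'z) measure"
  assumes strong_markov: "strong_markov_family P"
begin

lemma measurable_P: "P \<in> borel \<rightarrow>\<^sub>M prob_algebra path_space"
  using strong_markov by (simp add: strong_markov_family_def)

lemma measurable_P_subprob [measurable]: "P \<in> borel \<rightarrow>\<^sub>M subprob_algebra path_space"
  by (rule measurable_prob_algebraD[OF measurable_P])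

lemma prob_space_P: "prob_space (P z)" and sets_P [simp, measurable_cong]: "sets (P z) = sets path_space"
  using measurable_space[OF measurable_P, of z] by (auto simp: space_prob_algebra)

lemma space_P [simp]: "space (P z) = paths"
  using sets_eq_imp_space_eq[OF sets_P] by simp

lemma measurable_P_eq: "measurable (P z) N = measurable path_space N"
  by (rule measurable_cong_sets[OF sets_P refl])

sublocale prob: prob_space "P z" for z
  by (rule prob_space_P)

lemma integrable_bounded:
  fixes V :: "(real \<Rightarrow> 'z) \<Rightarrow> real"
  assumes "V \<in> borel_measurable path_space" "\<And>\<omega>. \<omega> \<in> paths \<Longrightarrow> \<bar>V \<omega>\<bar> \<le> C"
  shows "integrable (P z) V"
  using assms by (intro prob.integrable_const_bound[of _ C]) auto

lemma expectation_bounded: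
  fixes V :: "(real \<Rightarrow> 'z) \<Rightarrow> real"
  assumes "V \<in> borel_measurable path_space" "\<And>\<omega>. \<omega> \<in> paths \<Longrightarrow> \<bar>V \<omega>\<bar> \<le> C"
  shows "\<bar>\<integral>\<omega>. V \<omega> \<partial>P z\<bar> \<le> C"
proof -
  have "\<bar>\<integral>\<omega>. V \<omega> \<partial>P z\<bar> \<le> (\<integral>\<omega>. \<bar>V \<omega>\<bar> \<partial>P z)" by (rule integral_abs_bound)
  also have "\<dots> \<le> (\<integral>\<omega>. C \<partial>P z)"
    by (intro integral_mono integrable_abs integrable_bounded[OF assms] integrable_const)
      (use assms(2) in auto)
  finally show ?thesis using prob.prob_space[of z] by simp
qed

lemma measurable_expectation:
  fixes V :: "(real \<Rightarrow> 'z) \<Rightarrow> real"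
  assumes "V \<in> borel_measurable path_space"
  shows "(\<lambda>z. \<integral>\<omega>. V \<omega> \<partial>P z) \<in> borel_measurable borel"
  using measurable_compose[OF measurable_P_subprob integral_measurable_subprob_algebra[OF assms]] .

lemma sets_pre_sigma_const:
  "sets (filtration.pre_sigma paths canonical_filtration (\<lambda>_::real \<Rightarrow> 'z. c))
    = sets (canonical_filtration c)"
proof -
  interpret filtration paths "canonical_filtration :: ennreal \<Rightarrow> (real \<Rightarrow> 'z) measure"
    by (rule filtration_canonical)
  have iff: "A \<in> sets (canonical_filtration c) \<longleftrightarrow> (\<forall>t. {\<omega> \<in> A. c \<le> t} \<in> sets (canonical_filtration t))"
    for A :: "(real \<Rightarrow> 'z) set"
  proof
    assume A: "A \<in> sets (canonical_filtration c)"
    show "\<forall>t. {\<omega> \<in> A. c \<le> t} \<in> sets (canonical_filtration t)"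
    proof
      fix t show "{\<omega> \<in> A. c \<le> t} \<in> sets (canonical_filtration t)"
        using subsetD[OF sets_F_mono A, of t] by (cases "c \<le> t") simp_all
    qed
  next
    assume "\<forall>t. {\<omega> \<in> A. c \<le> t} \<in> sets (canonical_filtration t)"
    then have "{\<omega> \<in> A. c \<le> c} \<in> sets (canonical_filtration c)" by blast
    then show "A \<in> sets (canonical_filtration c)" by simp
  qed
  show ?thesis
    unfolding sets_pre_sigma[OF stopping_time_const]
    by (rule Set.set_eqI, unfold mem_Collect_eq) (rule iff[symmetric])
qed

text \<open>
  The strong Markov property for a constant stopping time; integrating against a function \<open>Y\<close> of the
  past removes the conditional expectation.
\<close>

lemma markov:
  fixes V Y :: "(real \<Rightarrow> 'z) \<Rightarrow> real"
  assumes t: "0 \<le> t"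
    and V: "V \<in> borel_measurable path_space" "\<And>\<omega>. \<omega> \<in> paths \<Longrightarrow> \<bar>V \<omega>\<bar> \<le> C"
    and Y: "Y \<in> borel_measurable (canonical_filtration (ennreal t))"
      "\<And>\<omega>. \<omega> \<in> paths \<Longrightarrow> \<bar>Y \<omega>\<bar> \<le> D"
  shows "(\<integral>\<omega>. Y \<omega> * V (shift t \<omega>) \<partial>P z) = (\<integral>\<omega>. Y \<omega> * (\<integral>\<omega>'. V \<omega>' \<partial>P (\<omega> t)) \<partial>P z)"
proof -
  let ?G = "filtration.pre_sigma paths canonical_filtration (\<lambda>_::real \<Rightarrow> 'z. ennreal t)"
  interpret F: filtration paths "canonical_filtration :: ennreal \<Rightarrow> (real \<Rightarrow> 'z) measure"
    by (rule filtration_canonical)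
  have sub: "subalgebra (P z) ?G"
    using canonical_filtration_subset[of "ennreal t"] coord_space_subset
    by (auto simp: subalgebra_def F.space_pre_sigma sets_pre_sigma_const)
  interpret G: finite_measure_subalgebra "P z" ?G
    by unfold_locales (rule sub)
  have "bounded (V ` paths)"
    using V(2) by (auto simp: bounded_iff intro!: exI[of _ C])
  with V(1) stopping_time_const have
    "stopping_time canonical_filtration (\<lambda>_::real \<Rightarrow> 'z. ennreal t) \<and>
      V \<in> borel_measurable path_space \<and> bounded (V ` paths)" by simp
  with strong_markov[unfolded strong_markov_family_def, THEN conjunct2, THEN conjunct2,
      THEN spec[of _ z], THEN spec[of _ "\<lambda>_. ennreal t"], THEN spec[of _ V]]
  have "AE \<omega> in P z. ennreal t < \<infinity> \<longrightarrow>
           real_cond_exp (P z) ?G (\<lambda>\<omega>'. V (shift (enn2real (ennreal t)) \<omega>')) \<omega>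
           = (\<integral>\<omega>'. V \<omega>' \<partial>P (\<omega> (enn2real (ennreal t))))"
    by (rule mp)
  then have ae: "AE \<omega> in P z. real_cond_exp (P z) ?G (\<lambda>\<omega>'. V (shift t \<omega>')) \<omega> = (\<integral>\<omega>'. V \<omega>' \<partial>P (\<omega> t))"
    using t by simp
  have Yp: "Y \<in> borel_measurable path_space"
    by (rule measurable_canonical_filtration_path_space[OF Y(1)])
  have Vs: "(\<lambda>\<omega>. V (shift t \<omega>)) \<in> borel_measurable path_space"
    by (rule measurable_compose[OF measurable_shift[OF t] V(1)])
  have EV: "(\<lambda>\<omega>. \<integral>\<omega>'. V \<omega>' \<partial>P (\<omega> t)) \<in> borel_measurable path_space"
    by (rule measurable_compose[OF measurable_eval[OF t] measurable_expectation[OF V(1)]])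
  have "integrable (P z) (\<lambda>\<omega>. Y \<omega> * V (shift t \<omega>))"
  proof (rule integrable_bounded[where C="D * C"])
    show "(\<lambda>\<omega>. Y \<omega> * V (shift t \<omega>)) \<in> borel_measurable path_space"
      by (intro borel_measurable_times Yp Vs)
    fix \<omega> :: "real \<Rightarrow> 'z" assume \<omega>: "\<omega> \<in> paths"
    have "\<bar>V (shift t \<omega>)\<bar> \<le> C" by (rule V(2)[OF shift_in_paths[OF t \<omega>]])
    moreover have "\<bar>Y \<omega>\<bar> \<le> D" by (rule Y(2)[OF \<omega>])
    ultimately show "\<bar>Y \<omega> * V (shift t \<omega>)\<bar> \<le> D * C"
      unfolding abs_mult by (intro mult_mono) linarith+
  qed
  moreover have "Y \<in> borel_measurable ?G"
    using Y(1) unfolding measurable_cong_sets[OF sets_pre_sigma_const refl] .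
  moreover have "(\<lambda>\<omega>. V (shift t \<omega>)) \<in> borel_measurable (P z)"
    using Vs unfolding measurable_P_eq .
  ultimately have "(\<integral>\<omega>. Y \<omega> * V (shift t \<omega>) \<partial>P z)
      = (\<integral>\<omega>. Y \<omega> * real_cond_exp (P z) ?G (\<lambda>\<omega>'. V (shift t \<omega>')) \<omega> \<partial>P z)"
    by (rule G.real_cond_exp_intg(2)[symmetric])
  also have "\<dots> = (\<integral>\<omega>. Y \<omega> * (\<integral>\<omega>'. V \<omega>' \<partial>P (\<omega> t)) \<partial>P z)"
  proof (rule integral_cong_AE)
    have "real_cond_exp (P z) ?G (\<lambda>\<omega>'. V (shift t \<omega>')) \<in> borel_measurable (P z)"
      by (rule borel_measurable_cond_exp2)
    then show "(\<lambda>\<omega>. Y \<omega> * real_cond_exp (P z) ?G (\<lambda>\<omega>'. V (shift t \<omega>')) \<omega>)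
        \<in> borel_measurable (P z)"
      using Yp unfolding measurable_P_eq by (intro borel_measurable_times)
    show "(\<lambda>\<omega>. Y \<omega> * (\<integral>\<omega>'. V \<omega>' \<partial>P (\<omega> t))) \<in> borel_measurable (P z)"
      using Yp EV unfolding measurable_P_eq by (intro borel_measurable_times)
    show "AE \<omega> in P z. Y \<omega> * real_cond_exp (P z) ?G (\<lambda>\<omega>'. V (shift t \<omega>')) \<omega>
        = Y \<omega> * (\<integral>\<omega>'. V \<omega>' \<partial>P (\<omega> t))"
      using ae by eventually_elim simp
  qed
  finally show ?thesis .
qed

lemma markov_expectation:
  fixes V :: "(real \<Rightarrow> 'z) \<Rightarrow> real"
  assumes t: "0 \<le> t"
    and V: "V \<in> borel_measurable path_space" "\<And>\<omega>. \<omega> \<in> paths \<Longrightarrow> \<bar>V \<omega>\<bar> \<le> C"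
  shows "(\<integral>\<omega>. V (shift t \<omega>) \<partial>P z) = (\<integral>\<omega>. (\<integral>\<omega>'. V \<omega>' \<partial>P (\<omega> t)) \<partial>P z)"
  using markov[OF t V, of "\<lambda>_. 1" 1] by simp

lemma AE_start: "AE \<omega> in P z. \<omega> 0 = z"
  using strong_markov by (simp add: strong_markov_family_def)

text \<open>
  The path after time \<open>t\<close> starts from a random point, so \<open>Q\<close> has to hold almost surely under all laws
  on one common measurable set.
\<close>

lemma AE_shift:
  assumes t: "0 \<le> t" and Q: "Measurable.pred path_space Q" and ae: "\<And>z. AE \<omega> in P z. Q \<omega>"
  shows "AE \<omega> in P z. Q (shift t \<omega>)"
proof -
  let ?V = "\<lambda>\<omega>. of_bool (\<not> Q \<omega>) :: real"
  have V [measurable]: "?V \<in> borel_measurable path_space"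
    using Q by measurable
  note [measurable] = measurable_shift[OF t]
  have "(\<integral>\<omega>'. ?V \<omega>' \<partial>P y) = 0" for y
    using ae[of y] by (intro integral_eq_zero_AE) auto
  then have "(\<integral>\<omega>. ?V (shift t \<omega>) \<partial>P z) = 0"
    by (subst markov_expectation[OF t V, of 1]) simp_all
  moreover have "(\<lambda>\<omega>. ?V (shift t \<omega>)) \<in> borel_measurable path_space" by measurable
  then have "integrable (P z) (\<lambda>\<omega>. ?V (shift t \<omega>))" by (rule integrable_bounded[of _ 1]) auto
  ultimately have "AE \<omega> in P z. ?V (shift t \<omega>) = 0"
    by (subst (asm) integral_nonneg_eq_0_iff_AE) auto
  then show ?thesis by (auto elim: eventually_mono)
qed

end

section \<open>Completion with respect to all starting points\<close>

text \<open>
  The approximating event is the same for all starting points. This uniformity is what the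
  description of the invariant events of the first component by \<open>linf\<close> offers, and it
  is needed with the Markov property, where the path restarts from a random point.
\<close>

definition universal_completion ::
  "('z \<Rightarrow> (real \<Rightarrow> 'a::topological_space) measure) \<Rightarrow> (real \<Rightarrow> 'a) measure \<Rightarrow> (real \<Rightarrow> 'a) measure" where
  "universal_completion P M =
     sigma paths {B \<in> sets path_space. \<exists>A\<in>sets M. \<forall>z. AE \<omega> in P z. \<omega> \<in> A \<longleftrightarrow> \<omega> \<in> B}"

lemma space_universal_completion [simp]: "space (universal_completion P M) = paths"
  by (simp add: universal_completion_def space_measure_of_conv)

lemma sets_universal_completion:
  assumes "space M = paths"
  shows "sets (universal_completion P M)
    = {B \<in> sets path_space. \<exists>A\<in>sets M. \<forall>z. AE \<omega> in P z. \<omega> \<in> A \<longleftrightarrow> \<omega> \<in> B}" (is "_ = ?S")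
proof -
  have "sigma_algebra paths ?S"
    unfolding sigma_algebra_iff2
  proof (intro conjI ballI allI impI)
    show "?S \<subseteq> Pow paths" using sets.sets_into_space[of _ path_space] by auto
    show "{} \<in> ?S" by (auto intro: bexI[of _ "{}"])
  next
    fix B assume "B \<in> ?S"
    then obtain A where A: "B \<in> sets path_space" "A \<in> sets M"
      "\<And>z. AE \<omega> in P z. \<omega> \<in> A \<longleftrightarrow> \<omega> \<in> B" by auto
    have "paths - A \<in> sets M" using A(2) assms by (metis sets.compl_sets)
    moreover have "AE \<omega> in P z. \<omega> \<in> paths - A \<longleftrightarrow> \<omega> \<in> paths - B" for z
      using A(3)[of z] by (auto elim: eventually_mono)
    moreover have "paths - B \<in> sets path_space"
      using sets.compl_sets[OF A(1)] by simp
    ultimately show "paths - B \<in> ?S" by blast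
  next
    fix B :: "nat \<Rightarrow> (real \<Rightarrow> 'a) set" assume B: "range B \<subseteq> ?S"
    then have "\<forall>i. \<exists>A. A \<in> sets M \<and> (\<forall>z. AE \<omega> in P z. \<omega> \<in> A \<longleftrightarrow> \<omega> \<in> B i)" by blast
    then obtain A where A: "\<And>i. A i \<in> sets M" "\<And>i z. AE \<omega> in P z. \<omega> \<in> A i \<longleftrightarrow> \<omega> \<in> B i"
      by metis
    have "AE \<omega> in P z. \<omega> \<in> (\<Union>i. A i) \<longleftrightarrow> \<omega> \<in> (\<Union>i. B i)" for z
    proof -
      have "AE \<omega> in P z. \<forall>i. \<omega> \<in> A i \<longleftrightarrow> \<omega> \<in> B i" using A(2) by (simp add: AE_all_countable)
      then show ?thesis by (auto elim: eventually_mono)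
    qed
    moreover have "(\<Union>i. A i) \<in> sets M" using A(1) by auto
    moreover have "(\<Union>i. B i) \<in> sets path_space" using B by auto
    ultimately show "(\<Union>i. B i) \<in> ?S" by blast
  qed
  then show ?thesis
    unfolding universal_completion_def by (rule sigma_algebra.sets_measure_of_eq)
qed

lemma in_universal_completion:
  assumes "space M = paths" "sets M \<subseteq> sets path_space"
  shows "sets M \<subseteq> sets (universal_completion P M)"
  using assms by (auto simp: sets_universal_completion)

lemma universal_completion_subset:
  "space M = paths \<Longrightarrow> sets (universal_completion P M) \<subseteq> sets path_space"
  by (auto simp: sets_universal_completion)

lemma measurable_universal_completion_path_space:
  assumes "f \<in> universal_completion P M \<rightarrow>\<^sub>M N" "space M = paths"
  shows "f \<in> path_space \<rightarrow>\<^sub>M N"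
  by (rule measurable_from_subalg[OF _ assms(1)])
    (use universal_completion_subset[OF assms(2)] in \<open>auto simp: subalgebra_def\<close>)

lemma universal_completion_mono:
  assumes "space M = paths" "space N = paths" "sets M \<subseteq> sets (universal_completion P N)"
  shows "sets (universal_completion P M) \<subseteq> sets (universal_completion P N)"
proof
  fix B assume "B \<in> sets (universal_completion P M)"
  then obtain A where A: "B \<in> sets path_space" "A \<in> sets M" "\<And>z. AE \<omega> in P z. \<omega> \<in> A \<longleftrightarrow> \<omega> \<in> B"
    using assms(1) by (auto simp: sets_universal_completion)
  then have "A \<in> sets (universal_completion P N)" using assms(3) by auto
  then obtain A' where A': "A' \<in> sets N" "\<And>z. AE \<omega> in P z. \<omega> \<in> A' \<longleftrightarrow> \<omega> \<in> A"
    using assms(2) by (auto simp: sets_universal_completion)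
  have "AE \<omega> in P z. \<omega> \<in> A' \<longleftrightarrow> \<omega> \<in> B" for z
    using A(3)[of z] A'(2)[of z] by eventually_elim simp
  with A(1) A'(1) show "B \<in> sets (universal_completion P N)"
    using assms(2) by (auto simp: sets_universal_completion)
qed

lemma measurable_universal_completion_mono:
  assumes "f \<in> universal_completion P M \<rightarrow>\<^sub>M L" "space M = paths" "space N = paths"
    "sets M \<subseteq> sets (universal_completion P N)"
  shows "f \<in> universal_completion P N \<rightarrow>\<^sub>M L"
  by (rule measurable_from_subalg[OF _ assms(1)])
    (use universal_completion_mono[OF assms(2-4)] in \<open>simp add: subalgebra_def\<close>)

lemma measurable_universal_completionI:
  assumes "f \<in> M \<rightarrow>\<^sub>M L" "space M = paths" "sets M \<subseteq> sets path_space"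
  shows "f \<in> universal_completion P M \<rightarrow>\<^sub>M L"
  by (rule measurable_from_subalg[OF _ assms(1)])
    (use in_universal_completion[OF assms(2,3)] assms(2) in \<open>simp add: subalgebra_def\<close>)

lemma measurable_universal_completion_cong:
  assumes f: "f \<in> universal_completion P M \<rightarrow>\<^sub>M L" and g: "g \<in> path_space \<rightarrow>\<^sub>M L"
    and M: "space M = paths" and ae: "\<And>z. AE \<omega> in P z. f \<omega> = g \<omega>"
    and P: "\<And>z. space (P z) = paths"
  shows "g \<in> universal_completion P M \<rightarrow>\<^sub>M L"
proof (rule measurableI)
  show "g \<omega> \<in> space L" if "\<omega> \<in> space (universal_completion P M)" for \<omega>
    using measurable_space[OF g] that by simp
  fix B assume B: "B \<in> sets L"
  have "f -` B \<inter> paths \<in> sets (universal_completion P M)"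
    using measurable_sets[OF f B] by simp
  then obtain A where A: "A \<in> sets M" "\<And>z. AE \<omega> in P z. \<omega> \<in> A \<longleftrightarrow> \<omega> \<in> f -` B \<inter> paths"
    using M by (auto simp: sets_universal_completion)
  have "AE \<omega> in P z. \<omega> \<in> A \<longleftrightarrow> \<omega> \<in> g -` B \<inter> paths" for z
    using A(2)[of z] ae[of z] by eventually_elim auto
  then show "g -` B \<inter> space (universal_completion P M) \<in> sets (universal_completion P M)"
    using A(1) measurable_sets[OF g B] M by (auto simp: sets_universal_completion)
qed

section \<open>Convergence of harmonic functions along paths\<close>

lemma closed_extend_from_rationals:
  fixes f :: "real \<Rightarrow> 'a::topological_space"
  assumes f: "continuous_on {m..} f" and C: "closed C"
    and q: "\<And>q. q \<in> \<rat> \<Longrightarrow> m \<le> q \<Longrightarrow> f q \<in> C" and t: "m \<le> t"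
  shows "f t \<in> C"
proof (rule ccontr)
  assume "f t \<notin> C"
  obtain B where B: "open B" "B \<inter> {m..} = f -` (- C) \<inter> {m..}"
    using f C unfolding continuous_on_open_invariant by (meson open_Compl)
  with \<open>f t \<notin> C\<close> t have "t \<in> B" by blast
  then obtain e where e: "0 < e" "\<And>s. dist s t < e \<Longrightarrow> s \<in> B"
    using B(1) by (metis open_dist)
  obtain q where "q \<in> \<rat>" "t < q" "q < t + e" using Rats_dense_in_real[of t "t + e"] e(1) by auto
  then have "q \<in> B \<inter> {m..}" using e(2)[of q] t by (auto simp: dist_real_def)
  with B(2) q[OF \<open>q \<in> \<rat>\<close>] show False by auto
qed

context markov_family
begin

lemma harmonicD:
  assumes "harmonic P H"
  shows "H \<in> borel_measurable borel" "\<And>z t. 0 \<le> t \<Longrightarrow> H z = (\<integral>\<omega>. H (\<omega> t) \<partial>P z)"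
    "\<exists>C. \<forall>z. \<bar>H z\<bar> \<le> C"
proof -
  have "H \<in> borel_measurable borel \<and> bounded (range H) \<and> (\<forall>z. \<forall>t\<ge>0. H z = (\<integral>\<omega>. H (\<omega> t) \<partial>P z))"
    using assms unfolding harmonic_def .
  then show "H \<in> borel_measurable borel" "\<And>z t. 0 \<le> t \<Longrightarrow> H z = (\<integral>\<omega>. H (\<omega> t) \<partial>P z)"
    and "\<exists>C. \<forall>z. \<bar>H z\<bar> \<le> C" unfolding bounded_iff by (blast, blast, force)
qed

lemma measurable_along_path:
  assumes "H \<in> borel_measurable borel" "0 \<le> t"
  shows "(\<lambda>\<omega>. H (\<omega> t)) \<in> borel_measurable path_space"
  by (rule measurable_compose[OF measurable_eval[OF assms(2)] assms(1)])

lemma harmonic_martingale: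
  assumes H: "harmonic P H" and st: "0 \<le> s" "s \<le> t"
    and Y: "Y \<in> borel_measurable (canonical_filtration (ennreal s))"
      "\<And>\<omega>. \<omega> \<in> paths \<Longrightarrow> \<bar>Y \<omega>\<bar> \<le> D"
  shows "(\<integral>\<omega>. Y \<omega> * H (\<omega> t) \<partial>P z) = (\<integral>\<omega>. Y \<omega> * H (\<omega> s) \<partial>P z)"
proof -
  obtain C where C: "\<And>z. \<bar>H z\<bar> \<le> C" using harmonicD(3)[OF H] by auto
  have "(\<integral>\<omega>. Y \<omega> * H (\<omega> t) \<partial>P z) = (\<integral>\<omega>. Y \<omega> * H (shift s \<omega> (t - s)) \<partial>P z)"
    using st by (simp add: shift_def)
  also have "\<dots> = (\<integral>\<omega>. Y \<omega> * (\<integral>\<omega>'. H (\<omega>' (t - s)) \<partial>P (\<omega> s)) \<partial>P z)"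
    by (rule markov[OF st(1) measurable_along_path[OF harmonicD(1)[OF H]] _ Y, of _ C])
      (use st C in auto)
  also have "\<dots> = (\<integral>\<omega>. Y \<omega> * H (\<omega> s) \<partial>P z)"
    by (subst harmonicD(2)[OF H, of "t - s", symmetric]) (use st in simp_all)
  finally show ?thesis .
qed

text \<open>
  Increments of a bounded martingale are orthogonal to the past.
\<close>

lemma harmonic_second_moment:
  assumes H: "harmonic P H" and st: "0 \<le> s" "s \<le> t"
  shows "(\<integral>\<omega>. (H (\<omega> t) - H (\<omega> s))\<^sup>2 \<partial>P z) = (\<integral>\<omega>. (H (\<omega> t))\<^sup>2 \<partial>P z) - (\<integral>\<omega>. (H (\<omega> s))\<^sup>2 \<partial>P z)"
proof -
  obtain C where C: "\<And>z. \<bar>H z\<bar> \<le> C" using harmonicD(3)[OF H] by auto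
  have m: "(\<lambda>\<omega>. H (\<omega> u)) \<in> borel_measurable path_space" if "0 \<le> u" for u
    by (rule measurable_along_path[OF harmonicD(1)[OF H] that])
  have int: "integrable (P z) (\<lambda>\<omega>. H (\<omega> u) * H (\<omega> v))" if "0 \<le> u" "0 \<le> v" for u v
  proof (rule integrable_bounded[where C="C * C"])
    show "\<bar>H (\<omega> u) * H (\<omega> v)\<bar> \<le> C * C" for \<omega>
      unfolding abs_mult using C[of "\<omega> u"] C[of "\<omega> v"] by (intro mult_mono) auto
  qed (intro borel_measurable_times m that)
  have "(\<lambda>\<omega>. H (\<omega> s)) \<in> borel_measurable (canonical_filtration (ennreal s))"
    by (rule measurable_compose[OF measurable_canonical_filtration_coord harmonicD(1)[OF H]])
      (use st in auto)
  then have "(\<integral>\<omega>. H (\<omega> s) * H (\<omega> t) \<partial>P z) = (\<integral>\<omega>. H (\<omega> s) * H (\<omega> s) \<partial>P z)"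
    by (rule harmonic_martingale[OF H st _ C])
  moreover have "(\<integral>\<omega>. (H (\<omega> t) - H (\<omega> s))\<^sup>2 \<partial>P z)
      = (\<integral>\<omega>. H (\<omega> t) * H (\<omega> t) - 2 * (H (\<omega> s) * H (\<omega> t)) + H (\<omega> s) * H (\<omega> s) \<partial>P z)"
    by (simp add: power2_eq_square algebra_simps)
  moreover have "\<dots> = (\<integral>\<omega>. H (\<omega> t) * H (\<omega> t) \<partial>P z) - 2 * (\<integral>\<omega>. H (\<omega> s) * H (\<omega> t) \<partial>P z)
      + (\<integral>\<omega>. H (\<omega> s) * H (\<omega> s) \<partial>P z)"
    using int st by simp
  ultimately show ?thesis by (simp add: power2_eq_square)
qed

text \<open>
  Decompose the event according to the first time in \<open>T\<close> at which the deviation exceeds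
  \<open>\<epsilon>\<close>; on each piece the later increment is orthogonal to the deviation reached there, so the
  final second moment dominates \<open>\<epsilon>\<^sup>2\<close> times the probability of the piece.
\<close>

lemma harmonic_maximal_inequality:
  assumes H: "harmonic P H" and T: "finite T" "\<And>t. t \<in> T \<Longrightarrow> m \<le> t \<and> t \<le> u"
    and m: "0 \<le> m" "m \<le> u" and \<epsilon>: "0 < \<epsilon>"
  shows "\<epsilon>\<^sup>2 * measure (P z) {\<omega> \<in> paths. \<exists>t\<in>T. \<epsilon> \<le> \<bar>H (\<omega> t) - H (\<omega> m)\<bar>}
    \<le> (\<integral>\<omega>. (H (\<omega> u))\<^sup>2 \<partial>P z) - (\<integral>\<omega>. (H (\<omega> m))\<^sup>2 \<partial>P z)"
proof -
  obtain C where C: "\<And>z. \<bar>H z\<bar> \<le> C" using harmonicD(3)[OF H] by auto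
  define D where "D t \<omega> = H (\<omega> t) - H (\<omega> m)" for t and \<omega> :: "real \<Rightarrow> 'z"
  have D_bound: "\<bar>D t \<omega>\<bar> \<le> 2 * C" for t \<omega>
    using C[of "\<omega> t"] C[of "\<omega> m"] by (simp add: D_def)
  have D_filt: "D t \<in> borel_measurable (canonical_filtration (ennreal s))" if "m \<le> t" "t \<le> s" for t s
    unfolding D_def
    by (intro borel_measurable_diff measurable_compose[OF measurable_canonical_filtration_coord
          harmonicD(1)[OF H]]) (use that m in auto)
  have D_meas: "D t \<in> borel_measurable path_space" if "m \<le> t" for t
    by (rule measurable_canonical_filtration_path_space[OF D_filt[OF that order_refl]])
  define A where "A \<tau> = {\<omega> \<in> paths. \<epsilon> \<le> \<bar>D \<tau> \<omega>\<bar> \<and> (\<forall>s\<in>{s\<in>T. s < \<tau>}. \<bar>D s \<omega>\<bar> < \<epsilon>)}" for \<tau>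
  have A_filt: "A \<tau> \<in> sets (canonical_filtration (ennreal \<tau>))" if "\<tau> \<in> T" for \<tau>
  proof -
    have [measurable]: "D \<tau> \<in> borel_measurable (canonical_filtration (ennreal \<tau>))"
      using D_filt[of \<tau> \<tau>] T(2)[OF that] by simp
    have "{\<omega> \<in> paths. \<bar>D s \<omega>\<bar> < \<epsilon>} \<in> sets (canonical_filtration (ennreal \<tau>))" if "s \<in> T" "s < \<tau>" for s
    proof -
      have [measurable]: "D s \<in> borel_measurable (canonical_filtration (ennreal \<tau>))"
        using D_filt[of s \<tau>] T(2)[OF \<open>s \<in> T\<close>] that by simp
      have "{\<omega> \<in> space (canonical_filtration (ennreal \<tau>)). \<bar>D s \<omega>\<bar> < \<epsilon>}
          \<in> sets (canonical_filtration (ennreal \<tau>))" by measurable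
      then show ?thesis by simp
    qed
    then have "{\<omega> \<in> space (canonical_filtration (ennreal \<tau>)). \<forall>s\<in>{s\<in>T. s < \<tau>}. \<bar>D s \<omega>\<bar> < \<epsilon>}
        \<in> sets (canonical_filtration (ennreal \<tau>))"
      using T(1) by (intro sets.sets_Collect_finite_All) auto
    moreover have "{\<omega> \<in> space (canonical_filtration (ennreal \<tau>)). \<epsilon> \<le> \<bar>D \<tau> \<omega>\<bar>}
        \<in> sets (canonical_filtration (ennreal \<tau>))" by measurable
    ultimately have "{\<omega> \<in> space (canonical_filtration (ennreal \<tau>)). \<epsilon> \<le> \<bar>D \<tau> \<omega>\<bar>}
        \<inter> {\<omega> \<in> space (canonical_filtration (ennreal \<tau>)). \<forall>s\<in>{s\<in>T. s < \<tau>}. \<bar>D s \<omega>\<bar> < \<epsilon>}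
        \<in> sets (canonical_filtration (ennreal \<tau>))" (is "?B \<in> _")
      by (rule sets.Int[rotated])
    moreover have "?B = A \<tau>" by (auto simp: A_def)
    ultimately show ?thesis by simp
  qed
  have A_meas: "A \<tau> \<in> sets path_space" if "\<tau> \<in> T" for \<tau>
    using A_filt[OF that] canonical_filtration_subset coord_space_subset by blast
  have sq_int: "integrable (P z) (\<lambda>\<omega>. indicator (A \<tau>) \<omega> * (D u \<omega>)\<^sup>2)" if "\<tau> \<in> T" for \<tau>
  proof (rule integrable_bounded[where C="(2 * C)\<^sup>2"])
    show "(\<lambda>\<omega>. indicator (A \<tau>) \<omega> * (D u \<omega>)\<^sup>2) \<in> borel_measurable path_space"
      using A_meas[OF that] D_meas[OF m(2)]
      by (intro borel_measurable_times borel_measurable_indicator borel_measurable_power)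
    show "\<bar>indicator (A \<tau>) \<omega> * (D u \<omega>)\<^sup>2\<bar> \<le> (2 * C)\<^sup>2" for \<omega>
      using power_mono[OF D_bound[of u \<omega>], of 2] by (auto simp: indicator_def)
  qed
  have piece: "\<epsilon>\<^sup>2 * measure (P z) (A \<tau>) \<le> (\<integral>\<omega>. indicator (A \<tau>) \<omega> * (D u \<omega>)\<^sup>2 \<partial>P z)" if \<tau>: "\<tau> \<in> T" for \<tau>
  proof -
    note m\<tau> = T(2)[OF \<tau>]
    define Y where "Y \<omega> = indicator (A \<tau>) \<omega> * D \<tau> \<omega>" for \<omega>
    have Y_filt: "Y \<in> borel_measurable (canonical_filtration (ennreal \<tau>))"
      unfolding Y_def using m\<tau> A_filt[OF \<tau>] D_filt[of \<tau> \<tau>]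
      by (intro borel_measurable_times borel_measurable_indicator) auto
    have Y_bound: "\<bar>Y \<omega>\<bar> \<le> 2 * C" for \<omega>
      using D_bound[of \<tau> \<omega>] by (auto simp: Y_def indicator_def)
    have YH: "integrable (P z) (\<lambda>\<omega>. Y \<omega> * H (\<omega> t))" if "0 \<le> t" for t
    proof (rule integrable_bounded[where C="(2 * C) * C"])
      show "(\<lambda>\<omega>. Y \<omega> * H (\<omega> t)) \<in> borel_measurable path_space"
        by (intro borel_measurable_times measurable_along_path[OF harmonicD(1)[OF H] that]
            measurable_canonical_filtration_path_space[OF Y_filt])
      show "\<bar>Y \<omega> * H (\<omega> t)\<bar> \<le> (2 * C) * C" for \<omega>
        unfolding abs_mult using Y_bound[of \<omega>] C[of "\<omega> t"] by (intro mult_mono) auto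
    qed
    have ortho: "(\<integral>\<omega>. 2 * (Y \<omega> * H (\<omega> u) - Y \<omega> * H (\<omega> \<tau>)) \<partial>P z) = 0"
      using harmonic_martingale[OF H _ _ Y_filt Y_bound, of u z] m\<tau> m YH by simp
    have ind: "integrable (P z) (\<lambda>\<omega>. \<epsilon>\<^sup>2 * indicator (A \<tau>) \<omega>)"
    proof (rule integrable_bounded[where C="\<epsilon>\<^sup>2"])
      show "(\<lambda>\<omega>. \<epsilon>\<^sup>2 * indicator (A \<tau>) \<omega>) \<in> borel_measurable path_space"
        using A_meas[OF \<tau>] by (intro borel_measurable_times borel_measurable_indicator) auto
      show "\<bar>\<epsilon>\<^sup>2 * indicator (A \<tau>) \<omega>\<bar> \<le> \<epsilon>\<^sup>2" for \<omega> by (simp add: indicator_def)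
    qed
    have "\<epsilon>\<^sup>2 * measure (P z) (A \<tau>)
        = (\<integral>\<omega>. \<epsilon>\<^sup>2 * indicator (A \<tau>) \<omega> + 2 * (Y \<omega> * H (\<omega> u) - Y \<omega> * H (\<omega> \<tau>)) \<partial>P z)"
      using ind YH m\<tau> m ortho A_meas[OF \<tau>] sets.sets_into_space[OF A_meas[OF \<tau>]]
      by (subst Bochner_Integration.integral_add) (auto simp: Int_absorb2)
    also have "\<dots> \<le> (\<integral>\<omega>. indicator (A \<tau>) \<omega> * (D u \<omega>)\<^sup>2 \<partial>P z)"
    proof (rule integral_mono)
      show "integrable (P z) (\<lambda>\<omega>. \<epsilon>\<^sup>2 * indicator (A \<tau>) \<omega> + 2 * (Y \<omega> * H (\<omega> u) - Y \<omega> * H (\<omega> \<tau>)))"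
        using ind YH m\<tau> m by (intro Bochner_Integration.integrable_add) auto
      show "integrable (P z) (\<lambda>\<omega>. indicator (A \<tau>) \<omega> * (D u \<omega>)\<^sup>2)" by (rule sq_int[OF \<tau>])
      fix \<omega>
      show "\<epsilon>\<^sup>2 * indicator (A \<tau>) \<omega> + 2 * (Y \<omega> * H (\<omega> u) - Y \<omega> * H (\<omega> \<tau>))
          \<le> indicator (A \<tau>) \<omega> * (D u \<omega>)\<^sup>2"
      proof (cases "\<omega> \<in> A \<tau>")
        case True
        then have "\<epsilon>\<^sup>2 \<le> (D \<tau> \<omega>)\<^sup>2"
          using \<epsilon> by (auto simp: A_def abs_le_square_iff[symmetric])
        moreover have "(D u \<omega>)\<^sup>2 = (D \<tau> \<omega>)\<^sup>2 + 2 * (D \<tau> \<omega> * H (\<omega> u) - D \<tau> \<omega> * H (\<omega> \<tau>))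
            + (H (\<omega> u) - H (\<omega> \<tau>))\<^sup>2"
          unfolding D_def by (simp add: power2_eq_square algebra_simps)
        ultimately have "\<epsilon>\<^sup>2 + 2 * (D \<tau> \<omega> * H (\<omega> u) - D \<tau> \<omega> * H (\<omega> \<tau>)) \<le> (D u \<omega>)\<^sup>2"
          using zero_le_power2[of "H (\<omega> u) - H (\<omega> \<tau>)"] by linarith
        then show ?thesis using True by (simp add: Y_def)
      qed (simp add: Y_def)
    qed
    finally show ?thesis .
  qed
  have disj: "disjoint_family_on A T"
    unfolding disjoint_family_on_def
  proof clarify
    fix \<sigma> \<tau> assume "\<sigma> \<in> T" "\<tau> \<in> T" "\<sigma> \<noteq> \<tau>"
    then show "A \<sigma> \<inter> A \<tau> = {}"
      by (cases "\<sigma> < \<tau>") (force simp: A_def)+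
  qed
  have "{\<omega> \<in> paths. \<exists>t\<in>T. \<epsilon> \<le> \<bar>H (\<omega> t) - H (\<omega> m)\<bar>} \<subseteq> (\<Union>\<tau>\<in>T. A \<tau>)"
  proof clarify
    fix \<omega> t assume \<omega>: "\<omega> \<in> paths" "t \<in> T" "\<epsilon> \<le> \<bar>H (\<omega> t) - H (\<omega> m)\<bar>"
    let ?B = "{t \<in> T. \<epsilon> \<le> \<bar>D t \<omega>\<bar>}"
    have B: "finite ?B" "?B \<noteq> {}" using T(1) \<omega> by (auto simp: D_def)
    have "\<bar>D s \<omega>\<bar> < \<epsilon>" if "s \<in> T" "s < Min ?B" for s
    proof (rule ccontr)
      assume "\<not> \<bar>D s \<omega>\<bar> < \<epsilon>"
      then have "Min ?B \<le> s" using that(1) B(1) by (intro Min_le) auto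
      with that(2) show False by simp
    qed
    with Min_in[OF B] \<omega>(1) have "\<omega> \<in> A (Min ?B)" by (auto simp: A_def)
    with Min_in[OF B] show "\<omega> \<in> (\<Union>\<tau>\<in>T. A \<tau>)" by blast
  qed
  then have "measure (P z) {\<omega> \<in> paths. \<exists>t\<in>T. \<epsilon> \<le> \<bar>H (\<omega> t) - H (\<omega> m)\<bar>} \<le> measure (P z) (\<Union>\<tau>\<in>T. A \<tau>)"
    using A_meas T(1) by (intro prob.finite_measure_mono) auto
  also have "\<dots> \<le> (\<Sum>\<tau>\<in>T. measure (P z) (A \<tau>))"
    using A_meas T(1) by (intro prob.finite_measure_subadditive_finite) auto
  finally have "\<epsilon>\<^sup>2 * measure (P z) {\<omega> \<in> paths. \<exists>t\<in>T. \<epsilon> \<le> \<bar>H (\<omega> t) - H (\<omega> m)\<bar>}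
      \<le> (\<Sum>\<tau>\<in>T. \<epsilon>\<^sup>2 * measure (P z) (A \<tau>))"
    by (simp add: sum_distrib_left[symmetric] mult_left_mono)
  also have "\<dots> \<le> (\<Sum>\<tau>\<in>T. (\<integral>\<omega>. indicator (A \<tau>) \<omega> * (D u \<omega>)\<^sup>2 \<partial>P z))"
    by (rule sum_mono[OF piece])
  also have "\<dots> = (\<integral>\<omega>. (\<Sum>\<tau>\<in>T. indicator (A \<tau>) \<omega> * (D u \<omega>)\<^sup>2) \<partial>P z)"
    by (rule Bochner_Integration.integral_sum[symmetric]) (rule sq_int)
  also have "\<dots> \<le> (\<integral>\<omega>. (D u \<omega>)\<^sup>2 \<partial>P z)"
  proof (rule integral_mono)
    show "integrable (P z) (\<lambda>\<omega>. \<Sum>\<tau>\<in>T. indicator (A \<tau>) \<omega> * (D u \<omega>)\<^sup>2)"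
      by (rule Bochner_Integration.integrable_sum) (rule sq_int)
    show "integrable (P z) (\<lambda>\<omega>. (D u \<omega>)\<^sup>2)"
    proof (rule integrable_bounded[where C="(2 * C)\<^sup>2"])
      show "\<bar>(D u \<omega>)\<^sup>2\<bar> \<le> (2 * C)\<^sup>2" for \<omega> using power_mono[OF D_bound[of u \<omega>], of 2] by simp
    qed (intro borel_measurable_power D_meas m)
    fix \<omega>
    have "(\<Sum>\<tau>\<in>T. indicator (A \<tau>) \<omega> * (D u \<omega>)\<^sup>2) = indicator (\<Union>\<tau>\<in>T. A \<tau>) \<omega> * (D u \<omega>)\<^sup>2"
      by (simp add: indicator_UN_disjoint[OF T(1) disj] sum_distrib_right)
    also have "\<dots> \<le> (D u \<omega>)\<^sup>2" by (simp add: indicator_def)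
    finally show "(\<Sum>\<tau>\<in>T. indicator (A \<tau>) \<omega> * (D u \<omega>)\<^sup>2) \<le> (D u \<omega>)\<^sup>2" .
  qed
  also have "\<dots> = (\<integral>\<omega>. (H (\<omega> u))\<^sup>2 \<partial>P z) - (\<integral>\<omega>. (H (\<omega> m))\<^sup>2 \<partial>P z)"
    unfolding D_def by (rule harmonic_second_moment[OF H m])
  finally show ?thesis .
qed

text \<open>
  Second moments along integer times increase to a finite limit, so the maximal inequality bounds
  the probability of an \<open>\<epsilon>\<close>-oscillation after time \<open>m\<close> by a quantity that vanishes as \<open>m\<close>
  grows. Rational times suffice, by continuity of the path and of \<open>H\<close>.
\<close>

theorem harmonic_converges:
  assumes H: "harmonic P H" and cont: "continuous_on UNIV H"
  shows "AE \<omega> in P z. \<exists>l. ((\<lambda>t. H (\<omega> t)) \<longlongrightarrow> l) at_top"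
proof -
  obtain C where C: "\<And>z. \<bar>H z\<bar> \<le> C" using harmonicD(3)[OF H] by auto
  define v where "v n = (\<integral>\<omega>. (H (\<omega> (real n)))\<^sup>2 \<partial>P z)" for n
  have meas: "(\<lambda>\<omega>. H (\<omega> t)) \<in> borel_measurable path_space" if "0 \<le> t" for t
    by (rule measurable_along_path[OF harmonicD(1)[OF H] that])
  have "incseq v"
  proof (rule monoI)
    fix m n :: nat assume "m \<le> n"
    then have "(\<integral>\<omega>. (H (\<omega> n) - H (\<omega> m))\<^sup>2 \<partial>P z) = v n - v m"
      unfolding v_def by (intro harmonic_second_moment[OF H]) auto
    moreover have "0 \<le> (\<integral>\<omega>. (H (\<omega> n) - H (\<omega> m))\<^sup>2 \<partial>P z)" by simp
    ultimately show "v m \<le> v n" by linarith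
  qed
  moreover have "v n \<le> C\<^sup>2" for n
  proof -
    have "\<bar>v n\<bar> \<le> C\<^sup>2" unfolding v_def
    proof (rule expectation_bounded)
      show "\<bar>(H (\<omega> (real n)))\<^sup>2\<bar> \<le> C\<^sup>2" for \<omega> using power_mono[OF C[of "\<omega> (real n)"], of 2] by simp
    qed (intro borel_measurable_power meas, simp)
    then show ?thesis by simp
  qed
  ultimately obtain L where L: "v \<longlonglongrightarrow> L" "\<And>n. v n \<le> L"
    by (metis incseq_convergent)
  define bad where "bad k m = {\<omega> \<in> paths. \<exists>q\<in>\<rat> \<inter> {real m..}.
      inverse (real (Suc k)) \<le> \<bar>H (\<omega> q) - H (\<omega> (real m))\<bar>}" for k m
  have bad: "bad k m \<in> sets path_space \<and>
      (inverse (real (Suc k)))\<^sup>2 * measure (P z) (bad k m) \<le> L - v m" for k m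
  proof -
    let ?\<epsilon> = "inverse (real (Suc k))"
    let ?Q = "\<rat> \<inter> {real m..}"
    let ?e = "from_nat_into ?Q"
    have Q: "countable ?Q" by (intro countable_Int1 countable_rat)
    have "real m \<in> ?Q" by simp
    then have e: "range ?e = ?Q" by (intro range_from_nat_into Q) blast
    define B where "B N = {\<omega> \<in> paths. \<exists>t\<in>?e ` {..N}. ?\<epsilon> \<le> \<bar>H (\<omega> t) - H (\<omega> (real m))\<bar>}" for N
    have B_sets: "B N \<in> sets path_space" for N
    proof -
      have "{\<omega> \<in> space path_space. ?\<epsilon> \<le> \<bar>H (\<omega> t) - H (\<omega> (real m))\<bar>} \<in> sets path_space"
        if "t \<in> ?e ` {..N}" for t
      proof -
        have "t \<in> ?Q" using e that by blast
        then have "0 \<le> t" by (auto intro: order_trans[OF of_nat_0_le_iff])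
        note [measurable] = meas[OF this] meas[of "real m", simplified]
        show ?thesis by measurable
      qed
      then have "(\<Union>t\<in>?e ` {..N}. {\<omega> \<in> space path_space. ?\<epsilon> \<le> \<bar>H (\<omega> t) - H (\<omega> (real m))\<bar>})
          \<in> sets path_space" by (intro sets.finite_UN) auto
      moreover have "(\<Union>t\<in>?e ` {..N}. {\<omega> \<in> space path_space. ?\<epsilon> \<le> \<bar>H (\<omega> t) - H (\<omega> (real m))\<bar>}) = B N"
        by (auto simp: B_def)
      ultimately show ?thesis by simp
    qed
    have bad_eq: "bad k m = (\<Union>N. B N)"
    proof -
      have "bad k m = {\<omega> \<in> paths. \<exists>t\<in>range ?e. ?\<epsilon> \<le> \<bar>H (\<omega> t) - H (\<omega> (real m))\<bar>}"
        unfolding e bad_def ..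
      also have "\<dots> = (\<Union>N. B N)" unfolding B_def by auto
      finally show ?thesis .
    qed
    have B_le: "?\<epsilon>\<^sup>2 * measure (P z) (B N) \<le> L - v m" for N
    proof -
      have ge: "real m \<le> t" if "t \<in> ?e ` {..N}" for t using e that by blast
      obtain n where n: "Max (?e ` {..N}) \<le> real n" using real_arch_simple by blast
      then have le: "t \<le> real n" if "t \<in> ?e ` {..N}" for t
        using that by (meson Max_ge finite_atMost finite_imageI order_trans)
      have "?e 0 \<in> ?e ` {..N}" by simp
      then have "real m \<le> real n" using ge le by (meson order_trans)
      then have "?\<epsilon>\<^sup>2 * measure (P z) (B N) \<le> v n - v m"
        unfolding B_def v_def using ge le
        by (intro harmonic_maximal_inequality[OF H]) auto
      with L(2)[of n] show ?thesis by linarith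
    qed
    have "incseq B" by (auto simp: incseq_def B_def)
    then have "(\<lambda>N. measure (P z) (B N)) \<longlonglongrightarrow> measure (P z) (bad k m)"
      unfolding bad_eq using B_sets by (intro prob.finite_Lim_measure_incseq) auto
    then have "(\<lambda>N. ?\<epsilon>\<^sup>2 * measure (P z) (B N)) \<longlonglongrightarrow> ?\<epsilon>\<^sup>2 * measure (P z) (bad k m)"
      by (rule tendsto_mult_left)
    then have "?\<epsilon>\<^sup>2 * measure (P z) (bad k m) \<le> L - v m"
      by (rule LIMSEQ_le_const2) (use B_le in blast)
    moreover have "bad k m \<in> sets path_space" unfolding bad_eq using B_sets by auto
    ultimately show ?thesis by blast
  qed
  have "AE \<omega> in P z. \<omega> \<notin> (\<Inter>m. bad k m)" for k
  proof -
    let ?\<epsilon> = "inverse (real (Suc k))" and ?N = "\<Inter>m. bad k m"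
    have N: "?N \<in> sets (P z)" using bad by auto
    have "?\<epsilon>\<^sup>2 * measure (P z) ?N \<le> L - v m" for m
    proof -
      have "measure (P z) ?N \<le> measure (P z) (bad k m)"
        using bad by (intro prob.finite_measure_mono) auto
      then have "?\<epsilon>\<^sup>2 * measure (P z) ?N \<le> ?\<epsilon>\<^sup>2 * measure (P z) (bad k m)" by (rule mult_left_mono) simp
      with bad[of k m] show ?thesis by linarith
    qed
    moreover have "(\<lambda>m. L - v m) \<longlonglongrightarrow> L - L" by (intro tendsto_intros L)
    ultimately have "?\<epsilon>\<^sup>2 * measure (P z) ?N \<le> L - L"
      by (intro LIMSEQ_le_const) auto
    then have "measure (P z) ?N \<le> 0" by (simp add: mult_le_0_iff)
    then have "measure (P z) ?N = 0" using measure_nonneg[of "P z" ?N] by linarith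
    then have "?N \<in> null_sets (P z)" using N by (simp add: null_sets_def prob.emeasure_eq_measure)
    then show ?thesis by (rule AE_not_in)
  qed
  then have "AE \<omega> in P z. \<forall>k. \<omega> \<notin> (\<Inter>m. bad k m)" by (simp add: AE_all_countable)
  with AE_space show ?thesis
  proof eventually_elim
    case (elim \<omega>)
    then have \<omega>: "\<omega> \<in> paths" by simp
    have cont\<omega>: "continuous_on {0..} (\<lambda>t. H (\<omega> t))"
      using continuous_on_compose2[OF cont pathsD[OF \<omega>]] by simp
    have osc: "\<exists>m. \<forall>t\<ge>real m. \<bar>H (\<omega> t) - H (\<omega> (real m))\<bar> \<le> inverse (real (Suc k))" for k
    proof -
      obtain m where "\<omega> \<notin> bad k m" using elim(2) by blast
      then have q: "H (\<omega> q) - H (\<omega> (real m)) \<in> {- inverse (real (Suc k))..inverse (real (Suc k))}"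
        if "q \<in> \<rat>" "real m \<le> q" for q
      proof -
        have "\<not> inverse (real (Suc k)) \<le> \<bar>H (\<omega> q) - H (\<omega> (real m))\<bar>"
          using \<open>\<omega> \<notin> bad k m\<close> \<omega> that unfolding bad_def by blast
        then show ?thesis unfolding atLeastAtMost_iff by linarith
      qed
      have c: "continuous_on {real m..} (\<lambda>t. H (\<omega> t) - H (\<omega> (real m)))"
        by (intro continuous_intros continuous_on_subset[OF cont\<omega>]) auto
      have "\<bar>H (\<omega> t) - H (\<omega> (real m))\<bar> \<le> inverse (real (Suc k))" if "real m \<le> t" for t
      proof -
        have "H (\<omega> t) - H (\<omega> (real m)) \<in> {- inverse (real (Suc k))..inverse (real (Suc k))}"
          by (rule closed_extend_from_rationals[OF c _ q that]) auto
        then show ?thesis unfolding atLeastAtMost_iff by linarith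
      qed
      then show ?thesis by blast
    qed
    have "Cauchy (\<lambda>n. H (\<omega> (real n)))"
    proof (rule CauchyI)
      fix e :: real assume "0 < e"
      then obtain k where k: "inverse (real (Suc k)) < e / 2" using reals_Archimedean[of "e / 2"] by auto
      from osc[of k] obtain m where
        m: "\<And>t. real m \<le> t \<Longrightarrow> \<bar>H (\<omega> t) - H (\<omega> (real m))\<bar> \<le> inverse (real (Suc k))" by blast
      have "norm (H (\<omega> (real n)) - H (\<omega> (real n'))) < e" if "m \<le> n" "m \<le> n'" for n n'
        using m[of n] m[of n'] that k by auto
      then show "\<exists>M. \<forall>m\<ge>M. \<forall>n\<ge>M. norm (H (\<omega> (real m)) - H (\<omega> (real n))) < e" by blast
    qed
    then obtain l where l: "(\<lambda>n. H (\<omega> (real n))) \<longlonglongrightarrow> l"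
      by (auto simp: Cauchy_convergent_iff convergent_def)
    have "((\<lambda>t. H (\<omega> t)) \<longlongrightarrow> l) at_top"
    proof (rule tendstoI)
      fix e :: real assume "0 < e"
      then obtain k where k: "inverse (real (Suc k)) < e / 2" using reals_Archimedean[of "e / 2"] by auto
      from osc[of k] obtain m where
        m: "\<And>t. real m \<le> t \<Longrightarrow> \<bar>H (\<omega> t) - H (\<omega> (real m))\<bar> \<le> inverse (real (Suc k))" by blast
      have "(\<lambda>n. \<bar>H (\<omega> (real n)) - H (\<omega> (real m))\<bar>) \<longlonglongrightarrow> \<bar>l - H (\<omega> (real m))\<bar>"
        by (intro tendsto_intros l)
      then have "\<bar>l - H (\<omega> (real m))\<bar> \<le> inverse (real (Suc k))"
        by (rule LIMSEQ_le_const2) (use m in \<open>auto intro!: exI[of _ m]\<close>)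
      then have "dist (H (\<omega> t)) l < e" if "real m \<le> t" for t
        using m[OF that] k by (simp add: dist_real_def)
      then show "\<forall>\<^sub>F t in at_top. dist (H (\<omega> t)) l < e"
        unfolding eventually_at_top_linorder by blast
    qed
    then show ?case by blast
  qed
qed

end

section \<open>Shift-invariant events\<close>

lemma sigma_algebra_inv_sets: "sigma_algebra paths (inv_sets Y)"
proof -
  have tail_eq: "A \<in> tail_sets Y \<longleftrightarrow> (\<forall>t\<ge>0. A \<in> sets (sigma_of {t..} Y))" for A
    by (auto simp: tail_sets_def)
  have tail_paths: "A \<subseteq> paths" if "A \<in> tail_sets Y" for A
    using that sets.sets_into_space[of A "sigma_of {0..} Y"] by (simp add: tail_eq)
  show ?thesis
    unfolding sigma_algebra_iff2
  proof (intro conjI ballI allI impI)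
    show "inv_sets Y \<subseteq> Pow paths" using tail_paths by (auto simp: inv_sets_def)
    show "{} \<in> inv_sets Y" by (auto simp: inv_sets_def tail_eq)
  next
    fix A assume A: "A \<in> inv_sets Y"
    have "paths - A \<in> sets (sigma_of {t..} Y)" if "0 \<le> t" for t
      using A that sets.compl_sets[of A "sigma_of {t..} Y"] by (simp add: inv_sets_def tail_eq)
    moreover have "shift s -` (paths - A) \<inter> paths = paths - A" if "s > 0" for s
    proof -
      have "shift s -` A \<inter> paths = A" using A that by (simp add: inv_sets_def)
      with shift_in_paths[OF less_imp_le[OF that]] show ?thesis by blast
    qed
    ultimately show "paths - A \<in> inv_sets Y" by (simp add: inv_sets_def tail_eq)
  next
    fix A :: "nat \<Rightarrow> (real \<Rightarrow> 'a) set" assume A: "range A \<subseteq> inv_sets Y"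
    then have "(\<Union>i. A i) \<in> sets (sigma_of {t..} Y)" if "0 \<le> t" for t
      using that by (intro sets.countable_UN) (auto simp: inv_sets_def tail_eq)
    moreover have "shift s -` (\<Union>i. A i) \<inter> paths = (\<Union>i. A i)" if "s > 0" for s
    proof -
      have "shift s -` A i \<inter> paths = A i" for i using A that by (auto simp: inv_sets_def)
      then show ?thesis by blast
    qed
    ultimately show "(\<Union>i. A i) \<in> inv_sets Y" by (simp add: inv_sets_def tail_eq)
  qed
qed

definition inv_space ::
  "(real \<Rightarrow> (real \<Rightarrow> 'a::topological_space) \<Rightarrow> 'b::topological_space) \<Rightarrow> (real \<Rightarrow> 'a) measure" where
  "inv_space Y = sigma paths (inv_sets Y)"

lemma space_inv_space [simp]: "space (inv_space Y) = paths"
  by (simp add: inv_space_def space_measure_of_conv)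

lemma sets_inv_space [simp]: "sets (inv_space Y) = inv_sets Y"
  unfolding inv_space_def by (rule sigma_algebra.sets_measure_of_eq[OF sigma_algebra_inv_sets])

lemma inv_sets_subset_sigma_of: "inv_sets Y \<subseteq> sets (sigma_of {0..} Y)"
  unfolding inv_sets_def tail_sets_def by (intro subsetI) (simp add: INT_iff)

lemma inv_sets_coord_subset:
  fixes y :: "'a::topological_space \<Rightarrow> 'b::topological_space"
  assumes "continuous_on UNIV y"
  shows "inv_sets (\<lambda>t \<omega>. y (\<omega> t)) \<subseteq> sets coord_space"
proof -
  have "sets (sigma_of {0..} (\<lambda>t \<omega>. y (\<omega> t))) \<subseteq> sets coord_space"
    by (rule sigma_of_subset)
      (simp_all add: measurable_compose[OF measurable_sigma_of_coord[where Y="\<lambda>t \<omega>. \<omega> t"]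
          borel_measurable_continuous_onI[OF assms]])
  with inv_sets_subset_sigma_of show ?thesis by blast
qed

lemma inv_sets_path_space_subset:
  "continuous_on UNIV y \<Longrightarrow> inv_sets (\<lambda>t \<omega>. y (\<omega> t)) \<subseteq> sets path_space"
  using inv_sets_coord_subset coord_space_subset by blast

lemma inv_sets_continuous_mono:
  fixes y :: "'a::topological_space \<Rightarrow> 'b::topological_space"
  assumes "continuous_on UNIV y"
  shows "inv_sets (\<lambda>t \<omega>. y (\<omega> t)) \<subseteq> inv_sets (\<lambda>t \<omega>. \<omega> t)"
proof -
  have "sets (sigma_of {t..} (\<lambda>t \<omega>. y (\<omega> t))) \<subseteq> sets (sigma_of {t..} (\<lambda>t \<omega>. \<omega> t))" for t
    by (rule sigma_of_subset)
      (simp_all add: measurable_compose[OF measurable_sigma_of_coord[where Y="\<lambda>t \<omega>. \<omega> t"]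
          borel_measurable_continuous_onI[OF assms]])
  then have "tail_sets (\<lambda>t \<omega>. y (\<omega> t)) \<subseteq> tail_sets (\<lambda>t \<omega>. \<omega> t)"
    unfolding tail_sets_def by (intro INF_mono) blast
  then show ?thesis unfolding inv_sets_def by blast
qed

lemma inv_sets_shift:
  assumes "A \<in> inv_sets Y" "0 \<le> s" "\<omega> \<in> paths"
  shows "shift s \<omega> \<in> A \<longleftrightarrow> \<omega> \<in> A"
proof (cases "s = 0")
  case False
  then have "shift s -` A \<inter> paths = A" using assms by (simp add: inv_sets_def)
  with assms(3) show ?thesis by blast
qed (simp add: shift_0 assms)

text \<open>
  For a closed set, staying there from some time on can be tested at rational times, which makes it
  a tail event; being insensitive to any finite shift of time, it is invariant.
\<close>

lemma eventually_closed_in_inv_sets: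
  fixes y :: "'a::topological_space \<Rightarrow> 'b::topological_space"
  assumes y: "continuous_on UNIV y" and C: "closed C"
  shows "{\<omega> \<in> paths. \<forall>\<^sub>F t in at_top. y (\<omega> t) \<in> C} \<in> inv_sets (\<lambda>t \<omega>. y (\<omega> t))"
    (is "?A \<in> _")
proof -
  have "?A \<in> sets (sigma_of {t..} (\<lambda>t \<omega>. y (\<omega> t)))" if t: "0 \<le> t" for t
  proof -
    let ?M = "sigma_of {t..} (\<lambda>t \<omega>. y (\<omega> t)) :: (real \<Rightarrow> 'a) measure"
    have coord: "{\<omega> \<in> space ?M. y (\<omega> q) \<in> C} \<in> sets ?M" if "t \<le> q" for q
    proof -
      have "(\<lambda>\<omega>. y (\<omega> q)) \<in> ?M \<rightarrow>\<^sub>M borel"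
        by (rule measurable_sigma_of_coord[where Y="\<lambda>t \<omega>. y (\<omega> t)"]) (use that in simp)
      from measurable_sets[OF this, of C] C
      have "(\<lambda>\<omega>. y (\<omega> q)) -` C \<inter> space ?M \<in> sets ?M" by auto
      moreover have "(\<lambda>\<omega>. y (\<omega> q)) -` C \<inter> space ?M = {\<omega> \<in> space ?M. y (\<omega> q) \<in> C}" by auto
      ultimately show ?thesis by simp
    qed
    have meas: "{\<omega> \<in> space ?M. \<exists>n\<in>{n. t \<le> real n}. \<forall>q\<in>\<rat> \<inter> {real n..}. y (\<omega> q) \<in> C} \<in> sets ?M"
    proof (rule sets.sets_Collect_countable_Ex')
      fix n assume n: "n \<in> {n. t \<le> real n}"
      show "{\<omega> \<in> space ?M. \<forall>q\<in>\<rat> \<inter> {real n..}. y (\<omega> q) \<in> C} \<in> sets ?M"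
      proof (rule sets.sets_Collect_countable_All')
        show "{\<omega> \<in> space ?M. y (\<omega> q) \<in> C} \<in> sets ?M" if "q \<in> \<rat> \<inter> {real n..}" for q
          using that n by (intro coord) simp
      qed (rule countable_Int1[OF countable_rat])
    qed simp
    have iff: "(\<exists>n\<in>{n. t \<le> real n}. \<forall>q\<in>\<rat> \<inter> {real n..}. y (\<omega> q) \<in> C)
        \<longleftrightarrow> (\<forall>\<^sub>F t in at_top. y (\<omega> t) \<in> C)" if \<omega>: "\<omega> \<in> paths" for \<omega> :: "real \<Rightarrow> 'a"
    proof
      assume "\<exists>n\<in>{n. t \<le> real n}. \<forall>q\<in>\<rat> \<inter> {real n..}. y (\<omega> q) \<in> C"
      then obtain n where n: "t \<le> real n" and q: "\<And>q. q \<in> \<rat> \<Longrightarrow> real n \<le> q \<Longrightarrow> y (\<omega> q) \<in> C"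
        by auto
      have "continuous_on {real n..} (\<lambda>t. y (\<omega> t))"
        using n t by (intro continuous_on_compose2[OF y] continuous_on_subset[OF pathsD[OF \<omega>]]) auto
      then have "y (\<omega> s) \<in> C" if "real n \<le> s" for s
        by (rule closed_extend_from_rationals[OF _ C q that])
      then show "\<forall>\<^sub>F t in at_top. y (\<omega> t) \<in> C" unfolding eventually_at_top_linorder by blast
    next
      assume "\<forall>\<^sub>F t in at_top. y (\<omega> t) \<in> C"
      then obtain T where T: "\<And>s. T \<le> s \<Longrightarrow> y (\<omega> s) \<in> C" unfolding eventually_at_top_linorder by blast
      obtain n where n: "max t T \<le> real n" using real_arch_simple by blast
      have "\<forall>q\<in>\<rat> \<inter> {real n..}. y (\<omega> q) \<in> C"
      proof
        fix q assume "q \<in> \<rat> \<inter> {real n..}"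
        with n have "T \<le> q" by simp
        then show "y (\<omega> q) \<in> C" by (rule T)
      qed
      moreover have "n \<in> {n. t \<le> real n}" using n by simp
      ultimately show "\<exists>n\<in>{n. t \<le> real n}. \<forall>q\<in>\<rat> \<inter> {real n..}. y (\<omega> q) \<in> C" by (rule bexI)
    qed
    have "{\<omega> \<in> space ?M. \<exists>n\<in>{n. t \<le> real n}. \<forall>q\<in>\<rat> \<inter> {real n..}. y (\<omega> q) \<in> C} = ?A"
    proof (rule Set.set_eqI)
      fix \<omega> :: "real \<Rightarrow> 'a"
      show "\<omega> \<in> {\<omega> \<in> space ?M. \<exists>n\<in>{n. t \<le> real n}. \<forall>q\<in>\<rat> \<inter> {real n..}. y (\<omega> q) \<in> C}
          \<longleftrightarrow> \<omega> \<in> ?A"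
        by (cases "\<omega> \<in> paths") (simp_all only: mem_Collect_eq space_sigma_of iff simp_thms)
    qed
    then show ?thesis using meas by (rule subst)
  qed
  moreover have "shift s -` ?A \<inter> paths = ?A" if s: "s > 0" for s
  proof -
    have "(\<forall>\<^sub>F t in at_top. y (shift s \<omega> t) \<in> C) \<longleftrightarrow> (\<forall>\<^sub>F t in at_top. y (\<omega> t) \<in> C)"
      for \<omega> :: "real \<Rightarrow> 'a"
    proof -
      have "(\<forall>\<^sub>F t in at_top. y (shift s \<omega> t) \<in> C) \<longleftrightarrow> (\<forall>\<^sub>F t in at_top. y (\<omega> (t + s)) \<in> C)"
        by (rule eventually_cong[OF eventually_ge_at_top[of 0]]) simp
      also have "\<dots> \<longleftrightarrow> (\<forall>\<^sub>F t in at_top. y (\<omega> t) \<in> C)"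
      proof
        assume "\<forall>\<^sub>F t in at_top. y (\<omega> (t + s)) \<in> C"
        then obtain T where "\<And>t. T \<le> t \<Longrightarrow> y (\<omega> (t + s)) \<in> C" unfolding eventually_at_top_linorder by blast
        then have "y (\<omega> t) \<in> C" if "T + s \<le> t" for t using that by (metis (no_types) diff_add_cancel le_diff_eq)
        then show "\<forall>\<^sub>F t in at_top. y (\<omega> t) \<in> C" unfolding eventually_at_top_linorder by blast
      next
        assume "\<forall>\<^sub>F t in at_top. y (\<omega> t) \<in> C"
        then obtain T where "\<And>t. T \<le> t \<Longrightarrow> y (\<omega> t) \<in> C" unfolding eventually_at_top_linorder by blast
        then have "y (\<omega> (t + s)) \<in> C" if "T \<le> t" for t using that s by simp
        then show "\<forall>\<^sub>F t in at_top. y (\<omega> (t + s)) \<in> C" unfolding eventually_at_top_linorder by blast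
      qed
      finally show ?thesis .
    qed
    then have "shift s \<omega> \<in> ?A \<longleftrightarrow> \<omega> \<in> ?A" if "\<omega> \<in> paths" for \<omega>
      using shift_in_paths[of s \<omega>] s that by simp
    then show ?thesis by blast
  qed
  ultimately show ?thesis by (simp add: inv_sets_def tail_sets_def)
qed

text \<open>
  The limit superior, unlike the limit, is defined on every path and hence exactly shift-invariant.
\<close>

definition limsup_at_top :: "(real \<Rightarrow> real) \<Rightarrow> real" where
  "limsup_at_top f = real_of_ereal (Limsup at_top (\<lambda>t. ereal (f t)))"

lemma limsup_at_top_eq: "(f \<longlongrightarrow> l) at_top \<Longrightarrow> limsup_at_top f = l"
  unfolding limsup_at_top_def
  by (subst lim_imp_Limsup[of at_top _ "ereal l"]) auto

lemma measurable_limsup_at_top: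
  fixes y :: "'a::topological_space \<Rightarrow> 'b::topological_space" and \<phi> :: "'b \<Rightarrow> real"
  assumes y: "continuous_on UNIV y" and \<phi>: "continuous_on UNIV \<phi>"
  shows "(\<lambda>\<omega>. limsup_at_top (\<lambda>t. \<phi> (y (\<omega> t)))) \<in> borel_measurable (inv_space (\<lambda>t \<omega>. y (\<omega> t)))"
    (is "_ \<in> borel_measurable ?M")
proof -
  let ?L = "\<lambda>\<omega>. Limsup at_top (\<lambda>t. ereal (\<phi> (y (\<omega> t))))"
  have "?L \<in> borel_measurable ?M"
  proof (rule borel_measurableI_le)
    fix a :: ereal
    have ev: "{\<omega> \<in> space ?M. \<forall>\<^sub>F t in at_top. \<phi> (y (\<omega> t)) \<le> r} \<in> sets ?M" for r
    proof -
      have "closed {b. \<phi> b \<le> r}" using \<phi> by (intro closed_Collect_le) auto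
      from eventually_closed_in_inv_sets[OF y this] show ?thesis by simp
    qed
    have "{\<omega> \<in> space ?M. \<forall>r::rat. a < ereal (of_rat r) \<longrightarrow> (\<forall>\<^sub>F t in at_top. \<phi> (y (\<omega> t)) \<le> of_rat r)}
        \<in> sets ?M"
    proof (rule sets.sets_Collect_countable_All)
      fix r :: rat
      show "{\<omega> \<in> space ?M. a < ereal (of_rat r) \<longrightarrow> (\<forall>\<^sub>F t in at_top. \<phi> (y (\<omega> t)) \<le> of_rat r)} \<in> sets ?M"
        using ev[of "of_rat r"] sets.top[of ?M] by (cases "a < ereal (of_rat r)") simp_all
    qed
    moreover have "?L \<omega> \<le> a \<longleftrightarrow>
        (\<forall>r::rat. a < ereal (of_rat r) \<longrightarrow> (\<forall>\<^sub>F t in at_top. \<phi> (y (\<omega> t)) \<le> of_rat r))" for \<omega> :: "real \<Rightarrow> 'a"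
    proof
      assume L: "?L \<omega> \<le> a"
      show "\<forall>r::rat. a < ereal (of_rat r) \<longrightarrow> (\<forall>\<^sub>F t in at_top. \<phi> (y (\<omega> t)) \<le> of_rat r)"
      proof (intro allI impI)
        fix r :: rat assume "a < ereal (of_rat r)"
        with L have "\<forall>\<^sub>F t in at_top. ereal (\<phi> (y (\<omega> t))) < ereal (of_rat r)"
          unfolding Limsup_le_iff by blast
        then show "\<forall>\<^sub>F t in at_top. \<phi> (y (\<omega> t)) \<le> of_rat r" by eventually_elim simp
      qed
    next
      assume r: "\<forall>r::rat. a < ereal (of_rat r) \<longrightarrow> (\<forall>\<^sub>F t in at_top. \<phi> (y (\<omega> t)) \<le> of_rat r)"
      show "?L \<omega> \<le> a"
        unfolding Limsup_le_iff
      proof (intro allI impI)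
        fix b assume "a < b"
        then obtain q where q: "a < ereal (of_rat q)" "ereal (of_rat q) < b"
          using ereal_dense3 by blast
        from r q(1) have "\<forall>\<^sub>F t in at_top. \<phi> (y (\<omega> t)) \<le> of_rat q" by blast
        then show "\<forall>\<^sub>F t in at_top. ereal (\<phi> (y (\<omega> t))) < b"
        proof eventually_elim
          case (elim t)
          then have "ereal (\<phi> (y (\<omega> t))) \<le> ereal (of_rat q)" by simp
          with q(2) show ?case by (rule le_less_trans[rotated])
        qed
      qed
    qed
    ultimately show "{\<omega> \<in> space ?M. ?L \<omega> \<le> a} \<in> sets ?M" by simp
  qed
  then show ?thesis unfolding limsup_at_top_def by measurable
qed

section \<open>Levy's zero-one law for invariant functions\<close>

lemma coord_space_generated:
  "sets (coord_space :: (real \<Rightarrow> 'a::topological_space) measure)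
    \<subseteq> sigma_sets paths (\<Union>n::nat. sets (canonical_filtration (ennreal n)))"
  unfolding sets_sigma_of
proof (rule sigma_sets_mono, rule subsetI)
  fix A :: "(real \<Rightarrow> 'a) set" assume "A \<in> {(\<lambda>\<omega>. \<omega> t) -` B \<inter> paths |t B. t \<in> {0..} \<and> B \<in> sets borel}"
  then obtain t :: real and B :: "'a set" where A: "A = (\<lambda>\<omega>. \<omega> t) -` B \<inter> paths"
    and t: "0 \<le> t" and B: "B \<in> sets borel" by auto
  obtain n :: nat where "t \<le> n" using real_arch_simple by blast
  then have "(\<lambda>\<omega>. \<omega> t) -` B \<inter> space (canonical_filtration (ennreal n)) \<in> sets (canonical_filtration (ennreal n))"
    using t B by (intro measurable_sets[OF measurable_canonical_filtration_coord]) auto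
  then show "A \<in> sigma_sets paths (\<Union>n::nat. sets (canonical_filtration (ennreal n)))"
    unfolding A by (intro sigma_sets.Basic) auto
qed

lemma Int_stable_canonical_filtrations:
  "Int_stable (\<Union>n::nat. sets (canonical_filtration (ennreal n) :: (real \<Rightarrow> 'a::topological_space) measure))"
proof (rule Int_stableI)
  fix A B :: "(real \<Rightarrow> 'a) set"
  assume "A \<in> (\<Union>n::nat. sets (canonical_filtration (ennreal n)))"
    "B \<in> (\<Union>n::nat. sets (canonical_filtration (ennreal n)))"
  then obtain m n :: nat where A: "A \<in> sets (canonical_filtration (ennreal m))"
    and B: "B \<in> sets (canonical_filtration (ennreal n))" by blast
  have "A \<in> sets (canonical_filtration (ennreal (max m n)))"
    "B \<in> sets (canonical_filtration (ennreal (max m n)))"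
    using A B subsetD[OF filtration.sets_F_mono[OF filtration_canonical, of "ennreal m" "ennreal (max m n)"]]
      subsetD[OF filtration.sets_F_mono[OF filtration_canonical, of "ennreal n" "ennreal (max m n)"]]
    by (auto intro: ennreal_leI)
  then have "A \<inter> B \<in> sets (canonical_filtration (ennreal (max m n)))" by (rule sets.Int)
  then show "A \<inter> B \<in> (\<Union>n::nat. sets (canonical_filtration (ennreal n)))" by blast
qed

abbreviation path_inv_space :: "(real \<Rightarrow> 'a::topological_space) measure" where
  "path_inv_space \<equiv> inv_space (\<lambda>t \<omega>. \<omega> t)"

lemma path_inv_subset_coord: "sets path_inv_space \<subseteq> sets coord_space"
  using inv_sets_coord_subset[OF continuous_on_id] by simp

lemma path_inv_subset_path_space: "sets path_inv_space \<subseteq> sets path_space"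
  using path_inv_subset_coord coord_space_subset by blast

context markov_family
begin

text \<open>
  Events of the completion are invariant only up to null sets. For a function, all rational levels are
  compared at once, so that a single null set suffices.
\<close>

lemma AE_shift_invariant:
  fixes f :: "(real \<Rightarrow> 'z) \<Rightarrow> real"
  assumes f: "f \<in> borel_measurable (universal_completion P path_inv_space)" and t: "0 \<le> t"
  shows "AE \<omega> in P z. f (shift t \<omega>) = f \<omega>"
proof -
  have set_inv: "AE \<omega> in P z. shift t \<omega> \<in> B \<longleftrightarrow> \<omega> \<in> B"
    if B: "B \<in> sets (universal_completion P path_inv_space)" for B
  proof -
    obtain A where A: "A \<in> inv_sets (\<lambda>t \<omega>. \<omega> t)" "B \<in> sets path_space"
      "\<And>z. AE \<omega> in P z. \<omega> \<in> A \<longleftrightarrow> \<omega> \<in> B"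
      using B by (auto simp: sets_universal_completion)
    have "A \<in> sets path_space" using A(1) path_inv_subset_path_space by auto
    then have "Measurable.pred path_space (\<lambda>\<omega>. \<omega> \<in> A \<longleftrightarrow> \<omega> \<in> B)" using A(2) by measurable
    from AE_shift[OF t this A(3)] A(3)[of z] AE_space[of "P z"]
    show ?thesis by eventually_elim (use inv_sets_shift[OF A(1) t] in auto)
  qed
  have "AE \<omega> in P z. \<forall>q::rat. f (shift t \<omega>) < of_rat q \<longleftrightarrow> f \<omega> < of_rat q"
    unfolding AE_all_countable
  proof
    fix q :: rat
    have "{\<omega> \<in> space (universal_completion P path_inv_space). f \<omega> < of_rat q}
        \<in> sets (universal_completion P path_inv_space)"
      using f by measurable
    from set_inv[OF this] AE_space[of "P z"]
    show "AE \<omega> in P z. f (shift t \<omega>) < of_rat q \<longleftrightarrow> f \<omega> < of_rat q"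
      by eventually_elim (use shift_in_paths[OF t] in auto)
  qed
  then show ?thesis
  proof eventually_elim
    case (elim \<omega>)
    show ?case
    proof (rule ccontr)
      assume "f (shift t \<omega>) \<noteq> f \<omega>"
      then consider "f (shift t \<omega>) < f \<omega>" | "f \<omega> < f (shift t \<omega>)" by linarith
      then show False
      proof cases
        case 1
        then obtain q where "f (shift t \<omega>) < of_rat q" "of_rat q < f \<omega>" using of_rat_dense by blast
        with elim show False by (metis less_asym)
      next
        case 2
        then obtain q where "f \<omega> < of_rat q" "of_rat q < f (shift t \<omega>)" using of_rat_dense by blast
        with elim show False by (metis less_asym)
      qed
    qed
  qed
qed

lemma harmonic_expectation:
  fixes V :: "(real \<Rightarrow> 'z) \<Rightarrow> real"
  assumes V: "V \<in> borel_measurable path_space" "\<And>\<omega>. \<omega> \<in> paths \<Longrightarrow> \<bar>V \<omega>\<bar> \<le> C"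
    and inv: "\<And>t z. 0 \<le> t \<Longrightarrow> AE \<omega> in P z. V (shift t \<omega>) = V \<omega>"
  shows "harmonic P (\<lambda>z. \<integral>\<omega>. V \<omega> \<partial>P z)"
  unfolding harmonic_def
proof (intro conjI allI impI)
  show "(\<lambda>z. \<integral>\<omega>. V \<omega> \<partial>P z) \<in> borel_measurable borel" by (rule measurable_expectation[OF V(1)])
  show "bounded (range (\<lambda>z. \<integral>\<omega>. V \<omega> \<partial>P z))"
    using expectation_bounded[OF V] by (auto simp: bounded_iff)
  fix z and t :: real assume t: "0 \<le> t"
  have "(\<integral>\<omega>. V \<omega> \<partial>P z) = (\<integral>\<omega>. V (shift t \<omega>) \<partial>P z)"
  proof (rule integral_cong_AE)
    show "V \<in> borel_measurable (P z)" using V(1) unfolding measurable_P_eq .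
    show "(\<lambda>\<omega>. V (shift t \<omega>)) \<in> borel_measurable (P z)"
      unfolding measurable_P_eq by (rule measurable_compose[OF measurable_shift[OF t] V(1)])
    show "AE \<omega> in P z. V \<omega> = V (shift t \<omega>)" using inv[OF t, of z] by eventually_elim simp
  qed
  also have "\<dots> = (\<integral>\<omega>. (\<integral>\<omega>'. V \<omega>' \<partial>P (\<omega> t)) \<partial>P z)" by (rule markov_expectation[OF t V])
  finally show "(\<integral>\<omega>. V \<omega> \<partial>P z) = (\<integral>\<omega>. (\<integral>\<omega>'. V \<omega>' \<partial>P (\<omega> t)) \<partial>P z)" .
qed

text \<open>
  The events known at some finite time form an intersection-stable generator of the coordinate events,
  so vanishing integrals extend to all of these, and then to the sets where \<open>W\<close> has a given sign.
\<close>

lemma AE_zero_if_integrals_zero: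
  fixes W :: "(real \<Rightarrow> 'z) \<Rightarrow> real"
  assumes W: "W \<in> borel_measurable (universal_completion P coord_space)" and int: "integrable (P z) W"
    and zero: "\<And>n A. A \<in> sets (canonical_filtration (ennreal (real n))) \<Longrightarrow>
      (\<integral>\<omega>\<in>A. W \<omega> \<partial>P z) = 0"
  shows "AE \<omega> in P z. W \<omega> = 0"
proof -
  let ?G = "\<Union>n::nat. sets (canonical_filtration (ennreal n) :: (real \<Rightarrow> 'z) measure)"
  have set_int: "set_integrable (P z) A W" if "A \<in> sets path_space" for A
    unfolding set_integrable_def using that int by (intro integrable_mult_indicator) auto
  have G: "?G \<subseteq> Pow paths"
    using sets.sets_into_space[of _ "canonical_filtration (ennreal n)" for n] by auto
  have G_ps: "sigma_sets paths ?G \<subseteq> sets path_space"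
  proof -
    have "?G \<subseteq> sets path_space"
      using canonical_filtration_subset coord_space_subset by blast
    from sets.sigma_sets_subset[OF this] show ?thesis by simp
  qed
  have coord: "(\<integral>\<omega>\<in>A. W \<omega> \<partial>P z) = 0" if "A \<in> sigma_sets paths ?G" for A
    using Int_stable_canonical_filtrations G that
  proof (induction rule: sigma_sets_induct_disjoint)
    case (basic A)
    then show ?case using zero by blast
  next
    case empty
    then show ?case by (simp add: set_lebesgue_integral_def)
  next
    case (compl A)
    have A: "A \<in> sets path_space" using compl(1) G_ps by blast
    have p: "paths \<in> sets (path_space :: (real \<Rightarrow> 'z) measure)" using sets.top[of path_space] by simp
    have "paths \<in> sets (canonical_filtration (ennreal (real 0)) :: (real \<Rightarrow> 'z) measure)"
      using sets.top[of "canonical_filtration (ennreal (real 0))"] by simp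
    then have "0 = (\<integral>\<omega>\<in>paths. W \<omega> \<partial>P z)" using zero[of paths 0] by simp
    also have "paths = A \<union> (paths - A)" using sets.sets_into_space[OF A] by auto
    also have "(\<integral>\<omega>\<in>A \<union> (paths - A). W \<omega> \<partial>P z) = (\<integral>\<omega>\<in>A. W \<omega> \<partial>P z) + (\<integral>\<omega>\<in>paths - A. W \<omega> \<partial>P z)"
      using A p by (intro set_integral_Un set_int) auto
    finally show ?case using compl(2) by simp
  next
    case (union A)
    have A: "A i \<in> sets path_space" for i using union(2) G_ps by blast
    have "(\<integral>\<omega>\<in>(\<Union>i. A i). W \<omega> \<partial>P z) = (\<Sum>i. (\<integral>\<omega>\<in>A i. W \<omega> \<partial>P z))"
      using union(1) A by (intro lebesgue_integral_countable_add set_int)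
        (auto simp: disjoint_family_on_def)
    then show ?case using union(3) by simp
  qed
  have comp: "(\<integral>\<omega>\<in>B. W \<omega> \<partial>P z) = 0" if B: "B \<in> sets (universal_completion P coord_space)" for B
  proof -
    obtain A where A: "A \<in> sets coord_space" "B \<in> sets path_space" "AE \<omega> in P z. \<omega> \<in> A \<longleftrightarrow> \<omega> \<in> B"
      using B by (auto simp: sets_universal_completion)
    have "A \<in> sets path_space" using A(1) coord_space_subset by blast
    moreover have "W \<in> borel_measurable (P z)" using int by simp
    ultimately have "(\<integral>\<omega>\<in>B. W \<omega> \<partial>P z) = (\<integral>\<omega>\<in>A. W \<omega> \<partial>P z)"
      unfolding set_lebesgue_integral_def using A(2,3)
      by (intro integral_cong_AE) (auto elim!: eventually_mono simp: indicator_def)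
    also have "\<dots> = 0" using A(1) coord_space_generated by (intro coord) blast
    finally show ?thesis .
  qed
  have sign: "AE \<omega> in P z. \<not> (0 < s * W \<omega>)" for s :: real
  proof -
    let ?B = "{\<omega> \<in> space (universal_completion P coord_space). 0 < s * W \<omega>}"
    have B: "?B \<in> sets (universal_completion P coord_space)" using W by measurable
    have B': "?B \<in> sets path_space" using B universal_completion_subset[of coord_space P] by auto
    have "(\<integral>\<omega>. indicator ?B \<omega> * (s * W \<omega>) \<partial>P z) = s * (\<integral>\<omega>\<in>?B. W \<omega> \<partial>P z)"
      unfolding set_lebesgue_integral_def by (simp add: mult.left_commute)
    also have "\<dots> = 0" using comp[OF B] by simp
    finally have "(\<integral>\<omega>. indicator ?B \<omega> * (s * W \<omega>) \<partial>P z) = 0" .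
    moreover have "integrable (P z) (\<lambda>\<omega>. indicator ?B \<omega> * (s * W \<omega>))"
      using integrable_mult_indicator[of ?B "P z" "\<lambda>\<omega>. s * W \<omega>"] B' int by simp
    moreover have "AE \<omega> in P z. 0 \<le> indicator ?B \<omega> * (s * W \<omega>)"
      by (auto simp: indicator_def)
    ultimately have "AE \<omega> in P z. indicator ?B \<omega> * (s * W \<omega>) = 0"
      by (simp add: integral_nonneg_eq_0_iff_AE)
    with AE_space show ?thesis by eventually_elim (auto simp: indicator_def split: if_splits)
  qed
  from sign[of 1] sign[of "-1"] show ?thesis by eventually_elim auto
qed

text \<open>
  Along the path, the conditional expectations of an invariant \<open>V\<close> are the values of the harmonic
  function \<open>z \<mapsto> E\<^sub>z[V]\<close>. Their limit integrates like \<open>V\<close> over every event known at a finite time.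
\<close>

theorem expectation_converges_to_invariant:
  fixes V :: "(real \<Rightarrow> 'z) \<Rightarrow> real"
  assumes V: "V \<in> borel_measurable (universal_completion P coord_space)"
      "\<And>\<omega>. \<omega> \<in> paths \<Longrightarrow> \<bar>V \<omega>\<bar> \<le> C"
    and inv: "\<And>t z. 0 \<le> t \<Longrightarrow> AE \<omega> in P z. V (shift t \<omega>) = V \<omega>"
    and cont: "continuous_on UNIV (\<lambda>z. \<integral>\<omega>. V \<omega> \<partial>P z)"
  shows "AE \<omega> in P z. ((\<lambda>t. \<integral>\<omega>'. V \<omega>' \<partial>P (\<omega> t)) \<longlongrightarrow> V \<omega>) at_top"
proof -
  let ?h = "\<lambda>z. \<integral>\<omega>. V \<omega> \<partial>P z"
  \<comment> \<open>a version of the limit that is defined, and measurable, on all paths\<close>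
  let ?Z = "\<lambda>\<omega>. limsup_at_top (\<lambda>t. ?h (\<omega> t))"
  have Vp: "V \<in> borel_measurable path_space"
    by (rule measurable_universal_completion_path_space[OF V(1)]) simp
  have harm: "harmonic P ?h" by (rule harmonic_expectation[OF Vp V(2) inv])
  have Z: "?Z \<in> borel_measurable (universal_completion P coord_space)"
  proof (rule measurable_universal_completionI[OF _ _ coord_space_subset])
    show "?Z \<in> borel_measurable coord_space"
      by (rule measurable_from_subalg[OF _ measurable_limsup_at_top[OF continuous_on_id cont]])
        (use path_inv_subset_coord in \<open>simp add: subalgebra_def\<close>)
  qed simp
  have Zp: "?Z \<in> borel_measurable path_space"
    by (rule measurable_universal_completion_path_space[OF Z]) simp
  have lim: "AE \<omega> in P z. ((\<lambda>t. ?h (\<omega> t)) \<longlongrightarrow> ?Z \<omega>) at_top"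
    using harmonic_converges[OF harm cont, of z]
    by eventually_elim (use limsup_at_top_eq in blast)
  have limn: "AE \<omega> in P z. (\<lambda>n. ?h (\<omega> (real n))) \<longlonglongrightarrow> ?Z \<omega>"
    using lim by eventually_elim (rule filterlim_compose[OF _ filterlim_real_sequentially])
  have Z_bound: "AE \<omega> in P z. \<bar>?Z \<omega>\<bar> \<le> C"
    using limn
  proof eventually_elim
    case (elim \<omega>)
    then have "(\<lambda>n. \<bar>?h (\<omega> (real n))\<bar>) \<longlonglongrightarrow> \<bar>?Z \<omega>\<bar>" by (intro tendsto_intros)
    then show ?case by (rule LIMSEQ_le_const2) (use expectation_bounded[OF Vp V(2)] in blast)
  qed
  have intV: "integrable (P z) V" by (rule integrable_bounded[OF Vp V(2)])
  have intZ: "integrable (P z) ?Z"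
    by (rule prob.integrable_const_bound[of _ C]) (use Z_bound Zp measurable_P_eq in auto)
  have "AE \<omega> in P z. V \<omega> - ?Z \<omega> = 0"
  proof (rule AE_zero_if_integrals_zero)
    show "(\<lambda>\<omega>. V \<omega> - ?Z \<omega>) \<in> borel_measurable (universal_completion P coord_space)"
      by (intro borel_measurable_diff V Z)
    show "integrable (P z) (\<lambda>\<omega>. V \<omega> - ?Z \<omega>)" by (intro Bochner_Integration.integrable_diff intV intZ)
    fix m :: nat and A :: "(real \<Rightarrow> 'z) set" assume A: "A \<in> sets (canonical_filtration (ennreal (real m)))"
    have Ap: "A \<in> sets path_space" using A canonical_filtration_subset coord_space_subset by blast
    have eq: "(\<integral>\<omega>. indicator A \<omega> * ?h (\<omega> (real n)) \<partial>P z) = (\<integral>\<omega>. indicator A \<omega> * V \<omega> \<partial>P z)"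
      if "m \<le> n" for n
    proof -
      have "A \<in> sets (canonical_filtration (ennreal (real n)))"
        using A filtration.sets_F_mono[OF filtration_canonical, of "ennreal (real m)" "ennreal (real n)"] that
        by (auto intro: ennreal_leI)
      then have "(\<integral>\<omega>. indicator A \<omega> * ?h (\<omega> (real n)) \<partial>P z)
          = (\<integral>\<omega>. indicator A \<omega> * V (shift (real n) \<omega>) \<partial>P z)"
        by (intro markov[symmetric, OF _ Vp V(2), of _ _ 1] borel_measurable_indicator)
          (auto simp: indicator_def)
      also have "\<dots> = (\<integral>\<omega>. indicator A \<omega> * V \<omega> \<partial>P z)"
      proof (rule integral_cong_AE)
        show "(\<lambda>\<omega>. indicator A \<omega> * V (shift (real n) \<omega>)) \<in> borel_measurable (P z)"
          unfolding measurable_P_eq using Ap measurable_compose[OF measurable_shift Vp, of "real n"]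
          by (intro borel_measurable_times borel_measurable_indicator) auto
        show "(\<lambda>\<omega>. indicator A \<omega> * V \<omega>) \<in> borel_measurable (P z)"
          unfolding measurable_P_eq using Ap Vp
          by (intro borel_measurable_times borel_measurable_indicator) auto
        show "AE \<omega> in P z. indicator A \<omega> * V (shift (real n) \<omega>) = indicator A \<omega> * V \<omega>"
          using inv[of "real n" z] by (auto elim: eventually_mono)
      qed
      finally show ?thesis .
    qed
    have "(\<lambda>n. \<integral>\<omega>. indicator A \<omega> * ?h (\<omega> (real n)) \<partial>P z) \<longlonglongrightarrow> (\<integral>\<omega>. indicator A \<omega> * ?Z \<omega> \<partial>P z)"
    proof (rule integral_dominated_convergence[where w="\<lambda>_. C"])
      show "(\<lambda>\<omega>. indicator A \<omega> * ?Z \<omega>) \<in> borel_measurable (P z)"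
        unfolding measurable_P_eq using Ap Zp
        by (intro borel_measurable_times borel_measurable_indicator) auto
      show "(\<lambda>\<omega>. indicator A \<omega> * ?h (\<omega> (real n))) \<in> borel_measurable (P z)" for n
        unfolding measurable_P_eq using Ap measurable_along_path[OF harmonicD(1)[OF harm]]
        by (intro borel_measurable_times borel_measurable_indicator) auto
      show "AE \<omega> in P z. (\<lambda>n. indicator A \<omega> * ?h (\<omega> (real n))) \<longlonglongrightarrow> indicator A \<omega> * ?Z \<omega>"
        using limn by eventually_elim (rule tendsto_mult_left)
      have "\<bar>indicator A \<omega> * ?h (\<omega> (real n))\<bar> \<le> C" for n \<omega>
        using expectation_bounded[OF Vp V(2), of "\<omega> (real n)"] by (auto simp: indicator_def)
      then show "AE \<omega> in P z. norm (indicator A \<omega> * ?h (\<omega> (real n))) \<le> C" for n by simp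
    qed simp
    moreover have "\<forall>\<^sub>F n in sequentially. (\<integral>\<omega>. indicator A \<omega> * ?h (\<omega> (real n)) \<partial>P z)
        = (\<integral>\<omega>. indicator A \<omega> * V \<omega> \<partial>P z)"
      using eventually_ge_at_top[of m] by eventually_elim (rule eq)
    then have "(\<lambda>n. \<integral>\<omega>. indicator A \<omega> * ?h (\<omega> (real n)) \<partial>P z) \<longlonglongrightarrow> (\<integral>\<omega>. indicator A \<omega> * V \<omega> \<partial>P z)"
      by (rule tendsto_eventually)
    ultimately have "(\<integral>\<omega>. indicator A \<omega> * ?Z \<omega> \<partial>P z) = (\<integral>\<omega>. indicator A \<omega> * V \<omega> \<partial>P z)"
      by (rule LIMSEQ_unique)
    moreover have "(\<integral>\<omega>\<in>A. V \<omega> - ?Z \<omega> \<partial>P z) = (\<integral>\<omega>\<in>A. V \<omega> \<partial>P z) - (\<integral>\<omega>\<in>A. ?Z \<omega> \<partial>P z)"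
      unfolding set_lebesgue_integral_def scaleR_diff_right
      using Ap intV intZ by (intro Bochner_Integration.integral_diff integrable_mult_indicator) auto
    ultimately show "(\<integral>\<omega>\<in>A. V \<omega> - ?Z \<omega> \<partial>P z) = 0" by (simp add: set_lebesgue_integral_def)
  qed
  with lim show ?thesis by eventually_elim simp
qed

end

section \<open>Topological groups\<close>

locale topological_group = group G
  for G :: "('g::{t2_space, second_countable_topology}, 'm) monoid_scheme" (structure) +
  assumes carrier_UNIV [simp]: "carrier G = UNIV"
    and continuous_mult: "continuous_on UNIV (\<lambda>(a, b). a \<otimes> b)"
    and continuous_inverse: "continuous_on UNIV (\<lambda>a. inv a)"
begin

lemma inv_mult_cancel [simp]: "inv a \<otimes> (a \<otimes> b) = b" "a \<otimes> (inv a \<otimes> b) = b"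
  by (simp_all flip: m_assoc)

lemma mult_inv_cancel [simp]: "(b \<otimes> a) \<otimes> inv a = b" "(b \<otimes> inv a) \<otimes> a = b"
  by (simp_all add: m_assoc)

lemma continuous_on_mult:
  "continuous_on S f \<Longrightarrow> continuous_on S g \<Longrightarrow> continuous_on S (\<lambda>z. f z \<otimes> g z)"
  by (rule continuous_on_group_mult[OF continuous_mult])

lemma continuous_on_inv: "continuous_on S f \<Longrightarrow> continuous_on S (\<lambda>z. inv (f z))"
  by (rule continuous_on_compose2[OF continuous_inverse _ subset_UNIV])

lemma tendsto_mult_group:
  assumes "(f \<longlongrightarrow> a) F" "(g \<longlongrightarrow> b) F"
  shows "((\<lambda>n. f n \<otimes> g n) \<longlongrightarrow> a \<otimes> b) F"
  using continuous_on_tendsto_compose[OF continuous_mult tendsto_Pair[OF assms]] by simp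

lemma tendsto_inv_group:
  assumes "(f \<longlongrightarrow> a) F"
  shows "((\<lambda>n. inv (f n)) \<longlongrightarrow> inv a) F"
  using continuous_on_tendsto_compose[OF continuous_inverse assms] by simp

lemma measurable_mult_group:
  assumes "f \<in> N \<rightarrow>\<^sub>M borel" "g \<in> N \<rightarrow>\<^sub>M borel"
  shows "(\<lambda>n. f n \<otimes> g n) \<in> N \<rightarrow>\<^sub>M borel"
  using measurable_compose[OF borel_measurable_Pair[OF assms]
      borel_measurable_continuous_onI[OF continuous_mult]] by simp

lemma measurable_inv_group:
  assumes "f \<in> N \<rightarrow>\<^sub>M borel"
  shows "(\<lambda>n. inv (f n)) \<in> N \<rightarrow>\<^sub>M borel"
  using measurable_compose[OF assms borel_measurable_continuous_onI[OF continuous_inverse]] by simp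

text \<open>
  Regularity: if \<open>A \<otimes> B \<subseteq> U\<close> for neighbourhoods \<open>A\<close> of the unit and \<open>B\<close> of \<open>g\<close>, then a point
  \<open>y\<close> of the closure of \<open>B\<close> has some \<open>w \<in> B\<close> with \<open>y \<otimes> inv w \<in> A\<close>, so \<open>y = (y \<otimes> inv w) \<otimes> w\<close> is in \<open>U\<close>.
\<close>

lemma regular_neighbourhood:
  fixes g :: 'g
  assumes U: "open U" "g \<in> U"
  obtains V where "open V" "g \<in> V" "closure V \<subseteq> U"
proof -
  have "open ((\<lambda>(a, b). a \<otimes> b) -` U)" using U(1) continuous_mult by (simp add: open_vimage)
  moreover have "(\<one>, g) \<in> (\<lambda>(a, b). a \<otimes> b) -` U" using U(2) by simp
  ultimately obtain A B where AB: "open A" "open B" "(\<one>, g) \<in> A \<times> B" "A \<times> B \<subseteq> (\<lambda>(a, b). a \<otimes> b) -` U"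
    by (rule open_prod_elim)
  have "closure B \<subseteq> U"
  proof
    fix y assume y: "y \<in> closure B"
    have "continuous_on UNIV (\<lambda>w. y \<otimes> inv w)"
      by (intro continuous_on_mult continuous_on_inv continuous_intros)
    then have "open ((\<lambda>w. y \<otimes> inv w) -` A)" using AB(1) by (simp add: open_vimage)
    moreover have "y \<in> (\<lambda>w. y \<otimes> inv w) -` A" using AB(3) by (simp add: r_inv)
    ultimately have "(\<lambda>w. y \<otimes> inv w) -` A \<inter> B \<noteq> {}"
      using y open_Int_closure_eq_empty[of "(\<lambda>w. y \<otimes> inv w) -` A" B] by blast
    then obtain w where "w \<in> B" "y \<otimes> inv w \<in> A" by blast
    then have "(y \<otimes> inv w, w) \<in> A \<times> B" by simp
    from subsetD[OF AB(4) this] show "y \<in> U" by simp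
  qed
  moreover have "g \<in> B" using AB(3) by simp
  ultimately show ?thesis using AB(2) by (intro that)
qed

text \<open>
  A countable neighbourhood base of the unit, which takes the place of a metric on the group.
\<close>

definition unit_nbhds :: "nat \<Rightarrow> 'g set" where
  "unit_nbhds = (SOME A. (\<forall>i. open (A i) \<and> \<one> \<in> A i) \<and>
     (\<forall>S. open S \<longrightarrow> \<one> \<in> S \<longrightarrow> eventually (\<lambda>i. A i \<subseteq> S) sequentially))"

lemma unit_nbhds:
  shows "open (unit_nbhds i)" "\<one> \<in> unit_nbhds i"
    "\<And>S. open S \<Longrightarrow> \<one> \<in> S \<Longrightarrow> eventually (\<lambda>i. unit_nbhds i \<subseteq> S) sequentially"
proof -
  obtain A :: "nat \<Rightarrow> 'g set" where "\<And>i. open (A i)" "\<And>i. \<one> \<in> A i"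
    "\<And>S. open S \<Longrightarrow> \<one> \<in> S \<Longrightarrow> eventually (\<lambda>i. A i \<subseteq> S) sequentially"
    by (rule countable_basis_at_decseq[of "\<one> :: 'g"]) blast
  then have "\<exists>A :: nat \<Rightarrow> 'g set. (\<forall>i. open (A i) \<and> \<one> \<in> A i) \<and>
     (\<forall>S. open S \<longrightarrow> \<one> \<in> S \<longrightarrow> eventually (\<lambda>i. A i \<subseteq> S) sequentially)" by blast
  then have *: "(\<forall>i. open (unit_nbhds i) \<and> \<one> \<in> unit_nbhds i) \<and>
     (\<forall>S. open S \<longrightarrow> \<one> \<in> S \<longrightarrow> eventually (\<lambda>i. unit_nbhds i \<subseteq> S) sequentially)"
    unfolding unit_nbhds_def by (rule someI_ex)
  show "open (unit_nbhds i)" "\<one> \<in> unit_nbhds i" using * by simp_all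
  show "eventually (\<lambda>i. unit_nbhds i \<subseteq> S) sequentially" if "open S" "\<one> \<in> S" for S
    using * that by blast
qed

lemma tendsto_unit_iff:
  "(f \<longlongrightarrow> \<one>) F \<longleftrightarrow> (\<forall>k. \<forall>\<^sub>F n in F. f n \<in> unit_nbhds k)"
proof
  assume "(f \<longlongrightarrow> \<one>) F"
  then show "\<forall>k. \<forall>\<^sub>F n in F. f n \<in> unit_nbhds k"
    using topological_tendstoD[OF _ unit_nbhds(1,2)] by blast
next
  assume k: "\<forall>k. \<forall>\<^sub>F n in F. f n \<in> unit_nbhds k"
  show "(f \<longlongrightarrow> \<one>) F"
  proof (rule topological_tendstoI)
    fix S :: "'g set" assume "open S" "\<one> \<in> S"
    then obtain i where "unit_nbhds i \<subseteq> S"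
      using eventually_happens[OF unit_nbhds(3)] by auto
    have "\<forall>\<^sub>F n in F. f n \<in> unit_nbhds i" using k by blast
    then show "\<forall>\<^sub>F n in F. f n \<in> S" by eventually_elim (use \<open>unit_nbhds i \<subseteq> S\<close> in blast)
  qed
qed

lemma tendsto_iff_div_unit:
  "(f \<longlongrightarrow> a) F \<longleftrightarrow> ((\<lambda>n. inv a \<otimes> f n) \<longlongrightarrow> \<one>) F"
proof
  assume "(f \<longlongrightarrow> a) F"
  then have "((\<lambda>n. inv a \<otimes> f n) \<longlongrightarrow> inv a \<otimes> a) F" by (intro tendsto_mult_group tendsto_const)
  then show "((\<lambda>n. inv a \<otimes> f n) \<longlongrightarrow> \<one>) F" by (simp add: l_inv)
next
  assume "((\<lambda>n. inv a \<otimes> f n) \<longlongrightarrow> \<one>) F"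
  then have "((\<lambda>n. a \<otimes> (inv a \<otimes> f n)) \<longlongrightarrow> a \<otimes> \<one>) F" by (intro tendsto_mult_group tendsto_const)
  then show "(f \<longlongrightarrow> a) F" by simp
qed

end

section \<open>Equivariant Markov families\<close>

text \<open>
  The setting of the argument: \<open>left_mult_law\<close> is the form in which equivariance of the generator is
  used.
\<close>

locale equivariant_family = markov_family P + topological_group G
  for P :: "'x::{t2_space, second_countable_topology} \<times> 'g::{t2_space, second_countable_topology}
      \<Rightarrow> (real \<Rightarrow> 'x \<times> 'g) measure"
    and G :: "('g, 'm) monoid_scheme" (structure) +
  fixes ginf :: "(real \<Rightarrow> 'x \<times> 'g) \<Rightarrow> 'g"
  assumes left_mult_law: "distr (P z) path_space (path_map (left_mult G a)) = P (left_mult G a z)"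
    and regular: "regular P"
    and convergence: "convergence_to P ginf"
begin

abbreviation act :: "'g \<Rightarrow> (real \<Rightarrow> 'x \<times> 'g) \<Rightarrow> real \<Rightarrow> 'x \<times> 'g" where
  "act a \<equiv> path_map (left_mult G a)"

lemma continuous_left: "continuous_on UNIV (left_mult G a :: 'x \<times> 'g \<Rightarrow> _)"
  by (rule continuous_left_mult[OF continuous_mult])

lemma act_in_paths: "\<omega> \<in> paths \<Longrightarrow> act a \<omega> \<in> paths"
  by (rule path_map_in_paths[OF continuous_left])

lemma act_act: "act a (act b \<omega>) = act (a \<otimes> b) \<omega>"
  by (rule ext) (simp add: path_map_def left_mult_def case_prod_beta' m_assoc)

lemma act_one: "\<omega> \<in> paths \<Longrightarrow> act \<one> \<omega> = \<omega>"
  by (rule ext) (auto simp: path_map_def left_mult_def paths_def extensional_def)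

lemma shift_act: "0 \<le> t \<Longrightarrow> shift t (act a \<omega>) = act a (shift t \<omega>)"
  by (rule shift_path_map)

lemma left_mult_start: "left_mult G g (x, \<one>) = (x, g)"
  by (simp add: left_mult_def)

lemma measurable_act: "act a \<in> path_space \<rightarrow>\<^sub>M path_space"
  by (rule measurable_path_map[OF continuous_left])

text \<open>
  Translating by a group element that itself depends on the path is measurable for the coordinate
  events, since each coordinate of the result is a continuous function of that element and of a
  coordinate.
\<close>

lemma measurable_act_coord:
  assumes f: "f \<in> N \<rightarrow>\<^sub>M borel" and w: "w \<in> N \<rightarrow>\<^sub>M coord_space"
  shows "(\<lambda>n. act (f n) (w n)) \<in> N \<rightarrow>\<^sub>M coord_space"
proof (rule measurable_into_sigma_of)
  show "(\<lambda>n. act (f n) (w n)) \<in> space N \<rightarrow> paths"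
    using measurable_space[OF w] act_in_paths by auto
  fix t :: real assume t: "t \<in> {0..}"
  have c: "(\<lambda>n. w n t) \<in> N \<rightarrow>\<^sub>M borel"
    by (rule measurable_compose[OF w measurable_sigma_of_coord[where Y="\<lambda>t \<omega>. \<omega> t", OF t]])
  have "(\<lambda>n. fst (w n t)) \<in> N \<rightarrow>\<^sub>M borel" "(\<lambda>n. snd (w n t)) \<in> N \<rightarrow>\<^sub>M borel"
    by (rule measurable_compose[OF c borel_measurable_continuous_onI]; intro continuous_intros)+
  then have "(\<lambda>n. (fst (w n t), f n \<otimes> snd (w n t))) \<in> N \<rightarrow>\<^sub>M borel"
    by (intro borel_measurable_Pair measurable_mult_group f)
  with t show "(\<lambda>n. act (f n) (w n) t) \<in> N \<rightarrow>\<^sub>M borel"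
    by (simp add: left_mult_def case_prod_beta')
qed

lemma expectation_left_mult:
  fixes V :: "(real \<Rightarrow> 'x \<times> 'g) \<Rightarrow> real"
  assumes "V \<in> borel_measurable path_space"
  shows "(\<integral>\<omega>. V \<omega> \<partial>P (left_mult G a z)) = (\<integral>\<omega>. V (act a \<omega>) \<partial>P z)"
  unfolding left_mult_law[symmetric]
  by (rule integral_distr[OF _ assms]) (simp add: measurable_P_eq measurable_act)

lemma AE_act:
  assumes "\<And>z. AE \<omega> in P z. Q \<omega>"
  shows "AE \<omega> in P z. Q (act a \<omega>)"
  using assms[of "left_mult G a z"] unfolding left_mult_law[symmetric]
  by (rule AE_distrD[rotated]) (simp add: measurable_P_eq measurable_act)

lemma measurable_ginf: "ginf \<in> path_space \<rightarrow>\<^sub>M borel"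
  using convergence by (simp add: convergence_to_def)

lemma AE_convergence: "AE \<omega> in P z. ((\<lambda>t. snd (\<omega> t)) \<longlongrightarrow> ginf \<omega>) at_top"
  using convergence[unfolded convergence_to_def, THEN conjunct2] by (rule spec)

lemma ginf_act: "AE \<omega> in P z. ginf (act a \<omega>) = a \<otimes> ginf \<omega>"
  using AE_act[OF AE_convergence, where a=a and z=z] AE_convergence[of z]
proof eventually_elim
  case (elim \<omega>)
  have "((\<lambda>t. a \<otimes> snd (\<omega> t)) \<longlongrightarrow> a \<otimes> ginf \<omega>) at_top"
    by (intro tendsto_mult_group tendsto_const elim(2))
  moreover have "\<forall>\<^sub>F t in at_top. a \<otimes> snd (\<omega> t) = snd (act a \<omega> t)"
    using eventually_ge_at_top[of 0]
    by eventually_elim (simp add: left_mult_def case_prod_beta')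
  ultimately have "((\<lambda>t. snd (act a \<omega> t)) \<longlongrightarrow> a \<otimes> ginf \<omega>) at_top"
    by (rule Lim_transform_eventually)
  with elim(1) show ?case by (rule tendsto_unique[OF trivial_limit_at_top_linorder])
qed

text \<open>
  The shifted path has a limit which equals \<open>ginf\<close> of the original path, but \<open>ginf\<close> of the shifted path
  is tied to that limit only outside a null set, which \<open>AE_shift\<close> transports.
\<close>

lemma ginf_shift:
  assumes t: "0 \<le> t"
  shows "AE \<omega> in P z. ginf (shift t \<omega>) = ginf \<omega>"
proof -
  \<comment> \<open>convergence along integer times is a measurable condition\<close>
  let ?Q = "\<lambda>\<omega>. \<forall>k. \<forall>\<^sub>F n in sequentially. inv (ginf \<omega>) \<otimes> snd (\<omega> (real n)) \<in> unit_nbhds k"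
  have Q_iff: "?Q \<omega> \<longleftrightarrow> (\<lambda>n. snd (\<omega> (real n))) \<longlonglongrightarrow> ginf \<omega>" for \<omega>
    unfolding tendsto_iff_div_unit[of _ "ginf \<omega>"] tendsto_unit_iff ..
  have m: "(\<lambda>\<omega>. inv (ginf \<omega>) \<otimes> snd (\<omega> (real n))) \<in> path_space \<rightarrow>\<^sub>M borel" for n
    by (intro measurable_mult_group measurable_inv_group measurable_ginf
        measurable_compose[OF measurable_eval borel_measurable_continuous_onI] continuous_intros) simp
  have pred: "Measurable.pred path_space (\<lambda>\<omega>. inv (ginf \<omega>) \<otimes> snd (\<omega> (real n)) \<in> unit_nbhds k)" for n k
    by (rule measurable_compose[OF m]) (use unit_nbhds(1)[of k] in \<open>simp add: pred_def\<close>)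
  have Q: "Measurable.pred path_space ?Q"
    unfolding eventually_sequentially
    by (intro pred_intros_countable pred_intros_imp' pred)
  have "AE \<omega> in P z. ?Q \<omega>" for z
    unfolding Q_iff using AE_convergence[of z]
    by eventually_elim (rule filterlim_compose[OF _ filterlim_real_sequentially])
  from AE_shift[OF t Q this, of z] AE_convergence[of z] show ?thesis
  proof eventually_elim
    case (elim \<omega>)
    then have "(\<lambda>n. snd (\<omega> (real n + t))) \<longlonglongrightarrow> ginf (shift t \<omega>)"
      unfolding Q_iff by simp
    moreover have "(\<lambda>n. snd (\<omega> (real n + t))) \<longlonglongrightarrow> ginf \<omega>"
      using filterlim_compose[OF elim(2)
          filterlim_tendsto_add_at_top[OF tendsto_const[of t] filterlim_real_sequentially]]
      by (simp add: add.commute)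
    ultimately show ?case by (rule LIMSEQ_unique)
  qed
qed

text \<open>
  Up to null sets, \<open>ginf \<in> U\<close> for an open \<open>U\<close> means that \<open>snd (\<omega> t)\<close> is eventually in the closure
  of some basic open set whose closure is contained in \<open>U\<close>.
\<close>

lemma ginf_measurable_invariant: "ginf \<in> universal_completion P path_inv_space \<rightarrow>\<^sub>M borel"
proof (rule borel_measurableI)
  fix U :: "'g set" assume U: "open U"
  obtain \<B> :: "'g set set" where \<B>: "countable \<B>" "topological_basis \<B>"
    using ex_countable_basis by blast
  define \<V> where "\<V> = {V \<in> \<B>. closure V \<subseteq> U}"
  let ?A = "\<Union>V\<in>\<V>. {\<omega> \<in> paths. \<forall>\<^sub>F t in at_top. snd (\<omega> t) \<in> closure V} :: (real \<Rightarrow> 'x \<times> 'g) set"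
  have snd: "continuous_on UNIV (snd :: 'x \<times> 'g \<Rightarrow> 'g)" by (intro continuous_intros)
  have "?A \<in> sets path_inv_space"
  proof (rule sets.countable_UN'')
    show "countable \<V>" using \<B>(1) by (simp add: \<V>_def)
    show "{\<omega> \<in> paths. \<forall>\<^sub>F t in at_top. snd (\<omega> t) \<in> closure V}
        \<in> sets (path_inv_space :: (real \<Rightarrow> 'x \<times> 'g) measure)" for V :: "'g set"
      using subsetD[OF inv_sets_continuous_mono[OF snd]
          eventually_closed_in_inv_sets[OF snd closed_closure[of V]]]
      by simp
  qed
  moreover have "AE \<omega> in P z. \<omega> \<in> ?A \<longleftrightarrow> \<omega> \<in> ginf -` U \<inter> paths" for z
    using AE_convergence[of z] AE_space[of "P z"]
  proof eventually_elim
    case (elim \<omega>)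
    show ?case
    proof
      assume "\<omega> \<in> ?A"
      then obtain V where V: "closure V \<subseteq> U" "\<forall>\<^sub>F t in at_top. snd (\<omega> t) \<in> closure V"
        by (auto simp: \<V>_def)
      then have "ginf \<omega> \<in> closure V"
        by (intro Lim_in_closed_set[OF closed_closure _ trivial_limit_at_top_linorder elim(1)])
      with V(1) elim(2) show "\<omega> \<in> ginf -` U \<inter> paths" by auto
    next
      assume "\<omega> \<in> ginf -` U \<inter> paths"
      then have "ginf \<omega> \<in> U" by simp
      from regular_neighbourhood[OF U this]
      obtain V where V: "open V" "ginf \<omega> \<in> V" "closure V \<subseteq> U" .
      obtain B where B: "B \<in> \<B>" "ginf \<omega> \<in> B" "B \<subseteq> V"
        using topological_basisE[OF \<B>(2) V(1,2)] by blast
      have "B \<in> \<V>" using B(1) closure_mono[OF B(3)] V(3) by (auto simp: \<V>_def)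
      moreover have "\<forall>\<^sub>F t in at_top. snd (\<omega> t) \<in> B"
        using topological_tendstoD[OF elim(1) topological_basis_open[OF \<B>(2) B(1)] B(2)] .
      then have "\<forall>\<^sub>F t in at_top. snd (\<omega> t) \<in> closure B"
        by eventually_elim (use closure_subset in blast)
      ultimately show "\<omega> \<in> ?A" using elim(2) by auto
    qed
  qed
  moreover have "ginf -` U \<inter> paths \<in> sets path_space"
    using measurable_sets[OF measurable_ginf, of U] U by simp
  ultimately show "ginf -` U \<inter> space (universal_completion P path_inv_space)
      \<in> sets (universal_completion P path_inv_space)"
    unfolding space_universal_completion sets_universal_completion[OF space_inv_space] by blast
qed

end

lemma AE_iff_of_sym_diff_null:
  assumes "sym_diff A B \<in> null_sets M"
  shows "AE \<omega> in M. \<omega> \<in> A \<longleftrightarrow> \<omega> \<in> B"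
  using AE_not_in[OF assms] by eventually_elim auto

lemma sym_diff_null_of_AE_iff:
  assumes "A \<in> sets M" "B \<in> sets M" "AE \<omega> in M. \<omega> \<in> A \<longleftrightarrow> \<omega> \<in> B"
  shows "sym_diff A B \<in> null_sets M"
proof -
  have "sym_diff A B \<in> sets M" using assms(1,2) by auto
  moreover have "AE \<omega> in M. \<omega> \<notin> sym_diff A B" using assms(3) by eventually_elim auto
  ultimately show ?thesis using AE_iff_null_sets by blast
qed

lemma inv_space_shift:
  fixes f :: "(real \<Rightarrow> 'a::topological_space) \<Rightarrow> real"
  assumes "f \<in> borel_measurable (inv_space Y)" "0 \<le> t" "\<omega> \<in> paths"
  shows "f (shift t \<omega>) = f \<omega>"
proof -
  have "f -` {f \<omega>} \<inter> space (inv_space Y) \<in> sets (inv_space Y)"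
    by (rule measurable_sets[OF assms(1)]) simp
  then have "f -` {f \<omega>} \<inter> paths \<in> inv_sets Y" by simp
  from inv_sets_shift[OF this assms(2,3)] assms(3) show ?thesis by simp
qed

locale equivariant_devissage = equivariant_family P G ginf
  for P :: "'x::{t2_space, second_countable_topology} \<times> 'g::{t2_space, second_countable_topology}
      \<Rightarrow> (real \<Rightarrow> 'x \<times> 'g) measure"
    and G :: "('g, 'm) monoid_scheme" (structure) and ginf +
  fixes \<Lambda> :: "'s measure" and linf :: "(real \<Rightarrow> 'x \<times> 'g) \<Rightarrow> 's"
  assumes measurable_linf: "linf \<in> path_space \<rightarrow>\<^sub>M \<Lambda>"
    and linf_generates:
      "eq_mod_null (range P) (inv_sets (\<lambda>t \<omega>. fst (\<omega> t))) (sets (vimage_algebra paths linf \<Lambda>))"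
begin

abbreviation linf_space :: "(real \<Rightarrow> 'x \<times> 'g) measure" where
  "linf_space \<equiv> vimage_algebra paths linf \<Lambda>"

abbreviation limit_space :: "(real \<Rightarrow> 'x \<times> 'g) measure" where
  "limit_space \<equiv> vimage_algebra paths (\<lambda>\<omega>. (linf \<omega>, ginf \<omega>)) (\<Lambda> \<Otimes>\<^sub>M borel)"

abbreviation completion :: "(real \<Rightarrow> 'x \<times> 'g) measure \<Rightarrow> (real \<Rightarrow> 'x \<times> 'g) measure" where
  "completion \<equiv> universal_completion P"

lemma continuous_fst_UNIV: "continuous_on UNIV (fst :: 'x \<times> 'g \<Rightarrow> 'x)"
  by (intro continuous_intros)

lemma linf_in_space: "linf \<in> paths \<rightarrow> space \<Lambda>"
  using measurable_space[OF measurable_linf] by auto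

lemma linf_space_path_space: "sets linf_space \<subseteq> sets path_space"
  using measurable_sets[OF measurable_linf] unfolding sets_vimage_algebra2[OF linf_in_space] by auto

lemma first_inv_subset: "inv_sets (\<lambda>t \<omega>. fst (\<omega> t)) \<subseteq> sets (completion linf_space)"
proof
  fix A :: "(real \<Rightarrow> 'x \<times> 'g) set" assume A: "A \<in> inv_sets (\<lambda>t \<omega>. fst (\<omega> t))"
  then obtain B where B: "B \<in> sets linf_space" "\<And>Q. Q \<in> range P \<Longrightarrow> sym_diff A B \<in> null_sets Q"
    using linf_generates unfolding eq_mod_null_def by blast
  have "AE \<omega> in P z. \<omega> \<in> B \<longleftrightarrow> \<omega> \<in> A" for z
    using AE_iff_of_sym_diff_null[OF B(2)[of "P z"]] by auto
  moreover have "A \<in> sets path_space"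
    using A inv_sets_path_space_subset[OF continuous_fst_UNIV] by blast
  ultimately show "A \<in> sets (completion linf_space)"
    using B(1) by (subst sets_universal_completion) auto
qed

lemma linf_space_subset: "sets linf_space \<subseteq> sets (completion path_inv_space)"
proof
  fix B assume B: "B \<in> sets linf_space"
  then obtain A where A: "A \<in> inv_sets (\<lambda>t \<omega>. fst (\<omega> t) :: 'x)"
    "\<And>Q. Q \<in> range P \<Longrightarrow> sym_diff A B \<in> null_sets Q"
    using linf_generates unfolding eq_mod_null_def by blast
  have "AE \<omega> in P z. \<omega> \<in> A \<longleftrightarrow> \<omega> \<in> B" for z
    using AE_iff_of_sym_diff_null[OF A(2)[of "P z"]] by auto
  moreover have "A \<in> inv_sets (\<lambda>t \<omega>. \<omega> t)"
    using A(1) inv_sets_continuous_mono[OF continuous_fst_UNIV] by blast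
  moreover have "B \<in> sets path_space" using B linf_space_path_space by blast
  ultimately show "B \<in> sets (completion path_inv_space)"
    by (subst sets_universal_completion) auto
qed

lemma linf_measurable_invariant: "linf \<in> completion path_inv_space \<rightarrow>\<^sub>M \<Lambda>"
proof (rule measurableI)
  show "linf \<omega> \<in> space \<Lambda>" if "\<omega> \<in> space (completion path_inv_space)" for \<omega>
    using linf_in_space that by auto
  show "linf -` C \<inter> space (completion path_inv_space) \<in> sets (completion path_inv_space)"
    if "C \<in> sets \<Lambda>" for C
    using in_vimage_algebra[OF that, of linf paths] linf_space_subset by auto
qed

lemma limits_measurable_invariant:
  "(\<lambda>\<omega>. (linf \<omega>, ginf \<omega>)) \<in> completion path_inv_space \<rightarrow>\<^sub>M \<Lambda> \<Otimes>\<^sub>M borel"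
  by (intro measurable_Pair linf_measurable_invariant ginf_measurable_invariant)

lemma limits_in_space: "(\<lambda>\<omega>. (linf \<omega>, ginf \<omega>)) \<in> paths \<rightarrow> space (\<Lambda> \<Otimes>\<^sub>M borel)"
  using linf_in_space by (auto simp: space_pair_measure)

lemma sets_limit_space:
  "sets limit_space = {(\<lambda>\<omega>. (linf \<omega>, ginf \<omega>)) -` C \<inter> paths |C. C \<in> sets (\<Lambda> \<Otimes>\<^sub>M borel)}"
  by (rule sets_vimage_algebra2[OF limits_in_space])

lemma limit_space_subset: "sets limit_space \<subseteq> sets (completion path_inv_space)"
  using measurable_sets[OF limits_measurable_invariant] unfolding sets_limit_space by auto

lemma limit_space_path_space: "sets limit_space \<subseteq> sets path_space"
  using limit_space_subset universal_completion_subset[OF space_inv_space] by blast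

lemma measurable_limits: "(\<lambda>\<omega>. (linf \<omega>, ginf \<omega>)) \<in> limit_space \<rightarrow>\<^sub>M \<Lambda> \<Otimes>\<^sub>M borel"
  by (rule measurable_vimage_algebra1[OF limits_in_space])

lemma linf_space_limit_space: "sets linf_space \<subseteq> sets (completion limit_space)"
proof -
  have "linf \<in> limit_space \<rightarrow>\<^sub>M \<Lambda>"
    using measurable_compose[OF measurable_limits measurable_fst] by simp
  then have "sets linf_space \<subseteq> sets limit_space"
    using measurable_sets[of linf limit_space \<Lambda>] unfolding sets_vimage_algebra2[OF linf_in_space] by auto
  then show ?thesis
    using in_universal_completion[of limit_space P] limit_space_path_space by auto
qed

lemma ginf_measurable_limit: "ginf \<in> completion limit_space \<rightarrow>\<^sub>M borel"
  by (rule measurable_universal_completionI[OF _ _ limit_space_path_space])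
    (use measurable_compose[OF measurable_limits measurable_snd] in simp_all)

lemma completion_inv_coord:
  assumes "f \<in> completion path_inv_space \<rightarrow>\<^sub>M N"
  shows "f \<in> completion coord_space \<rightarrow>\<^sub>M N"
  using path_inv_subset_coord in_universal_completion[of coord_space P, OF _ coord_space_subset]
  by (intro measurable_universal_completion_mono[OF assms]) auto

lemma completion_limit_inv:
  assumes "f \<in> completion limit_space \<rightarrow>\<^sub>M N"
  shows "f \<in> completion path_inv_space \<rightarrow>\<^sub>M N"
  by (rule measurable_universal_completion_mono[OF assms _ _ limit_space_subset]) auto

lemma measurable_id_completion_coord: "(\<lambda>\<omega>. \<omega>) \<in> completion coord_space \<rightarrow>\<^sub>M coord_space"
  by (rule measurable_universal_completionI[OF _ _ coord_space_subset]) simp_all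

text \<open>
  Here the regularity condition enters: invariant functions have harmonic expectations.
\<close>

lemma continuous_expectation:
  fixes V :: "(real \<Rightarrow> 'x \<times> 'g) \<Rightarrow> real"
  assumes "V \<in> borel_measurable path_space" "\<And>\<omega>. \<omega> \<in> paths \<Longrightarrow> \<bar>V \<omega>\<bar> \<le> C"
    and "\<And>t z. 0 \<le> t \<Longrightarrow> AE \<omega> in P z. V (shift t \<omega>) = V \<omega>"
  shows "continuous_on UNIV (\<lambda>z. \<integral>\<omega>. V \<omega> \<partial>P z)"
  using regular harmonic_expectation[OF assms] by (simp add: regular_def)

lemma continuous_expectation_invariant:
  fixes V :: "(real \<Rightarrow> 'x \<times> 'g) \<Rightarrow> real"
  assumes "V \<in> borel_measurable (completion path_inv_space)" "\<And>\<omega>. \<omega> \<in> paths \<Longrightarrow> \<bar>V \<omega>\<bar> \<le> C"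
  shows "continuous_on UNIV (\<lambda>z. \<integral>\<omega>. V \<omega> \<partial>P z)"
  by (rule continuous_expectation[OF _ assms(2)])
    (auto intro: AE_shift_invariant[OF assms(1)] measurable_universal_completion_path_space[OF assms(1)])

text \<open>
  If \<open>V\<close> is also unchanged by the translations, then \<open>E\<^sub>z[V]\<close> depends on the \<open>X\<close>-component of \<open>z\<close>
  only, so its limit along the path is an invariant function of the first component.
\<close>

lemma translation_invariant_measurable_linf:
  fixes V :: "(real \<Rightarrow> 'x \<times> 'g) \<Rightarrow> real"
  assumes V: "V \<in> borel_measurable (completion coord_space)" "\<And>\<omega>. \<omega> \<in> paths \<Longrightarrow> \<bar>V \<omega>\<bar> \<le> C"
    and shift: "\<And>t z. 0 \<le> t \<Longrightarrow> AE \<omega> in P z. V (shift t \<omega>) = V \<omega>"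
    and act: "\<And>a z. AE \<omega> in P z. V (act a \<omega>) = V \<omega>"
  shows "V \<in> borel_measurable (completion linf_space)"
proof -
  have Vp: "V \<in> borel_measurable path_space"
    by (rule measurable_universal_completion_path_space[OF V(1)]) simp
  let ?h = "\<lambda>z. \<integral>\<omega>. V \<omega> \<partial>P z"
  have cont: "continuous_on UNIV ?h" by (rule continuous_expectation[OF Vp V(2) shift])
  have h_first: "?h z = ?h (fst z, \<one>)" for z
  proof -
    have "?h z = ?h (left_mult G (snd z) (fst z, \<one>))" by (simp add: left_mult_start)
    also have "\<dots> = (\<integral>\<omega>. V (act (snd z) \<omega>) \<partial>P (fst z, \<one>))" by (rule expectation_left_mult[OF Vp])
    also have "\<dots> = ?h (fst z, \<one>)"
      by (rule integral_cong_AE)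
        (simp_all only: measurable_P_eq Vp measurable_compose[OF measurable_act Vp] act)
    finally show ?thesis .
  qed
  have c1: "continuous_on UNIV (\<lambda>x. ?h (x, \<one>))"
    by (intro continuous_on_compose2[OF cont] continuous_intros) auto
  let ?I = "inv_space (\<lambda>t \<omega>. fst (\<omega> t)) :: (real \<Rightarrow> 'x \<times> 'g) measure"
  let ?L = "\<lambda>\<omega> :: real \<Rightarrow> 'x \<times> 'g. limsup_at_top (\<lambda>t. ?h (fst (\<omega> t), \<one>))"
  have "?L \<in> borel_measurable ?I"
    by (rule measurable_limsup_at_top[OF continuous_fst_UNIV c1])
  then have "?L \<in> borel_measurable (completion ?I)"
    by (rule measurable_universal_completionI)
      (use inv_sets_path_space_subset[OF continuous_fst_UNIV] in simp_all)
  then have L: "?L \<in> borel_measurable (completion linf_space)"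
    by (rule measurable_universal_completion_mono) (use first_inv_subset in simp_all)
  have "AE \<omega> in P z. ((\<lambda>t. ?h (\<omega> t)) \<longlongrightarrow> V \<omega>) at_top" for z
    by (rule expectation_converges_to_invariant[OF V shift cont])
  then have "AE \<omega> in P z. ?L \<omega> = V \<omega>" for z
  proof eventually_elim
    case (elim \<omega>)
    then have "((\<lambda>t. ?h (fst (\<omega> t), \<one>)) \<longlongrightarrow> V \<omega>) at_top" by (subst h_first[symmetric])
    then show ?case by (rule limsup_at_top_eq)
  qed
  then show ?thesis
    by (intro measurable_universal_completion_cong[OF L Vp]) simp_all
qed

text \<open>
  Given the path up to time \<open>t\<close>, the element \<open>inv (snd (\<omega> t)) \<otimes> ginf\<close> has the law of \<open>ginf\<close> started
  from \<open>(x, \<one>)\<close> with \<open>x = fst (\<omega> t)\<close>, by the Markov property and equivariance. As it converges to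
  the unit, this law must be concentrated there for suitable late values of \<open>fst (\<omega> t)\<close>.
\<close>

lemma ginf_concentrates:
  assumes U: "open U" "\<one> \<in> U" and \<epsilon>: "0 < \<epsilon>"
  shows "\<exists>x. measure (P (x, \<one>)) {\<omega> \<in> paths. ginf \<omega> \<notin> U} < \<epsilon>"
proof -
  define V where "V \<omega> = (of_bool (inv (snd (\<omega> 0)) \<otimes> ginf \<omega> \<notin> U) :: real)" for \<omega> :: "real \<Rightarrow> 'x \<times> 'g"
  let ?p = "\<lambda>x. measure (P (x, \<one>)) {\<omega> \<in> paths. ginf \<omega> \<notin> U}"
  have U_borel: "(\<lambda>c. of_bool (c \<notin> U) :: real) \<in> borel_measurable borel"
  proof -
    have "U \<in> sets borel" using U(1) by simp
    then show ?thesis by measurable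
  qed
  have snd0: "(\<lambda>\<omega>. snd (\<omega> 0)) \<in> path_space \<rightarrow>\<^sub>M (borel :: 'g measure)"
    by (rule measurable_compose[OF measurable_eval borel_measurable_continuous_onI])
      (auto intro: continuous_intros)
  have V_meas: "V \<in> borel_measurable path_space"
    unfolding V_def
    by (rule measurable_compose[OF _ U_borel])
      (intro measurable_mult_group measurable_inv_group measurable_ginf snd0)
  have V_bound: "\<bar>V \<omega>\<bar> \<le> 1" for \<omega> by (simp add: V_def)
  have p: "(\<integral>\<omega>. V \<omega> \<partial>P (x, g)) = ?p x" for x g
  proof -
    have gm: "(\<lambda>\<omega>. of_bool (ginf \<omega> \<notin> U) :: real) \<in> borel_measurable path_space"
      by (rule measurable_compose[OF measurable_ginf U_borel])
    have "(\<integral>\<omega>. V \<omega> \<partial>P (x, g)) = (\<integral>\<omega>. V (act g \<omega>) \<partial>P (x, \<one>))"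
      using expectation_left_mult[OF V_meas, of g "(x, \<one>)"] by (simp add: left_mult_start)
    also have "\<dots> = (\<integral>\<omega>. of_bool (ginf \<omega> \<notin> U) \<partial>P (x, \<one>))"
    proof (rule integral_cong_AE)
      show "AE \<omega> in P (x, \<one>). V (act g \<omega>) = of_bool (ginf \<omega> \<notin> U)"
        using ginf_act[where a=g and z="(x, \<one>)"] AE_start[of "(x, \<one>)"]
        by eventually_elim (simp add: V_def left_mult_def)
    qed (simp_all only: measurable_P_eq gm measurable_compose[OF measurable_act V_meas])
    also have "\<dots> = (\<integral>\<omega>. indicator {\<omega> \<in> paths. ginf \<omega> \<notin> U} \<omega> \<partial>P (x, \<one>))"
      by (rule Bochner_Integration.integral_cong[OF refl]) (simp add: indicator_def)
    also have "\<dots> = ?p x"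
      by (subst Bochner_Integration.integral_indicator) (auto intro: arg_cong[where f="measure _"])
    finally show ?thesis .
  qed
  have p': "(\<integral>\<omega>. V \<omega> \<partial>P y) = ?p (fst y)" for y
    using p[of "fst y" "snd y"] by simp
  let ?z = "(undefined, \<one>) :: 'x \<times> 'g"
  have Vs: "(\<lambda>\<omega>. V (shift (real n) \<omega>)) \<in> borel_measurable path_space" for n
    by (rule measurable_compose[OF measurable_shift V_meas]) simp
  have "(\<lambda>n. \<integral>\<omega>. V (shift (real n) \<omega>) \<partial>P ?z) \<longlonglongrightarrow> (\<integral>\<omega>. 0 \<partial>P ?z)"
  proof (rule integral_dominated_convergence[where w="\<lambda>_. 1"])
    have "AE \<omega> in P ?z. \<forall>n::nat. ginf (shift (real n) \<omega>) = ginf \<omega>"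
      unfolding AE_all_countable by (intro allI ginf_shift) simp
    with AE_convergence[of ?z]
    show "AE \<omega> in P ?z. (\<lambda>n. V (shift (real n) \<omega>)) \<longlonglongrightarrow> 0"
    proof eventually_elim
      case (elim \<omega>)
      have "(\<lambda>n. inv (snd (\<omega> (real n))) \<otimes> ginf \<omega>) \<longlonglongrightarrow> inv (ginf \<omega>) \<otimes> ginf \<omega>"
        by (intro tendsto_mult_group tendsto_inv_group tendsto_const
            filterlim_compose[OF elim(1) filterlim_real_sequentially])
      then have "\<forall>\<^sub>F n in sequentially. inv (snd (\<omega> (real n))) \<otimes> ginf \<omega> \<in> U"
        using U by (intro topological_tendstoD) (simp_all add: l_inv)
      then have "\<forall>\<^sub>F n in sequentially. V (shift (real n) \<omega>) = 0"
        by eventually_elim (simp add: V_def elim(2))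
      then show ?case by (rule tendsto_eventually)
    qed
  qed (simp_all add: measurable_P_eq Vs V_bound)
  then have "\<forall>\<^sub>F n in sequentially. (\<integral>\<omega>. V (shift (real n) \<omega>) \<partial>P ?z) < \<epsilon>"
    using \<epsilon> by (intro order_tendstoD(2)) auto
  then obtain n :: nat where "(\<integral>\<omega>. V (shift (real n) \<omega>) \<partial>P ?z) < \<epsilon>"
    using eventually_happens trivial_limit_sequentially by blast
  then have lt: "(\<integral>\<omega>. ?p (fst (\<omega> (real n))) \<partial>P ?z) < \<epsilon>"
    using markov_expectation[OF _ V_meas V_bound, of "real n" ?z] by (simp add: p')
  show ?thesis
  proof (rule ccontr)
    assume "\<not> ?thesis"
    then have ge: "\<epsilon> \<le> ?p x" for x by (simp add: not_less)
    have "(\<lambda>\<omega>. \<integral>\<omega>'. V \<omega>' \<partial>P (\<omega> (real n))) \<in> borel_measurable path_space"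
      by (rule measurable_compose[OF measurable_eval measurable_expectation[OF V_meas]]) simp
    then have "(\<lambda>\<omega> :: real \<Rightarrow> 'x \<times> 'g. ?p (fst (\<omega> (real n)))) \<in> borel_measurable path_space"
      by (simp only: p')
    then have "integrable (P ?z) (\<lambda>\<omega>. ?p (fst (\<omega> (real n))))"
      by (rule integrable_bounded[where C=1]) (simp add: prob.prob_le_1)
    then have "\<epsilon> \<le> (\<integral>\<omega>. ?p (fst (\<omega> (real n))) \<partial>P ?z)"
      by (rule prob.integral_ge_const) (use ge in simp)
    with lt show False by simp
  qed
qed


section \<open>Smoothing by the law of the limit\<close>

text \<open>
  In \<open>average x Z\<close> the function \<open>Z\<close> is convolved with the law of the inverse of \<open>ginf\<close> under
  \<open>P (x, \<one>)\<close>, which is an approximate identity when \<open>x\<close> is chosen by \<open>ginf_concentrates\<close>. Writing \<open>\<omega>\<close> as the translate by \<open>ginf \<omega>\<close> of a path \<open>\<eta>\<close> with limit \<open>\<one>\<close>, it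
  becomes a function of \<open>ginf \<omega>\<close> and \<open>\<eta>\<close>, namely \<open>smoothed x Z (ginf \<omega>) \<eta>\<close>.
\<close>

definition smoothed ::
  "'x \<Rightarrow> ((real \<Rightarrow> 'x \<times> 'g) \<Rightarrow> real) \<Rightarrow> 'g \<Rightarrow> (real \<Rightarrow> 'x \<times> 'g) \<Rightarrow> real" where
  "smoothed x Z b \<eta> = (\<integral>\<zeta>. Z (act (inv (ginf \<zeta>) \<otimes> b) \<eta>) \<partial>P (x, \<one>))"

definition average :: "'x \<Rightarrow> ((real \<Rightarrow> 'x \<times> 'g) \<Rightarrow> real) \<Rightarrow> (real \<Rightarrow> 'x \<times> 'g) \<Rightarrow> real" where
  "average x Z \<omega> = (\<integral>\<zeta>. Z (act (inv (ginf \<zeta>)) \<omega>) \<partial>P (x, \<one>))"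

lemma average_eq_smoothed: "average x Z \<omega> = smoothed x Z (ginf \<omega>) (act (inv (ginf \<omega>)) \<omega>)"
  by (simp add: average_def smoothed_def act_act)

text \<open>
  For a fixed path \<open>\<eta>\<close>, \<open>smoothed x Z b \<eta>\<close> is the expectation of a function of \<open>ginf\<close> started from
  \<open>(x, inv b)\<close>; so it is continuous in \<open>b\<close> although \<open>Z\<close> need not be.
\<close>

lemma continuous_smoothed:
  assumes Z: "Z \<in> borel_measurable coord_space" "\<And>\<omega>. \<omega> \<in> paths \<Longrightarrow> \<bar>Z \<omega>\<bar> \<le> C"
    and \<eta>: "\<eta> \<in> paths"
  shows "continuous_on UNIV (\<lambda>b. smoothed x Z b \<eta>)"
proof -
  \<comment> \<open>\<open>inv c \<otimes> b = inv (inv b \<otimes> c)\<close> turns the right factor \<open>b\<close> into a left translation of \<open>c = ginf \<zeta>\<close>\<close>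
  define f where "f c = Z (act (inv c) \<eta>)" for c
  have f: "f \<in> borel_measurable borel"
    unfolding f_def
  proof (rule measurable_compose[OF measurable_act_coord Z(1)])
    show "(\<lambda>c. inv c) \<in> (borel :: 'g measure) \<rightarrow>\<^sub>M borel" by (rule measurable_inv_group) simp
    show "(\<lambda>c. \<eta>) \<in> (borel :: 'g measure) \<rightarrow>\<^sub>M coord_space" using \<eta> by (intro measurable_const) simp
  qed
  have f_bound: "\<bar>f c\<bar> \<le> C" for c unfolding f_def by (rule Z(2)[OF act_in_paths[OF \<eta>]])
  have fg: "(\<lambda>\<zeta>. f (ginf \<zeta>)) \<in> borel_measurable (completion path_inv_space)"
    by (rule measurable_compose[OF ginf_measurable_invariant f])
  have fg_ps: "(\<lambda>\<zeta>. f (ginf \<zeta>)) \<in> borel_measurable path_space"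
    by (rule measurable_compose[OF measurable_ginf f])
  have cont: "continuous_on UNIV (\<lambda>z. \<integral>\<zeta>. f (ginf \<zeta>) \<partial>P z)"
    by (rule continuous_expectation_invariant[OF fg f_bound])
  have "smoothed x Z b \<eta> = (\<integral>\<zeta>. f (ginf \<zeta>) \<partial>P (x, inv b))" for b
  proof -
    have "smoothed x Z b \<eta> = (\<integral>\<zeta>. f (inv b \<otimes> ginf \<zeta>) \<partial>P (x, \<one>))"
      by (simp add: smoothed_def f_def inv_mult_group)
    also have "\<dots> = (\<integral>\<zeta>. f (ginf (act (inv b) \<zeta>)) \<partial>P (x, \<one>))"
    proof (rule integral_cong_AE)
      show "(\<lambda>\<zeta>. f (inv b \<otimes> ginf \<zeta>)) \<in> borel_measurable (P (x, \<one>))"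
        unfolding measurable_P_eq
        by (rule measurable_compose[OF measurable_mult_group[OF measurable_const measurable_ginf] f]) simp
      show "(\<lambda>\<zeta>. f (ginf (act (inv b) \<zeta>))) \<in> borel_measurable (P (x, \<one>))"
        unfolding measurable_P_eq by (rule measurable_compose[OF measurable_act fg_ps])
      show "AE \<zeta> in P (x, \<one>). f (inv b \<otimes> ginf \<zeta>) = f (ginf (act (inv b) \<zeta>))"
        using ginf_act[where a="inv b" and z="(x, \<one>)"] by eventually_elim simp
    qed
    also have "\<dots> = (\<integral>\<zeta>. f (ginf \<zeta>) \<partial>P (x, inv b))"
      using expectation_left_mult[OF fg_ps, of "inv b" "(x, \<one>)"] by (simp add: left_mult_start)
    finally show ?thesis .
  qed
  then show ?thesis
    using continuous_on_compose2[OF cont, of UNIV "\<lambda>b. (x, inv b)"]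
    by (simp add: continuous_on_Pair continuous_on_inv continuous_on_const)
qed

lemma measurable_act_pair:
  fixes Z :: "(real \<Rightarrow> 'x \<times> 'g) \<Rightarrow> real"
  assumes Z: "Z \<in> borel_measurable coord_space"
    and c: "case_prod c \<in> M \<Otimes>\<^sub>M path_space \<rightarrow>\<^sub>M borel" and w: "w \<in> M \<rightarrow>\<^sub>M coord_space"
  shows "(\<lambda>\<omega>. \<integral>\<zeta>. Z (act (c \<omega> \<zeta>) (w \<omega>)) \<partial>P z) \<in> borel_measurable M"
proof (rule prob.borel_measurable_lebesgue_integral[where f="\<lambda>\<omega> \<zeta>. Z (act (c \<omega> \<zeta>) (w \<omega>))"])
  have "(\<lambda>p. Z (act (case_prod c p) (w (fst p)))) \<in> borel_measurable (M \<Otimes>\<^sub>M path_space)"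
    by (rule measurable_compose[OF measurable_act_coord[OF c measurable_compose[OF measurable_fst w]] Z])
  then show "(\<lambda>(\<omega>, \<zeta>). Z (act (c \<omega> \<zeta>) (w \<omega>))) \<in> borel_measurable (M \<Otimes>\<^sub>M P z)"
    using measurable_cong_sets[OF sets_pair_measure_cong[OF refl sets_P] refl, of M z "borel :: real measure"]
    by (simp add: case_prod_beta')
qed

lemma smoothed_bound:
  assumes Z: "Z \<in> borel_measurable coord_space" "\<And>\<omega>. \<omega> \<in> paths \<Longrightarrow> \<bar>Z \<omega>\<bar> \<le> C" and \<eta>: "\<eta> \<in> paths"
  shows "\<bar>smoothed x Z b \<eta>\<bar> \<le> C"
  unfolding smoothed_def
proof (rule expectation_bounded)
  show "(\<lambda>\<zeta>. Z (act (inv (ginf \<zeta>) \<otimes> b) \<eta>)) \<in> borel_measurable path_space"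
    using \<eta> by (intro measurable_compose[OF measurable_act_coord Z(1)] measurable_mult_group
        measurable_inv_group measurable_ginf measurable_const) simp_all
  show "\<bar>Z (act (inv (ginf \<zeta>) \<otimes> b) \<eta>)\<bar> \<le> C" for \<zeta> by (rule Z(2)[OF act_in_paths[OF \<eta>]])
qed

text \<open>
  The path \<open>act (inv (ginf \<omega>)) \<omega>\<close> is unchanged when \<open>\<omega>\<close> is translated, because \<open>ginf\<close> is translated
  along with it; so \<open>translation_invariant_measurable_linf\<close> applies for a constant \<open>b\<close>.
\<close>

lemma smoothed_measurable_linf:
  assumes Z: "Z \<in> borel_measurable path_inv_space" "\<And>\<omega>. \<omega> \<in> paths \<Longrightarrow> \<bar>Z \<omega>\<bar> \<le> C"
  shows "(\<lambda>\<omega>. smoothed x Z b (act (inv (ginf \<omega>)) \<omega>)) \<in> borel_measurable (completion linf_space)"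
proof (rule translation_invariant_measurable_linf)
  let ?S = "\<lambda>\<omega>. smoothed x Z b (act (inv (ginf \<omega>)) \<omega>)"
  have Zc: "Z \<in> borel_measurable coord_space"
    by (rule measurable_from_subalg[OF _ Z(1)]) (use path_inv_subset_coord in \<open>simp add: subalgebra_def\<close>)
  have gc: "ginf \<in> completion coord_space \<rightarrow>\<^sub>M borel"
    by (rule completion_inv_coord[OF ginf_measurable_invariant])
  show "?S \<in> borel_measurable (completion coord_space)"
    unfolding smoothed_def
  proof (rule measurable_act_pair[OF Zc])
    show "(\<lambda>(\<omega>, \<zeta>). inv (ginf \<zeta>) \<otimes> b) \<in> completion coord_space \<Otimes>\<^sub>M path_space \<rightarrow>\<^sub>M borel"
      unfolding case_prod_beta'
      by (intro measurable_mult_group measurable_inv_group measurable_const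
          measurable_compose[OF measurable_snd measurable_ginf]) simp
    show "(\<lambda>\<omega>. act (inv (ginf \<omega>)) \<omega>) \<in> completion coord_space \<rightarrow>\<^sub>M coord_space"
      by (intro measurable_act_coord measurable_inv_group gc measurable_id_completion_coord)
  qed
  show "\<bar>?S \<omega>\<bar> \<le> C" if "\<omega> \<in> paths" for \<omega>
    by (rule smoothed_bound[OF Zc Z(2) act_in_paths[OF that]])
  show "AE \<omega> in P z. ?S (shift t \<omega>) = ?S \<omega>" if t: "0 \<le> t" for t z
    using ginf_shift[OF t, of z] AE_space[of "P z"]
  proof eventually_elim
    case (elim \<omega>)
    have "Z (act c (shift t (act d \<omega>))) = Z (act c (act d \<omega>))" for c d
      using inv_space_shift[OF Z(1) t, of "act c (act d \<omega>)"] elim(2)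
      by (simp add: act_in_paths shift_act[OF t])
    with elim(1) show ?case by (simp add: smoothed_def shift_act[OF t, symmetric])
  qed
  show "AE \<omega> in P z. ?S (act a \<omega>) = ?S \<omega>" for a z
    using ginf_act[where a=a and z=z]
    by eventually_elim (simp add: act_act inv_mult_group m_assoc)
qed

text \<open>
  The value \<open>b = ginf \<omega>\<close> is approximated by values in a countable dense subset of the group. For each of
  these the smoothed function is known to be a function of \<open>linf\<close> up to a null set, and continuity in
  \<open>b\<close> allows passing to the limit.
\<close>

lemma average_measurable_limit:
  assumes Z: "Z \<in> borel_measurable path_inv_space" "\<And>\<omega>. \<omega> \<in> paths \<Longrightarrow> \<bar>Z \<omega>\<bar> \<le> C"
  shows "average x Z \<in> borel_measurable (completion limit_space)"
proof -
  have Zc: "Z \<in> borel_measurable coord_space"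
    by (rule measurable_from_subalg[OF _ Z(1)]) (use path_inv_subset_coord in \<open>simp add: subalgebra_def\<close>)
  obtain D :: "'g set" where D: "countable D" "\<And>X. open X \<Longrightarrow> X \<noteq> {} \<Longrightarrow> \<exists>d\<in>D. d \<in> X"
    using countable_dense_exists by blast
  have "D \<noteq> {}" using D(2)[of UNIV] by auto
  define d where "d = from_nat_into D"
  have range_d: "range d = D" unfolding d_def by (rule range_from_nat_into[OF \<open>D \<noteq> {}\<close> D(1)])
  define idx where "idx k b = (LEAST i. b \<otimes> inv (d i) \<in> unit_nbhds k)" for k b
  have idx: "b \<otimes> inv (d (idx k b)) \<in> unit_nbhds k" for k b
  proof -
    have "continuous_on UNIV (\<lambda>c. b \<otimes> inv c)"
      by (intro continuous_on_mult continuous_on_inv continuous_intros)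
    then have "open ((\<lambda>c. b \<otimes> inv c) -` unit_nbhds k)" using unit_nbhds(1) by (simp add: open_vimage)
    moreover have "b \<in> (\<lambda>c. b \<otimes> inv c) -` unit_nbhds k" using unit_nbhds(2) by (simp add: r_inv)
    ultimately obtain c where "c \<in> D" "b \<otimes> inv c \<in> unit_nbhds k" using D(2) by blast
    then obtain i where "b \<otimes> inv (d i) \<in> unit_nbhds k" using range_d by blast
    then show ?thesis unfolding idx_def by (rule LeastI)
  qed
  have d_lim: "(\<lambda>k. d (idx k b)) \<longlonglongrightarrow> b" for b
  proof -
    have "(\<lambda>k. b \<otimes> inv (d (idx k b))) \<longlonglongrightarrow> \<one>"
    proof (rule topological_tendstoI)
      fix S :: "'g set" assume "open S" "\<one> \<in> S"
      from unit_nbhds(3)[OF this]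
      show "\<forall>\<^sub>F k in sequentially. b \<otimes> inv (d (idx k b)) \<in> S"
        by eventually_elim (use idx in blast)
    qed
    then have "(\<lambda>k. inv (b \<otimes> inv (d (idx k b))) \<otimes> b) \<longlonglongrightarrow> inv \<one> \<otimes> b"
      by (intro tendsto_mult_group tendsto_inv_group tendsto_const)
    then show ?thesis by (simp add: inv_mult_group)
  qed
  let ?S = "\<lambda>b \<omega>. smoothed x Z b (act (inv (ginf \<omega>)) \<omega>)"
  show ?thesis
  proof (rule borel_measurable_LIMSEQ_real)
    fix \<omega> assume "\<omega> \<in> space (completion limit_space)"
    then have \<omega>: "act (inv (ginf \<omega>)) \<omega> \<in> paths" by (simp add: act_in_paths)
    show "(\<lambda>k. ?S (d (idx k (ginf \<omega>))) \<omega>) \<longlonglongrightarrow> average x Z \<omega>"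
      unfolding average_eq_smoothed
      by (rule continuous_on_tendsto_compose[OF continuous_smoothed[OF Zc Z(2) \<omega>] d_lim]) simp_all
  next
    fix k
    show "(\<lambda>\<omega>. ?S (d (idx k (ginf \<omega>))) \<omega>) \<in> borel_measurable (completion limit_space)"
    proof (rule measurable_compose_countable[where f="\<lambda>i \<omega>. ?S (d i) \<omega>" and g="\<lambda>\<omega>. idx k (ginf \<omega>)"])
      show "?S (d i) \<in> borel_measurable (completion limit_space)" for i
        by (rule measurable_universal_completion_mono[OF smoothed_measurable_linf[OF Z] _ _
              linf_space_limit_space]) auto
      show "(\<lambda>\<omega>. idx k (ginf \<omega>)) \<in> completion limit_space \<rightarrow>\<^sub>M count_space UNIV"
        unfolding idx_def
      proof (rule measurable_Least)
        fix i
        have "(\<lambda>\<omega>. ginf \<omega> \<otimes> inv (d i)) \<in> completion limit_space \<rightarrow>\<^sub>M borel"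
          by (intro measurable_mult_group ginf_measurable_limit measurable_const) simp
        then show "Measurable.pred (completion limit_space) (\<lambda>\<omega>. ginf \<omega> \<otimes> inv (d i) \<in> unit_nbhds k)"
          by (rule measurable_compose) (use unit_nbhds(1)[of k] in \<open>simp add: pred_def\<close>)
      qed
    qed
  qed
qed

section \<open>Weak continuity of translations\<close>

text \<open>
  \<open>Y\<close> is replaced by \<open>E\<^sub>z[Y]\<close> evaluated at a late time \<open>m\<close>, with an error in mean that is uniform
  in the translation; by the Markov property at time \<open>m\<close> the function \<open>Z\<close> is then only seen through
  its expectations, which are continuous.
\<close>

lemma expectation_act_tendsto:
  fixes Y Z :: "(real \<Rightarrow> 'x \<times> 'g) \<Rightarrow> real"
  assumes Z: "Z \<in> borel_measurable (completion path_inv_space)" "\<And>\<omega>. \<omega> \<in> paths \<Longrightarrow> \<bar>Z \<omega>\<bar> \<le> C"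
    and Y: "Y \<in> borel_measurable (completion path_inv_space)" "\<And>\<omega>. \<omega> \<in> paths \<Longrightarrow> \<bar>Y \<omega>\<bar> \<le> D"
    and a: "a \<longlonglongrightarrow> \<one>"
  shows "(\<lambda>n. \<integral>\<omega>. Z (act (a n) \<omega>) * Y \<omega> \<partial>P z) \<longlonglongrightarrow> (\<integral>\<omega>. Z \<omega> * Y \<omega> \<partial>P z)"
proof -
  let ?hZ = "\<lambda>z. \<integral>\<omega>. Z \<omega> \<partial>P z" and ?hY = "\<lambda>z. \<integral>\<omega>. Y \<omega> \<partial>P z"
  have Zp: "Z \<in> borel_measurable path_space" and Yp: "Y \<in> borel_measurable path_space"
    using Z(1) Y(1) by (auto intro: measurable_universal_completion_path_space)
  have Za: "(\<lambda>\<omega>. Z (act c \<omega>)) \<in> borel_measurable path_space" for c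
    by (rule measurable_compose[OF measurable_act Zp])
  have Za_bound: "\<bar>Z (act c \<omega>)\<bar> \<le> C" if "\<omega> \<in> paths" for c \<omega>
    by (rule Z(2)[OF act_in_paths[OF that]])
  have C0: "0 \<le> C"
    using prob.not_empty[of z] Z(2) by (auto intro: order_trans[OF abs_ge_zero])
  have hZ_cont: "continuous_on UNIV ?hZ" by (rule continuous_expectation_invariant[OF Z])
  have hY_cont: "continuous_on UNIV ?hY" by (rule continuous_expectation_invariant[OF Y])
  have hZ_bound: "\<bar>?hZ y\<bar> \<le> C" for y by (rule expectation_bounded[OF Zp Z(2)])
  have hY_bound: "\<bar>?hY y\<bar> \<le> D" for y by (rule expectation_bounded[OF Yp Y(2)])
  have hZ_meas: "?hZ \<in> borel_measurable borel" by (rule measurable_expectation[OF Zp])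
  have hY_meas: "?hY \<in> borel_measurable borel" by (rule measurable_expectation[OF Yp])
  define R where "R m \<omega> = ?hY (\<omega> (real m))" for m \<omega>
  have Rp: "R m \<in> borel_measurable path_space" for m
    unfolding R_def by (rule measurable_compose[OF measurable_eval hY_meas]) simp
  have Rf: "R m \<in> borel_measurable (canonical_filtration (ennreal (real m)))" for m
    unfolding R_def by (rule measurable_compose[OF measurable_canonical_filtration_coord hY_meas]) simp_all
  have R_bound: "\<bar>R m \<omega>\<bar> \<le> D" for m \<omega> unfolding R_def by (rule hY_bound)
  have "AE \<omega> in P z. ((\<lambda>t. ?hY (\<omega> t)) \<longlongrightarrow> Y \<omega>) at_top"
    by (rule expectation_converges_to_invariant[OF completion_inv_coord[OF Y(1)] Y(2) _ hY_cont])
      (simp_all add: AE_shift_invariant[OF Y(1)])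
  then have R_lim: "AE \<omega> in P z. (\<lambda>m. R m \<omega>) \<longlonglongrightarrow> Y \<omega>"
    unfolding R_def by eventually_elim (rule filterlim_compose[OF _ filterlim_real_sequentially])
  have diff_meas: "(\<lambda>\<omega>. \<bar>Y \<omega> - R m \<omega>\<bar>) \<in> borel_measurable path_space" for m
    by (intro borel_measurable_abs borel_measurable_diff Yp Rp)
  have diff_bound: "\<bar>\<bar>Y \<omega> - R m \<omega>\<bar>\<bar> \<le> 2 * D" if "\<omega> \<in> paths" for m \<omega>
    using Y(2)[OF that] R_bound[of m \<omega>] by linarith
  have err: "(\<lambda>m. \<integral>\<omega>. \<bar>Y \<omega> - R m \<omega>\<bar> \<partial>P z) \<longlonglongrightarrow> (\<integral>\<omega>. 0 \<partial>P z)"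
  proof (rule integral_dominated_convergence[where w="\<lambda>_. 2 * D"])
    show "AE \<omega> in P z. (\<lambda>m. \<bar>Y \<omega> - R m \<omega>\<bar>) \<longlonglongrightarrow> 0"
      using R_lim
    proof eventually_elim
      case (elim \<omega>)
      then have "(\<lambda>m. \<bar>Y \<omega> - R m \<omega>\<bar>) \<longlonglongrightarrow> \<bar>Y \<omega> - Y \<omega>\<bar>" by (intro tendsto_intros)
      then show ?case by simp
    qed
    show "AE \<omega> in P z. norm \<bar>Y \<omega> - R m \<omega>\<bar> \<le> 2 * D" for m
      using AE_space by eventually_elim (use diff_bound in simp)
  qed (simp_all add: measurable_P_eq diff_meas)
  define J where "J m c = (\<integral>\<omega>. R m \<omega> * ?hZ (left_mult G c (\<omega> (real m))) \<partial>P z)" for m c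
  have lm: "left_mult G c \<in> borel \<rightarrow>\<^sub>M (borel :: ('x \<times> 'g) measure)" for c
    by (rule borel_measurable_continuous_onI[OF continuous_left])
  have J_meas: "(\<lambda>\<omega>. R m \<omega> * ?hZ (left_mult G c (\<omega> (real m)))) \<in> borel_measurable path_space" for m c
    by (intro borel_measurable_times Rp measurable_compose[OF _ hZ_meas] measurable_compose[OF _ lm]
        measurable_eval) simp
  have J_eq: "J m c = (\<integral>\<omega>. R m \<omega> * Z (act c \<omega>) \<partial>P z)" for m c
  proof -
    have "J m c = (\<integral>\<omega>. R m \<omega> * (\<integral>\<omega>'. Z (act c \<omega>') \<partial>P (\<omega> (real m))) \<partial>P z)"
      unfolding J_def by (simp add: expectation_left_mult[OF Zp])
    also have "\<dots> = (\<integral>\<omega>. R m \<omega> * Z (act c (shift (real m) \<omega>)) \<partial>P z)"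
      by (rule markov[symmetric, OF _ Za Za_bound Rf R_bound]) simp_all
    also have "\<dots> = (\<integral>\<omega>. R m \<omega> * Z (act c \<omega>) \<partial>P z)"
    proof (rule integral_cong_AE)
      have "AE \<omega> in P z. Z (shift (real m) (act c \<omega>)) = Z (act c \<omega>)"
        by (rule AE_act[where Q="\<lambda>\<omega>. Z (shift (real m) \<omega>) = Z \<omega>"])
          (rule AE_shift_invariant[OF Z(1)], simp)
      then show "AE \<omega> in P z. R m \<omega> * Z (act c (shift (real m) \<omega>)) = R m \<omega> * Z (act c \<omega>)"
        by eventually_elim (simp add: shift_act)
      show "(\<lambda>\<omega>. R m \<omega> * Z (act c (shift (real m) \<omega>))) \<in> borel_measurable (P z)"
        unfolding measurable_P_eq
        by (intro borel_measurable_times Rp measurable_compose[OF measurable_shift Za]) simp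
      show "(\<lambda>\<omega>. R m \<omega> * Z (act c \<omega>)) \<in> borel_measurable (P z)"
        unfolding measurable_P_eq by (intro borel_measurable_times Rp Za)
    qed
    finally show ?thesis .
  qed
  have J_lim: "(\<lambda>n. J m (a n)) \<longlonglongrightarrow> J m \<one>" for m
    unfolding J_def
  proof (rule integral_dominated_convergence[where w="\<lambda>_. D * C"])
    have "(\<lambda>n. left_mult G (a n) y) \<longlonglongrightarrow> left_mult G \<one> y" for y :: "'x \<times> 'g"
      unfolding left_mult_def case_prod_beta'
      by (intro tendsto_Pair tendsto_const tendsto_mult_group a)
    then have "(\<lambda>n. R m \<omega> * ?hZ (left_mult G (a n) (\<omega> (real m))))
        \<longlonglongrightarrow> R m \<omega> * ?hZ (left_mult G \<one> (\<omega> (real m)))" for \<omega>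
      by (intro tendsto_mult_left continuous_on_tendsto_compose[OF hZ_cont]) simp_all
    then show "AE \<omega> in P z. (\<lambda>n. R m \<omega> * ?hZ (left_mult G (a n) (\<omega> (real m))))
        \<longlonglongrightarrow> R m \<omega> * ?hZ (left_mult G \<one> (\<omega> (real m)))" by (intro AE_I2)
    have "norm (R m \<omega> * ?hZ (left_mult G (a n) (\<omega> (real m)))) \<le> D * C" for n \<omega>
      unfolding real_norm_def abs_mult
      using R_bound[of m \<omega>] hZ_bound[of "left_mult G (a n) (\<omega> (real m))"]
      by (intro mult_mono) linarith+
    then show "AE \<omega> in P z. norm (R m \<omega> * ?hZ (left_mult G (a n) (\<omega> (real m)))) \<le> D * C" for n
      by (intro AE_I2)
  qed (simp_all add: measurable_P_eq J_meas)
  define K where "K c = (\<integral>\<omega>. Z (act c \<omega>) * Y \<omega> \<partial>P z)" for c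
  have KJ: "\<bar>K c - J m c\<bar> \<le> C * (\<integral>\<omega>. \<bar>Y \<omega> - R m \<omega>\<bar> \<partial>P z)" for c m
  proof -
    have i1: "integrable (P z) (\<lambda>\<omega>. Z (act c \<omega>) * Y \<omega>)"
    proof (rule integrable_bounded[where C="C * D"])
      show "\<bar>Z (act c \<omega>) * Y \<omega>\<bar> \<le> C * D" if "\<omega> \<in> paths" for \<omega>
        unfolding abs_mult using Za_bound[OF that] Y(2)[OF that] C0 by (intro mult_mono) auto
    qed (intro borel_measurable_times Za Yp)
    have i2: "integrable (P z) (\<lambda>\<omega>. R m \<omega> * Z (act c \<omega>))"
    proof (rule integrable_bounded[where C="D * C"])
      show "\<bar>R m \<omega> * Z (act c \<omega>)\<bar> \<le> D * C" if "\<omega> \<in> paths" for \<omega>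
        unfolding abs_mult using Za_bound[OF that, of c] R_bound[of m \<omega>] C0
        by (intro mult_mono) linarith+
    qed (intro borel_measurable_times Za Rp)
    have i3: "integrable (P z) (\<lambda>\<omega>. \<bar>Y \<omega> - R m \<omega>\<bar>)"
      by (rule integrable_bounded[OF diff_meas diff_bound])
    have "\<bar>K c - J m c\<bar> = \<bar>\<integral>\<omega>. Z (act c \<omega>) * Y \<omega> - R m \<omega> * Z (act c \<omega>) \<partial>P z\<bar>"
      unfolding K_def J_eq using i1 i2 by simp
    also have "\<dots> \<le> (\<integral>\<omega>. \<bar>Z (act c \<omega>) * Y \<omega> - R m \<omega> * Z (act c \<omega>)\<bar> \<partial>P z)"
      by (rule integral_abs_bound)
    also have "\<dots> \<le> (\<integral>\<omega>. C * \<bar>Y \<omega> - R m \<omega>\<bar> \<partial>P z)"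
    proof (rule integral_mono)
      fix \<omega> assume "\<omega> \<in> space (P z)"
      then have "\<bar>Z (act c \<omega>)\<bar> \<le> C" by (simp add: Za_bound)
      moreover have "\<bar>Z (act c \<omega>) * Y \<omega> - R m \<omega> * Z (act c \<omega>)\<bar> = \<bar>Z (act c \<omega>)\<bar> * \<bar>Y \<omega> - R m \<omega>\<bar>"
        by (simp flip: abs_mult add: algebra_simps)
      ultimately show "\<bar>Z (act c \<omega>) * Y \<omega> - R m \<omega> * Z (act c \<omega>)\<bar> \<le> C * \<bar>Y \<omega> - R m \<omega>\<bar>"
        by (simp add: mult_right_mono)
    qed (use i1 i2 i3 in simp_all)
    finally show ?thesis by simp
  qed
  have "(\<lambda>n. K (a n)) \<longlonglongrightarrow> K \<one>"
  proof (rule LIMSEQ_I)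
    fix e :: real assume e: "0 < e"
    have "(\<lambda>m. C * (\<integral>\<omega>. \<bar>Y \<omega> - R m \<omega>\<bar> \<partial>P z)) \<longlonglongrightarrow> C * 0"
      using err by (intro tendsto_mult_left) simp
    then have "\<forall>\<^sub>F m in sequentially. C * (\<integral>\<omega>. \<bar>Y \<omega> - R m \<omega>\<bar> \<partial>P z) < e / 3"
      using e by (intro order_tendstoD(2)) auto
    then obtain m where m: "C * (\<integral>\<omega>. \<bar>Y \<omega> - R m \<omega>\<bar> \<partial>P z) < e / 3"
      using eventually_happens trivial_limit_sequentially by blast
    obtain N where N: "\<And>n. N \<le> n \<Longrightarrow> \<bar>J m (a n) - J m \<one>\<bar> < e / 3"
      using LIMSEQ_D[OF J_lim, of "e / 3" m] e by auto
    have "norm (K (a n) - K \<one>) < e" if "N \<le> n" for n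
      using KJ[of "a n" m] KJ[of \<one> m] N[OF that] m unfolding real_norm_def by linarith
    then show "\<exists>N. \<forall>n\<ge>N. norm (K (a n) - K \<one>) < e" by blast
  qed
  moreover have "K \<one> = (\<integral>\<omega>. Z \<omega> * Y \<omega> \<partial>P z)"
    unfolding K_def by (rule Bochner_Integration.integral_cong[OF refl]) (simp add: act_one)
  ultimately show ?thesis by (simp add: K_def)
qed


text \<open>
  By Fubini's theorem the expectation is the mean of \<open>k (inv c)\<close> over the law of \<open>c = ginf\<close> under
  \<open>P (x n, \<one>)\<close>, where \<open>k a = E\<^sub>z[Z (act a \<omega>) Y]\<close> is continuous at the unit. Only weak convergence
  is claimed, which suffices to identify a conditional expectation.
\<close>

lemma expectation_average_tendsto:
  fixes Y Z :: "(real \<Rightarrow> 'x \<times> 'g) \<Rightarrow> real"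
  assumes Z: "Z \<in> borel_measurable path_inv_space" "\<And>\<omega>. \<omega> \<in> paths \<Longrightarrow> \<bar>Z \<omega>\<bar> \<le> C"
    and Y: "Y \<in> borel_measurable (completion path_inv_space)" "\<And>\<omega>. \<omega> \<in> paths \<Longrightarrow> \<bar>Y \<omega>\<bar> \<le> D"
    and x: "(\<lambda>n. measure (P (x n, \<one>)) {\<omega> \<in> paths. ginf \<omega> \<notin> unit_nbhds n}) \<longlonglongrightarrow> 0"
  shows "(\<lambda>n. \<integral>\<omega>. average (x n) Z \<omega> * Y \<omega> \<partial>P z) \<longlonglongrightarrow> (\<integral>\<omega>. Z \<omega> * Y \<omega> \<partial>P z)"
proof -
  define k where "k a = (\<integral>\<omega>. Z (act a \<omega>) * Y \<omega> \<partial>P z)" for a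
  have Zc: "Z \<in> borel_measurable coord_space"
    by (rule measurable_from_subalg[OF _ Z(1)]) (use path_inv_subset_coord in \<open>simp add: subalgebra_def\<close>)
  have Zi: "Z \<in> borel_measurable (completion path_inv_space)"
    by (rule measurable_universal_completionI[OF Z(1) _ path_inv_subset_path_space]) simp
  have Zp: "Z \<in> borel_measurable path_space" and Yp: "Y \<in> borel_measurable path_space"
    using Zi Y(1) by (auto intro: measurable_universal_completion_path_space)
  have ZY_bound: "\<bar>Z (act a \<omega>) * Y \<omega>\<bar> \<le> C * D" if "\<omega> \<in> paths" for a \<omega>
    unfolding abs_mult using Z(2)[OF act_in_paths[OF that], of a] Y(2)[OF that]
    by (intro mult_mono) linarith+
  have k_bound: "\<bar>k a\<bar> \<le> C * D" for a
    unfolding k_def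
    by (rule expectation_bounded[OF _ ZY_bound])
      (intro borel_measurable_times Yp measurable_compose[OF measurable_act Zp])
  have k_one: "k \<one> = (\<integral>\<omega>. Z \<omega> * Y \<omega> \<partial>P z)"
    unfolding k_def by (rule Bochner_Integration.integral_cong[OF refl]) (simp add: act_one)
  have k_lim: "(\<lambda>n. k (a n)) \<longlonglongrightarrow> k \<one>" if "a \<longlonglongrightarrow> \<one>" for a
    unfolding k_one unfolding k_def by (rule expectation_act_tendsto[OF Zi Z(2) Y that])
  have id_c: "(\<lambda>\<omega>. \<omega>) \<in> path_space \<rightarrow>\<^sub>M (coord_space :: (real \<Rightarrow> 'x \<times> 'g) measure)"
    by (rule measurable_from_subalg[of _ coord_space])
      (use coord_space_subset in \<open>simp_all add: subalgebra_def\<close>)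
  have joint: "(\<lambda>(\<omega>, \<zeta>). Z (act (inv (ginf \<zeta>)) \<omega>) * Y \<omega>) \<in> borel_measurable (P z \<Otimes>\<^sub>M P y)" for y
  proof -
    have "(\<lambda>p. Z (act (inv (ginf (snd p))) (fst p)) * Y (fst p))
        \<in> borel_measurable (path_space \<Otimes>\<^sub>M path_space)"
      by (intro borel_measurable_times measurable_compose[OF measurable_act_coord Zc]
          measurable_inv_group measurable_compose[OF measurable_snd measurable_ginf]
          measurable_compose[OF measurable_fst id_c] measurable_compose[OF measurable_fst Yp])
    then show ?thesis
      using measurable_cong_sets[OF sets_pair_measure_cong[OF sets_P sets_P] refl,
          of z y "borel :: real measure"] by (simp add: case_prod_beta')
  qed
  have swap: "(\<integral>\<omega>. average (x n) Z \<omega> * Y \<omega> \<partial>P z) = (\<integral>\<zeta>. k (inv (ginf \<zeta>)) \<partial>P (x n, \<one>))" for n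
  proof -
    interpret pp: pair_prob_space "P z" "P (x n, \<one>)" ..
    have "integrable (P z \<Otimes>\<^sub>M P (x n, \<one>)) (\<lambda>(\<omega>, \<zeta>). Z (act (inv (ginf \<zeta>)) \<omega>) * Y \<omega>)"
    proof (rule pp.P.integrable_const_bound[OF _ joint])
      show "AE p in P z \<Otimes>\<^sub>M P (x n, \<one>). norm (case p of (\<omega>, \<zeta>) \<Rightarrow> Z (act (inv (ginf \<zeta>)) \<omega>) * Y \<omega>) \<le> C * D"
        using ZY_bound by (intro AE_I2) (auto simp: space_pair_measure)
    qed
    from pp.Fubini_integral[OF this]
    show ?thesis by (simp add: average_def k_def)
  qed
  have kg: "(\<lambda>\<zeta>. k (inv (ginf \<zeta>))) \<in> borel_measurable path_space"
    unfolding k_def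
  proof (rule prob.borel_measurable_lebesgue_integral[where f="\<lambda>\<zeta> \<omega>. Z (act (inv (ginf \<zeta>)) \<omega>) * Y \<omega>"])
    have "(\<lambda>p. Z (act (inv (ginf (fst p))) (snd p)) * Y (snd p))
        \<in> borel_measurable (path_space \<Otimes>\<^sub>M path_space)"
      by (intro borel_measurable_times measurable_compose[OF measurable_act_coord Zc]
          measurable_inv_group measurable_compose[OF measurable_fst measurable_ginf]
          measurable_compose[OF measurable_snd id_c] measurable_compose[OF measurable_snd Yp])
    then show "(\<lambda>(\<zeta>, \<omega>). Z (act (inv (ginf \<zeta>)) \<omega>) * Y \<omega>) \<in> borel_measurable (path_space \<Otimes>\<^sub>M P z)"
      using measurable_cong_sets[OF sets_pair_measure_cong[OF refl sets_P] refl,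
          of "path_space :: (real \<Rightarrow> 'x \<times> 'g) measure" z "borel :: real measure"]
      by (simp add: case_prod_beta')
  qed
  have near: "\<forall>\<^sub>F n in sequentially. \<forall>c\<in>unit_nbhds n. \<bar>k (inv c) - k \<one>\<bar> < e" if e: "0 < e" for e
  proof -
    \<comment> \<open>a sequence that picks a bad point of each neighbourhood for as long as there is one\<close>
    define c where "c n = (if \<exists>c\<in>unit_nbhds n. e \<le> \<bar>k (inv c) - k \<one>\<bar>
      then SOME c. c \<in> unit_nbhds n \<and> e \<le> \<bar>k (inv c) - k \<one>\<bar> else \<one>)" for n
    have c: "c n \<in> unit_nbhds n \<and> (\<forall>c'\<in>unit_nbhds n. e \<le> \<bar>k (inv c') - k \<one>\<bar> \<longrightarrow> e \<le> \<bar>k (inv (c n)) - k \<one>\<bar>)" for n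
    proof (cases "\<exists>c\<in>unit_nbhds n. e \<le> \<bar>k (inv c) - k \<one>\<bar>")
      case True
      then have "\<exists>c. c \<in> unit_nbhds n \<and> e \<le> \<bar>k (inv c) - k \<one>\<bar>" by blast
      from someI_ex[OF this] True show ?thesis by (simp add: c_def)
    next
      case False
      then show ?thesis using unit_nbhds(2) by (auto simp: c_def)
    qed
    have "c \<longlonglongrightarrow> \<one>"
    proof (rule topological_tendstoI)
      fix S :: "'g set" assume "open S" "\<one> \<in> S"
      from unit_nbhds(3)[OF this] show "\<forall>\<^sub>F n in sequentially. c n \<in> S"
        by eventually_elim (use c in blast)
    qed
    then have "(\<lambda>n. inv (c n)) \<longlonglongrightarrow> \<one>" using tendsto_inv_group by fastforce
    from k_lim[OF this] have "(\<lambda>n. \<bar>k (inv (c n)) - k \<one>\<bar>) \<longlonglongrightarrow> \<bar>k \<one> - k \<one>\<bar>"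
      by (intro tendsto_intros)
    then have "\<forall>\<^sub>F n in sequentially. \<bar>k (inv (c n)) - k \<one>\<bar> < e"
      using e by (intro order_tendstoD(2)) auto
    then show ?thesis by eventually_elim (use c in \<open>meson not_le\<close>)
  qed
  have "(\<lambda>n. \<integral>\<zeta>. k (inv (ginf \<zeta>)) \<partial>P (x n, \<one>)) \<longlonglongrightarrow> k \<one>"
  proof (rule tendstoI)
    fix e :: real assume e: "0 < e"
    let ?B = "2 * (C * D)" and ?p = "\<lambda>n. measure (P (x n, \<one>)) {\<omega> \<in> paths. ginf \<omega> \<notin> unit_nbhds n}"
    have "(\<lambda>n. ?B * ?p n) \<longlonglongrightarrow> ?B * 0" by (intro tendsto_mult_left x)
    then have "\<forall>\<^sub>F n in sequentially. ?B * ?p n < e / 2" using e by (intro order_tendstoD(2)) auto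
    moreover have "\<forall>\<^sub>F n in sequentially. \<forall>c\<in>unit_nbhds n. \<bar>k (inv c) - k \<one>\<bar> < e / 2"
      using e by (intro near) simp
    ultimately show "\<forall>\<^sub>F n in sequentially. dist (\<integral>\<zeta>. k (inv (ginf \<zeta>)) \<partial>P (x n, \<one>)) (k \<one>) < e"
    proof eventually_elim
      case (elim n)
      let ?Q = "P (x n, \<one>)"
      let ?E = "{\<omega> \<in> paths. ginf \<omega> \<notin> unit_nbhds n}"
      have "ginf -` (- unit_nbhds n) \<inter> space path_space \<in> sets path_space"
        using measurable_sets[OF measurable_ginf, of "- unit_nbhds n"] unit_nbhds(1)[of n]
        by (simp add: borel_closed closed_Compl)
      then have E: "?E \<in> sets path_space" by (simp add: vimage_def Int_def conj_commute)
      have i: "integrable ?Q (\<lambda>\<zeta>. k (inv (ginf \<zeta>)))" by (rule integrable_bounded[OF kg k_bound])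
      have "(\<integral>\<zeta>. k (inv (ginf \<zeta>)) \<partial>?Q) - k \<one> = (\<integral>\<zeta>. k (inv (ginf \<zeta>)) - k \<one> \<partial>?Q)"
        using i prob.prob_space[of "(x n, \<one>)"] by simp
      also have "\<bar>\<dots>\<bar> \<le> (\<integral>\<zeta>. \<bar>k (inv (ginf \<zeta>)) - k \<one>\<bar> \<partial>?Q)" by (rule integral_abs_bound)
      also have "\<dots> \<le> (\<integral>\<zeta>. e / 2 + ?B * indicator ?E \<zeta> \<partial>?Q)"
      proof (rule integral_mono)
        show "integrable ?Q (\<lambda>\<zeta>. \<bar>k (inv (ginf \<zeta>)) - k \<one>\<bar>)" using i by simp
        have "integrable ?Q (indicator ?E :: _ \<Rightarrow> real)"
          by (rule integrable_bounded[where C=1]) (use E in \<open>auto simp: indicator_def\<close>)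
        then show "integrable ?Q (\<lambda>\<zeta>. e / 2 + ?B * indicator ?E \<zeta>)" by simp
        fix \<zeta> assume "\<zeta> \<in> space ?Q"
        then have \<zeta>: "\<zeta> \<in> paths" by simp
        show "\<bar>k (inv (ginf \<zeta>)) - k \<one>\<bar> \<le> e / 2 + ?B * indicator ?E \<zeta>"
        proof (cases "ginf \<zeta> \<in> unit_nbhds n")
          case True
          then have "\<bar>k (inv (ginf \<zeta>)) - k \<one>\<bar> < e / 2" using elim(2) by blast
          with True show ?thesis by (simp add: indicator_def)
        next
          case False
          have "\<bar>k (inv (ginf \<zeta>)) - k \<one>\<bar> \<le> ?B"
            using k_bound[of "inv (ginf \<zeta>)"] k_bound[of \<one>] by linarith
          with False \<zeta> e show ?thesis by (simp add: indicator_def)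
        qed
      qed
      also have "\<dots> = e / 2 + ?B * ?p n"
      proof -
        have "integrable ?Q (indicator ?E :: _ \<Rightarrow> real)"
          by (rule integrable_bounded[where C=1]) (use E in \<open>auto simp: indicator_def\<close>)
        moreover have "?E \<inter> paths = ?E" by blast
        ultimately show ?thesis
          using E prob.prob_space[of "(x n, \<one>)"] by simp
      qed
      also have "\<dots> < e" using elim(1) by linarith
      finally show ?case by (simp add: dist_real_def)
    qed
  qed
  then show ?thesis by (simp add: swap k_one)
qed

section \<open>Invariant events and the limits\<close>

text \<open>
  Probabilities of invariant events are continuous in the starting point, so being negligible for a
  dense set of starting points is being negligible for all of them.
\<close>

lemma AE_from_dense:
  assumes S: "S \<in> sets (completion path_inv_space)"
    and D: "\<And>X. open X \<Longrightarrow> X \<noteq> {} \<Longrightarrow> \<exists>d\<in>D. d \<in> X"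
    and ae: "\<And>d. d \<in> D \<Longrightarrow> AE \<omega> in P d. \<omega> \<notin> S"
  shows "AE \<omega> in P z. \<omega> \<notin> S"
proof -
  have Sp: "S \<in> sets path_space" using S universal_completion_subset[OF space_inv_space] by blast
  have "(indicator S :: _ \<Rightarrow> real) \<in> borel_measurable (completion path_inv_space)"
    using S by (rule borel_measurable_indicator)
  then have cont: "continuous_on UNIV (\<lambda>z. \<integral>\<omega>. indicator S \<omega> \<partial>P z :: real)"
    by (rule continuous_expectation_invariant[where C=1]) (simp add: indicator_def)
  have eq: "(\<integral>\<omega>. indicator S \<omega> \<partial>P z :: real) = measure (P z) S" for z
    using sets.sets_into_space[OF Sp] by (simp add: Int_absorb2)
  have "measure (P z) S = 0"
  proof (rule ccontr)
    assume "measure (P z) S \<noteq> 0"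
    moreover have "open {z. measure (P z) S \<noteq> 0}"
      using cont unfolding eq by (intro open_Collect_neq) auto
    ultimately obtain d where "d \<in> D" "measure (P d) S \<noteq> 0" using D by blast
    moreover have "measure (P d) S = 0"
      using ae[OF \<open>d \<in> D\<close>] Sp by (simp add: prob.prob_eq_0)
    ultimately show False by simp
  qed
  then show ?thesis using Sp by (simp add: prob.prob_eq_0)
qed


text \<open>
  Let \<open>\<rho>\<close> be a mixture of the laws started from a dense sequence, \<open>W\<close> the conditional expectation of
  the indicator of \<open>A\<close> given the two limits, and \<open>Y\<close> the difference. Averages of the indicator are
  functions of the limits, hence orthogonal to \<open>Y\<close>; by weak convergence so is the indicator itself.
  Then \<open>Y\<close> is orthogonal to itself, which makes \<open>A\<close> equal to \<open>{W = 1}\<close> almost surely under \<open>\<rho>\<close>, and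
  therefore from every starting point.
\<close>

theorem invariant_measurable_limits:
  assumes A: "A \<in> inv_sets (\<lambda>t \<omega>. \<omega> t)"
  shows "A \<in> sets (completion limit_space)"
proof -
  obtain D :: "('x \<times> 'g) set" where D: "countable D" "\<And>X. open X \<Longrightarrow> X \<noteq> {} \<Longrightarrow> \<exists>d\<in>D. d \<in> X"
    using countable_dense_exists by blast
  have "D \<noteq> {}" using D(2)[of UNIV] by auto
  define s where "s = from_nat_into D"
  have range_s: "range s = D" unfolding s_def by (rule range_from_nat_into[OF \<open>D \<noteq> {}\<close> D(1)])
  \<comment> \<open>any fully supported distribution on the indices of the dense sequence\<close>
  define q where "q = measure_pmf (geometric_pmf (1 / 2))"
  interpret q: prob_space q unfolding q_def by (rule prob_space_measure_pmf)
  define \<rho> where "\<rho> = q \<bind> (\<lambda>n. P (s n))"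
  have kernel: "(\<lambda>n. P (s n)) \<in> q \<rightarrow>\<^sub>M subprob_algebra path_space"
    by (rule measurable_compose[OF _ measurable_P_subprob]) (simp add: q_def)
  have sets_\<rho>: "sets \<rho> = sets path_space"
    unfolding \<rho>_def by (rule sets_bind) (simp_all add: q_def)
  have meas_\<rho>: "measurable \<rho> N = measurable path_space N" for N :: "real measure"
    by (rule measurable_cong_sets[OF sets_\<rho> refl])
  have space_\<rho>: "space \<rho> = paths" using sets_eq_imp_space_eq[OF sets_\<rho>] by simp
  interpret \<rho>: prob_space \<rho>
    unfolding \<rho>_def by (rule q.prob_space_bind[OF _ kernel]) (simp add: prob_space_P)
  have int_\<rho>: "(\<integral>\<omega>. f \<omega> \<partial>\<rho>) = (\<integral>n. (\<integral>\<omega>. f \<omega> \<partial>P (s n)) \<partial>q)"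
    if "f \<in> borel_measurable path_space" "\<And>\<omega>. \<omega> \<in> paths \<Longrightarrow> \<bar>f \<omega>\<bar> \<le> B" for f :: "(real \<Rightarrow> 'x \<times> 'g) \<Rightarrow> real" and B
    unfolding \<rho>_def
  proof (rule integral_bind[OF that(1) _ kernel])
    show "\<bar>f \<omega>\<bar> \<le> B" if "\<omega> \<in> space path_space" for \<omega> using that \<open>\<And>\<omega>. \<omega> \<in> paths \<Longrightarrow> \<bar>f \<omega>\<bar> \<le> B\<close> by simp
    show "finite_measure q" by (rule q.finite_measure_axioms)
    show "AE n in q. emeasure (P (s n)) (space (P (s n))) \<le> ennreal 1"
      by (intro AE_I2) (simp only: prob.emeasure_space_1 ennreal_1 order_refl)
  qed
  have int_bdd: "integrable \<rho> f"
    if "f \<in> borel_measurable path_space" "\<And>\<omega>. \<omega> \<in> paths \<Longrightarrow> \<bar>f \<omega>\<bar> \<le> B" for f :: "(real \<Rightarrow> 'x \<times> 'g) \<Rightarrow> real" and B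
    using that by (intro \<rho>.integrable_const_bound[of _ B]) (auto simp: meas_\<rho> space_\<rho>)
  have AE_\<rho>: "AE \<omega> in P d. Q \<omega>" if "AE \<omega> in \<rho>. Q \<omega>" "Measurable.pred path_space Q" "d \<in> D" for Q d
  proof -
    have "AE n in q. AE \<omega> in P (s n). Q \<omega>"
      using that(1) unfolding \<rho>_def AE_bind[OF kernel that(2)] .
    then have "AE \<omega> in P (s n). Q \<omega>" for n
      unfolding q_def AE_measure_pmf_iff by (simp add: set_pmf_geometric)
    with that(3) range_s show ?thesis by blast
  qed

  let ?F = "completion limit_space"
  let ?Z = "indicator A :: (real \<Rightarrow> 'x \<times> 'g) \<Rightarrow> real"
  have F_sub: "sets ?F \<subseteq> sets path_space" by (rule universal_completion_subset) simp
  interpret F: finite_measure_subalgebra \<rho> ?F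
    by unfold_locales (use F_sub sets_\<rho> space_\<rho> in \<open>simp add: subalgebra_def\<close>)
  have Z: "?Z \<in> borel_measurable path_inv_space" using A by (intro borel_measurable_indicator) simp
  have Z_bound: "\<bar>?Z \<omega>\<bar> \<le> 1" for \<omega> by (simp add: indicator_def)
  have Zi: "?Z \<in> borel_measurable (completion path_inv_space)"
    by (rule measurable_universal_completionI[OF Z _ path_inv_subset_path_space]) simp
  have Zp: "?Z \<in> borel_measurable path_space"
    by (rule measurable_universal_completion_path_space[OF Zi]) simp
  have Z_int: "integrable \<rho> ?Z" by (rule int_bdd[OF Zp Z_bound])
  define W0 where "W0 = real_cond_exp \<rho> ?F ?Z"
  \<comment> \<open>truncated so that it is bounded everywhere and not just almost surely\<close>
  define W where "W \<omega> = max 0 (min 1 (W0 \<omega>))" for \<omega>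
  have W0F: "W0 \<in> borel_measurable ?F" unfolding W0_def by (rule borel_measurable_cond_exp)
  have WF: "W \<in> borel_measurable ?F"
    unfolding W_def by (intro borel_measurable_max borel_measurable_min borel_measurable_const W0F)
  have "AE \<omega> in \<rho>. 0 \<le> W0 \<omega>" "AE \<omega> in \<rho>. W0 \<omega> \<le> 1"
    unfolding W0_def by (intro F.real_cond_exp_ge_c F.real_cond_exp_le_c Z_int; simp)+
  then have W_eq: "AE \<omega> in \<rho>. W \<omega> = W0 \<omega>" by eventually_elim (simp add: W_def)
  have W_bound: "\<bar>W \<omega>\<bar> \<le> 1" for \<omega> by (simp add: W_def)
  define Y where "Y \<omega> = ?Z \<omega> - W \<omega>" for \<omega>
  have Wi: "W \<in> borel_measurable (completion path_inv_space)" by (rule completion_limit_inv[OF WF])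
  have Yi: "Y \<in> borel_measurable (completion path_inv_space)"
    unfolding Y_def by (intro borel_measurable_diff Zi Wi)
  have Yp: "Y \<in> borel_measurable path_space" by (rule measurable_universal_completion_path_space[OF Yi]) simp
  have Wp: "W \<in> borel_measurable path_space" by (rule measurable_universal_completion_path_space[OF WF]) simp
  have W0p: "W0 \<in> borel_measurable path_space" by (rule measurable_universal_completion_path_space[OF W0F]) simp
  have Y_bound: "\<bar>Y \<omega>\<bar> \<le> 1" for \<omega> by (auto simp: Y_def W_def indicator_def)

  have ortho: "(\<integral>\<omega>. T \<omega> * Y \<omega> \<partial>\<rho>) = 0"
    if T: "T \<in> borel_measurable ?F" "\<And>\<omega>. \<omega> \<in> paths \<Longrightarrow> \<bar>T \<omega>\<bar> \<le> 1" for T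
  proof -
    have Tp: "T \<in> borel_measurable path_space" by (rule measurable_universal_completion_path_space[OF T(1)]) simp
    have prod_bound: "\<bar>T \<omega> * f \<omega>\<bar> \<le> 1 * 1" if "\<bar>f \<omega>\<bar> \<le> 1" "\<omega> \<in> paths" for f and \<omega> :: "real \<Rightarrow> 'x \<times> 'g"
      unfolding abs_mult using T(2)[OF that(2)] that(1) by (intro mult_mono) auto
    have TZ: "integrable \<rho> (\<lambda>\<omega>. T \<omega> * ?Z \<omega>)"
      by (rule int_bdd[OF _ prod_bound]) (intro borel_measurable_times Tp Zp, rule Z_bound)
    have TW: "integrable \<rho> (\<lambda>\<omega>. T \<omega> * W \<omega>)"
      by (rule int_bdd[OF _ prod_bound]) (intro borel_measurable_times Tp Wp, rule W_bound)
    have "(\<integral>\<omega>. T \<omega> * W \<omega> \<partial>\<rho>) = (\<integral>\<omega>. T \<omega> * W0 \<omega> \<partial>\<rho>)"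
      by (rule integral_cong_AE)
        (use W_eq in \<open>auto simp: meas_\<rho> elim: eventually_mono intro!: borel_measurable_times Tp Wp W0p\<close>)
    also have "\<dots> = (\<integral>\<omega>. T \<omega> * ?Z \<omega> \<partial>\<rho>)"
      unfolding W0_def using Zp by (intro F.real_cond_exp_intg(2)[OF TZ T(1)]) (simp add: meas_\<rho>)
    finally show ?thesis
      unfolding Y_def right_diff_distrib using TZ TW by simp
  qed

  have "\<exists>x. \<forall>n. measure (P (x n, \<one>)) {\<omega> \<in> paths. ginf \<omega> \<notin> unit_nbhds n} < inverse (real (Suc n))"
    by (intro choice allI ginf_concentrates unit_nbhds(1,2)) simp
  then obtain x where
    x: "\<And>n. measure (P (x n, \<one>)) {\<omega> \<in> paths. ginf \<omega> \<notin> unit_nbhds n} < inverse (real (Suc n))" by blast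
  have x_lim: "(\<lambda>n. measure (P (x n, \<one>)) {\<omega> \<in> paths. ginf \<omega> \<notin> unit_nbhds n}) \<longlonglongrightarrow> 0"
    by (rule tendsto_sandwich[OF _ _ tendsto_const LIMSEQ_inverse_real_of_nat])
      (use x in \<open>auto intro!: always_eventually less_imp_le\<close>)
  have avg: "average (x n) ?Z \<in> borel_measurable ?F" for n
    by (rule average_measurable_limit[OF Z Z_bound])
  have avg_p: "average (x n) ?Z \<in> borel_measurable path_space" for n
    by (rule measurable_universal_completion_path_space[OF avg]) simp
  have avg_bound: "\<bar>average (x n) ?Z \<omega>\<bar> \<le> 1" if "\<omega> \<in> paths" for n \<omega>
    unfolding average_eq_smoothed
    by (rule smoothed_bound[OF _ Z_bound act_in_paths[OF that]])
      (rule measurable_from_subalg[OF _ Z], use path_inv_subset_coord in \<open>simp add: subalgebra_def\<close>)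
  have prod1: "\<bar>a * b\<bar> \<le> 1" if "\<bar>a\<bar> \<le> 1" "\<bar>b\<bar> \<le> 1" for a b :: real
    unfolding abs_mult using mult_mono[OF that] by simp
  have ZY0: "(\<integral>\<omega>. ?Z \<omega> * Y \<omega> \<partial>\<rho>) = 0"
  proof -
    have "(\<lambda>n. \<integral>j. (\<integral>\<omega>. average (x n) ?Z \<omega> * Y \<omega> \<partial>P (s j)) \<partial>q)
        \<longlonglongrightarrow> (\<integral>j. (\<integral>\<omega>. ?Z \<omega> * Y \<omega> \<partial>P (s j)) \<partial>q)"
    proof (rule integral_dominated_convergence[where w="\<lambda>_. 1"])
      show "AE j in q. (\<lambda>n. \<integral>\<omega>. average (x n) ?Z \<omega> * Y \<omega> \<partial>P (s j)) \<longlonglongrightarrow> (\<integral>\<omega>. ?Z \<omega> * Y \<omega> \<partial>P (s j))"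
        by (intro AE_I2 expectation_average_tendsto[OF Z Z_bound Yi Y_bound x_lim])
      have "\<bar>\<integral>\<omega>. average (x n) ?Z \<omega> * Y \<omega> \<partial>P (s j)\<bar> \<le> 1" for n j
        by (rule expectation_bounded)
          (intro borel_measurable_times avg_p Yp, intro prod1 avg_bound Y_bound)
      then show "AE j in q. norm (\<integral>\<omega>. average (x n) ?Z \<omega> * Y \<omega> \<partial>P (s j)) \<le> 1" for n
        by (intro AE_I2) simp
    qed (simp_all add: q_def)
    moreover have "(\<integral>j. (\<integral>\<omega>. average (x n) ?Z \<omega> * Y \<omega> \<partial>P (s j)) \<partial>q) = 0" for n
    proof -
      have "(\<integral>\<omega>. average (x n) ?Z \<omega> * Y \<omega> \<partial>\<rho>) = (\<integral>j. (\<integral>\<omega>. average (x n) ?Z \<omega> * Y \<omega> \<partial>P (s j)) \<partial>q)"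
        by (rule int_\<rho>[of _ 1]) (intro borel_measurable_times avg_p Yp, intro prod1 avg_bound Y_bound)
      with ortho[OF avg avg_bound, of n] show ?thesis by simp
    qed
    moreover have "(\<integral>\<omega>. ?Z \<omega> * Y \<omega> \<partial>\<rho>) = (\<integral>j. (\<integral>\<omega>. ?Z \<omega> * Y \<omega> \<partial>P (s j)) \<partial>q)"
      by (rule int_\<rho>[of _ 1]) (intro borel_measurable_times Zp Yp, intro prod1 Z_bound Y_bound)
    ultimately show ?thesis by (simp add: LIMSEQ_const_iff)
  qed
  have "(\<integral>\<omega>. Y \<omega> * Y \<omega> \<partial>\<rho>) = (\<integral>\<omega>. ?Z \<omega> * Y \<omega> \<partial>\<rho>) - (\<integral>\<omega>. W \<omega> * Y \<omega> \<partial>\<rho>)"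
  proof -
    have "integrable \<rho> (\<lambda>\<omega>. ?Z \<omega> * Y \<omega>)"
      by (rule int_bdd[of _ 1]) (intro borel_measurable_times Zp Yp, intro prod1 Z_bound Y_bound)
    moreover have "integrable \<rho> (\<lambda>\<omega>. W \<omega> * Y \<omega>)"
      by (rule int_bdd[of _ 1]) (intro borel_measurable_times Wp Yp, intro prod1 W_bound Y_bound)
    moreover have "Y \<omega> * Y \<omega> = ?Z \<omega> * Y \<omega> - W \<omega> * Y \<omega>" for \<omega>
      by (simp add: Y_def algebra_simps)
    ultimately show ?thesis by simp
  qed
  then have "(\<integral>\<omega>. Y \<omega> * Y \<omega> \<partial>\<rho>) = 0" using ZY0 ortho[OF WF W_bound] by simp
  moreover have "integrable \<rho> (\<lambda>\<omega>. Y \<omega> * Y \<omega>)"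
    by (rule int_bdd[of _ 1]) (intro borel_measurable_times Yp, intro prod1 Y_bound)
  ultimately have "AE \<omega> in \<rho>. Y \<omega> * Y \<omega> = 0"
    by (subst (asm) integral_nonneg_eq_0_iff_AE) auto
  then have ZW: "AE \<omega> in \<rho>. ?Z \<omega> = W \<omega>" by eventually_elim (simp add: Y_def)

  define B where "B = {\<omega> \<in> space ?F. W \<omega> = 1}"
  have B: "B \<in> sets ?F" unfolding B_def using WF by measurable
  have Ap: "A \<in> sets path_space" using A path_inv_subset_path_space by auto
  have Bp: "B \<in> sets path_space" using B F_sub by blast
  have Ac: "A \<in> sets (completion path_inv_space)"
    using in_universal_completion[of path_inv_space P, OF _ path_inv_subset_path_space] A by auto
  have "B \<in> sets (completion path_inv_space)"
  proof -
    have "(\<lambda>\<omega>. W \<omega>) -` {1} \<inter> space (completion path_inv_space) \<in> sets (completion path_inv_space)"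
      by (rule measurable_sets[OF Wi]) simp
    moreover have "W -` {1} \<inter> paths = B" by (auto simp: B_def)
    ultimately show ?thesis by simp
  qed
  with Ac have S: "sym_diff A B \<in> sets (completion path_inv_space)" by auto
  have "AE \<omega> in \<rho>. \<omega> \<notin> sym_diff A B"
    using ZW AE_space[of \<rho>]
    by eventually_elim (auto simp: B_def space_\<rho> indicator_def split: if_splits)
  then have null_dense: "AE \<omega> in P d. \<omega> \<notin> sym_diff A B" if "d \<in> D" for d
    by (rule AE_\<rho>[OF _ _ that]) (use Ap Bp in measurable)
  have null: "AE \<omega> in P z. \<omega> \<notin> sym_diff A B" for z
  proof (rule AE_from_dense[OF S])
    show "\<exists>d\<in>D. d \<in> X" if "open X" "X \<noteq> {}" for X by (rule D(2)[OF that])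
  qed (rule null_dense)
  obtain B' where B': "B' \<in> sets limit_space" "\<And>z. AE \<omega> in P z. \<omega> \<in> B' \<longleftrightarrow> \<omega> \<in> B"
    using B by (auto simp: sets_universal_completion)
  have "AE \<omega> in P z. \<omega> \<in> B' \<longleftrightarrow> \<omega> \<in> A" for z
    using null[of z] B'(2)[of z] by eventually_elim auto
  with B'(1) Ap show ?thesis by (subst sets_universal_completion) auto
qed

theorem invariant_eq_limits_mod_null:
  "eq_mod_null {P z} (inv_sets (\<lambda>t \<omega>. \<omega> t)) (sets limit_space)"
  unfolding eq_mod_null_def
proof (intro conjI ballI)
  fix A :: "(real \<Rightarrow> 'x \<times> 'g) set" assume A: "A \<in> inv_sets (\<lambda>t \<omega>. \<omega> t)"
  obtain B where B: "B \<in> sets limit_space" "\<And>z. AE \<omega> in P z. \<omega> \<in> B \<longleftrightarrow> \<omega> \<in> A"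
    using invariant_measurable_limits[OF A] by (auto simp: sets_universal_completion)
  have "AE \<omega> in P z. \<omega> \<in> A \<longleftrightarrow> \<omega> \<in> B" using B(2)[of z] by eventually_elim blast
  then have "sym_diff A B \<in> null_sets (P z)"
    using A B(1) path_inv_subset_path_space limit_space_path_space
    by (intro sym_diff_null_of_AE_iff) auto
  with B(1) show "\<exists>B\<in>sets limit_space. \<forall>Q\<in>{P z}. sym_diff A B \<in> null_sets Q" by auto
next
  fix B assume B: "B \<in> sets limit_space"
  then have "B \<in> sets (completion path_inv_space)" using limit_space_subset by blast
  then obtain A where A: "A \<in> inv_sets (\<lambda>t \<omega>. \<omega> t)" "\<And>z. AE \<omega> in P z. \<omega> \<in> A \<longleftrightarrow> \<omega> \<in> B"
    by (auto simp: sets_universal_completion)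
  have "sym_diff A B \<in> null_sets (P z)"
    using A B path_inv_subset_path_space limit_space_path_space
    by (intro sym_diff_null_of_AE_iff) auto
  with A(1) show "\<exists>A\<in>inv_sets (\<lambda>t \<omega>. \<omega> t). \<forall>Q\<in>{P z}. sym_diff A B \<in> null_sets Q" by auto
qed

text \<open>
  The level sets of the limit of \<open>H\<close> along the path are, up to null sets, preimages of measurable
  sets under the pair of limits; \<open>\<psi>\<close> is reassembled from these.
\<close>

theorem harmonic_representation:
  assumes H: "harmonic P H"
  shows "\<exists>\<psi>\<in>borel_measurable (\<Lambda> \<Otimes>\<^sub>M borel). bounded (\<psi> ` space (\<Lambda> \<Otimes>\<^sub>M borel)) \<and>
    (\<forall>z. H z = (\<integral>\<omega>. \<psi> (linf \<omega>, ginf \<omega>) \<partial>P z))"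
proof -
  obtain C where C: "\<And>z. \<bar>H z\<bar> \<le> C" using harmonicD(3)[OF H] by auto
  have cont: "continuous_on UNIV H" using regular H by (simp add: regular_def)
  let ?Z = "\<lambda>\<omega> :: real \<Rightarrow> 'x \<times> 'g. limsup_at_top (\<lambda>t. H (\<omega> t))"
  have Z: "?Z \<in> borel_measurable path_inv_space"
    by (rule measurable_limsup_at_top[OF continuous_on_id cont])
  have Zp: "?Z \<in> borel_measurable path_space"
    by (rule measurable_from_subalg[OF _ Z]) (use path_inv_subset_path_space in \<open>simp add: subalgebra_def\<close>)
  have lim: "AE \<omega> in P z. (\<lambda>n. H (\<omega> (real n))) \<longlonglongrightarrow> ?Z \<omega>" for z
    using harmonic_converges[OF H cont, of z]
  proof eventually_elim
    case (elim \<omega>)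
    then obtain l where l: "((\<lambda>t. H (\<omega> t)) \<longlongrightarrow> l) at_top" by blast
    from filterlim_compose[OF l filterlim_real_sequentially] limsup_at_top_eq[OF l]
    show ?case by simp
  qed
  have Z_bound: "AE \<omega> in P z. \<bar>?Z \<omega>\<bar> \<le> C" for z
    using lim[of z]
  proof eventually_elim
    case (elim \<omega>)
    then have "(\<lambda>n. \<bar>H (\<omega> (real n))\<bar>) \<longlonglongrightarrow> \<bar>?Z \<omega>\<bar>" by (intro tendsto_intros)
    then show ?case by (rule LIMSEQ_le_const2) (use C in blast)
  qed
  have H_eq: "H z = (\<integral>\<omega>. ?Z \<omega> \<partial>P z)" for z
  proof -
    have "(\<lambda>n. \<integral>\<omega>. H (\<omega> (real n)) \<partial>P z) \<longlonglongrightarrow> (\<integral>\<omega>. ?Z \<omega> \<partial>P z)"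
      by (rule integral_dominated_convergence[where w="\<lambda>_. C"])
        (simp_all add: measurable_P_eq Zp lim C measurable_along_path[OF harmonicD(1)[OF H]])
    moreover have "(\<integral>\<omega>. H (\<omega> (real n)) \<partial>P z) = H z" for n
      by (rule harmonicD(2)[OF H, symmetric]) simp
    ultimately show ?thesis by (simp add: LIMSEQ_const_iff)
  qed
  have "\<exists>S. S \<in> sets (\<Lambda> \<Otimes>\<^sub>M borel) \<and> (\<forall>z. AE \<omega> in P z. (linf \<omega>, ginf \<omega>) \<in> S \<longleftrightarrow> ?Z \<omega> < of_rat r)" for r :: rat
  proof -
    have "{\<omega> \<in> space path_inv_space. ?Z \<omega> < of_rat r} \<in> sets path_inv_space"
      using Z by measurable
    then have "{\<omega> \<in> paths. ?Z \<omega> < of_rat r} \<in> sets (completion limit_space)"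
      by (intro invariant_measurable_limits) simp
    then obtain B where B: "B \<in> sets limit_space"
      "\<And>z. AE \<omega> in P z. \<omega> \<in> B \<longleftrightarrow> \<omega> \<in> {\<omega> \<in> paths. ?Z \<omega> < of_rat r}"
      by (auto simp: sets_universal_completion)
    from B(1) obtain S where S: "S \<in> sets (\<Lambda> \<Otimes>\<^sub>M borel)" "B = (\<lambda>\<omega>. (linf \<omega>, ginf \<omega>)) -` S \<inter> paths"
      unfolding sets_limit_space by blast
    have "AE \<omega> in P z. (linf \<omega>, ginf \<omega>) \<in> S \<longleftrightarrow> ?Z \<omega> < of_rat r" for z
      using B(2)[of z] AE_space[of "P z"] by eventually_elim (auto simp: S(2))
    with S(1) show ?thesis by blast
  qed
  then have "\<exists>S. \<forall>r :: rat. S r \<in> sets (\<Lambda> \<Otimes>\<^sub>M borel) \<and>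
      (\<forall>z. AE \<omega> in P z. (linf \<omega>, ginf \<omega>) \<in> S r \<longleftrightarrow> ?Z \<omega> < of_rat r)"
    by (intro choice allI)
  then obtain S where S: "\<And>r :: rat. S r \<in> sets (\<Lambda> \<Otimes>\<^sub>M borel)"
    "\<And>r z. AE \<omega> in P z. (linf \<omega>, ginf \<omega>) \<in> S r \<longleftrightarrow> ?Z \<omega> < of_rat r" by blast
  define \<psi>0 where "\<psi>0 y = (SUP r :: rat. if y \<in> S r then - \<infinity> else ereal (of_rat r))" for y
  define \<psi> where "\<psi> y = max (- C) (min C (real_of_ereal (\<psi>0 y)))" for y
  have "\<psi>0 \<in> borel_measurable (\<Lambda> \<Otimes>\<^sub>M borel)"
    unfolding \<psi>0_def
  proof (intro borel_measurable_SUP measurable_If measurable_const)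
    show "{y \<in> space (\<Lambda> \<Otimes>\<^sub>M borel). y \<in> S r} \<in> sets (\<Lambda> \<Otimes>\<^sub>M borel)" for r
      using S(1)[of r] sets.sets_into_space[OF S(1)[of r]] by (simp add: Int_absorb1 Collect_conj_eq)
  qed simp_all
  then have \<psi>: "\<psi> \<in> borel_measurable (\<Lambda> \<Otimes>\<^sub>M borel)"
    unfolding \<psi>_def by measurable
  have "bounded (\<psi> ` space (\<Lambda> \<Otimes>\<^sub>M borel))"
    by (intro boundedI[where B="\<bar>C\<bar>"]) (auto simp: \<psi>_def)
  moreover have "H z = (\<integral>\<omega>. \<psi> (linf \<omega>, ginf \<omega>) \<partial>P z)" for z
  proof (rule trans[OF H_eq integral_cong_AE])
    show "?Z \<in> borel_measurable (P z)" using Zp unfolding measurable_P_eq .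
    show "(\<lambda>\<omega>. \<psi> (linf \<omega>, ginf \<omega>)) \<in> borel_measurable (P z)"
      unfolding measurable_P_eq
      by (rule measurable_compose[OF _ \<psi>]) (intro measurable_Pair measurable_linf measurable_ginf)
    have "AE \<omega> in P z. \<forall>r. (linf \<omega>, ginf \<omega>) \<in> S r \<longleftrightarrow> ?Z \<omega> < of_rat r"
      unfolding AE_all_countable using S(2) by blast
    with Z_bound[of z] show "AE \<omega> in P z. ?Z \<omega> = \<psi> (linf \<omega>, ginf \<omega>)"
    proof eventually_elim
      case (elim \<omega>)
      have "\<psi>0 (linf \<omega>, ginf \<omega>) = ereal (?Z \<omega>)"
        unfolding \<psi>0_def
      proof (rule SUP_eqI)
        show "(if (linf \<omega>, ginf \<omega>) \<in> S r then - \<infinity> else ereal (of_rat r)) \<le> ereal (?Z \<omega>)" for r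
          using elim(2) by simp
        fix y assume y: "\<And>r. r \<in> UNIV \<Longrightarrow> (if (linf \<omega>, ginf \<omega>) \<in> S r then - \<infinity> else ereal (of_rat r)) \<le> y"
        show "ereal (?Z \<omega>) \<le> y"
        proof (rule ccontr)
          assume "\<not> ereal (?Z \<omega>) \<le> y"
          then obtain r where r: "y < ereal (of_rat r)" "ereal (of_rat r) < ereal (?Z \<omega>)"
            using ereal_dense3[of y "ereal (?Z \<omega>)"] by (auto simp: not_le)
          then have "(linf \<omega>, ginf \<omega>) \<notin> S r" using elim(2) by simp
          with y[of r] r(1) show False by simp
        qed
      qed
      with elim(1) show ?case by (simp add: \<psi>_def)
    qed
  qed
  ultimately show ?thesis using \<psi> by blast
qed

end

theorem theorem2:
  fixes \<X> :: "('x::{t2_space, second_countable_topology}, 'e::euclidean_space) chart set"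
    and \<G> :: "('g::{t2_space, second_countable_topology}, 'f::euclidean_space) chart set"
    and G :: "('g, 'm) monoid_scheme"
    and L :: "('x \<times> 'g \<Rightarrow> real) \<Rightarrow> 'x \<times> 'g \<Rightarrow> real"
    and P :: "'x \<times> 'g \<Rightarrow> (real \<Rightarrow> 'x \<times> 'g) measure"
    and \<Lambda> :: "'s measure"
    and linf :: "(real \<Rightarrow> 'x \<times> 'g) \<Rightarrow> 's"
    and ginf :: "(real \<Rightarrow> 'x \<times> 'g) \<Rightarrow> 'g"
  assumes "smooth_manifold \<X>"
    and "lie_group G \<G>" and "connected (UNIV :: 'g set)"
    and "diffusion (prod_atlas \<X> \<G>) L P"
    and "devissage \<X> P \<Lambda> linf"
    and "convergence_to P ginf"
    and "equivariant (prod_atlas \<X> \<G>) G L"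
    and "regular P"
  shows "(\<forall>x g. eq_mod_null {P (x, g)} (inv_sets (\<lambda>t \<omega>. \<omega> t))
            (sets (vimage_algebra paths (\<lambda>\<omega>. (linf \<omega>, ginf \<omega>)) (\<Lambda> \<Otimes>\<^sub>M borel)))) \<and>
         (\<forall>H. harmonic P H \<longrightarrow>
            (\<exists>\<psi> \<in> borel_measurable (\<Lambda> \<Otimes>\<^sub>M borel). bounded (\<psi> ` space (\<Lambda> \<Otimes>\<^sub>M borel)) \<and>
               (\<forall>x g. H (x, g) = (\<integral>\<omega>. \<psi> (linf \<omega>, ginf \<omega>) \<partial>P (x, g)))))"
proof -
  note lie = lie_groupD[OF assms(2)]
  interpret group G by (rule lie(1))
  interpret equivariant_devissage P G ginf \<Lambda> linf
  proof
    show "strong_markov_family P" using assms(4) unfolding diffusion_def by blast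
    show "carrier G = UNIV" by (rule lie(2))
    show "continuous_on UNIV (\<lambda>(a, b). a \<otimes>\<^bsub>G\<^esub> b)" by (rule lie(5))
    show "continuous_on UNIV (\<lambda>a. inv\<^bsub>G\<^esub> a)" by (rule lie(6))
    show "distr (P z) path_space (path_map (left_mult G a)) = P (left_mult G a z)" for z a
      by (rule diffusion_left_mult_law[OF assms(1,2,4,7)])
    show "regular P" by (rule assms(8))
    show "convergence_to P ginf" by (rule assms(6))
    show "linf \<in> path_space \<rightarrow>\<^sub>M \<Lambda>" using assms(5) unfolding devissage_def by blast
    show "eq_mod_null (range P) (inv_sets (\<lambda>t \<omega>. fst (\<omega> t))) (sets (vimage_algebra paths linf \<Lambda>))"
      using assms(5) unfolding devissage_def by blast
  qed
  show ?thesis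
  proof (intro conjI allI impI)
    show "eq_mod_null {P (x, g)} (inv_sets (\<lambda>t \<omega>. \<omega> t))
        (sets (vimage_algebra paths (\<lambda>\<omega>. (linf \<omega>, ginf \<omega>)) (\<Lambda> \<Otimes>\<^sub>M borel)))" for x g
      by (rule invariant_eq_limits_mod_null)
  next
    fix H assume "harmonic P H"
    from harmonic_representation[OF this] obtain \<psi> where
      "\<psi> \<in> borel_measurable (\<Lambda> \<Otimes>\<^sub>M borel)" "bounded (\<psi> ` space (\<Lambda> \<Otimes>\<^sub>M borel))"
      "\<And>z. H z = (\<integral>\<omega>. \<psi> (linf \<omega>, ginf \<omega>) \<partial>P z)" by blast
    then show "\<exists>\<psi> \<in> borel_measurable (\<Lambda> \<Otimes>\<^sub>M borel). bounded (\<psi> ` space (\<Lambda> \<Otimes>\<^sub>M borel)) \<and>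
        (\<forall>x g. H (x, g) = (\<integral>\<omega>. \<psi> (linf \<omega>, ginf \<omega>) \<partial>P (x, g)))"
      by (intro bexI[of _ \<psi>] conjI allI)
  qed
qed

end
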